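(* The class $\mathcal{P}_{\mathcal{HN}}$ of hyper-nuclear homogeneous polynomials is the smallest Banach polynomial $\left(1,\frac{n^n}{n!}\right)_{n=1}^\infty$-two-sided ideal (resp. the smallest Banach polynomial hyper-ideal) in the following sense: $\mathcal{P}_{\mathcal{HN}}$ is a Banach polynomial $\left(1,\frac{n^n}{n!}\right)_{n=1}^\infty$-two-sided ideal (resp. a Banach polynomial hyper-ideal), and if $\mathcal{Q}$ is a Banach polynomial $(C_n,K_n)_{n=1}^\infty$-two-sided ideal (resp. a Banach polynomial $(C_n)_{n=1}^\infty$-hyper-ideal), then $\mathcal{P}_{\mathcal{HN}}\subseteq\mathcal{Q}$ and $\|P\|_{\mathcal Q}\le C_n\|P\|_{\mathcal{P}_{\mathcal{HN}}}$ for all $n\in\mathbb{N}$, Banach spaces $E,F$ and $P\in\mathcal{P}_{\mathcal{HN}}(^nE;F)$.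
   Context: All Banach spaces are over $\mathbb{K}=\mathbb{R}$ or $\mathbb{C}$. $\mathcal{P}(^nE;F)$ ($n\ge 1$) is the Banach space of continuous $n$-homogeneous polynomials from $E$ to $F$ with the sup norm $\|\cdot\|$; $\mathcal{P}(^nE)=\mathcal{P}(^nE;\mathbb{K})$, $\mathcal{L}(E;F)=\mathcal{P}(^1E;F)$, $E'=\mathcal{P}(^1E)$. $P\in\mathcal{P}(^nE;F)$ is hyper-nuclear, written $P\in\mathcal{P}_{\mathcal{HN}}(^nE;F)$, if there are $(\lambda_j)_j\in\ell_1$, a bounded sequence $(P_j)_j$ in $\mathcal{P}(^nE)$ and a bounded sequence $(y_j)_j$ in $F$ with $P(x)=\sum_{j=1}^\infty\lambda_jP_j(x)y_j$ for every $x\in E$; $\|P\|_{\mathcal{P}_{\mathcal{HN}}}=\inf\left\{\|(\lambda_j)\|_1\cdot\sup_j\|P_j\|\cdot\sup_j\|y_j\|\right\}$ over all such representations. A polynomial of finite type is a finite sum of polynomials $x\mapsto\varphi(x)^n y$ with $\varphi\in E'$, $y\in F$. A class of polynomials is a subclass $\mathcal{Q}$ of the class of all continuous homogeneous polynomials between Banach spaces, endowed with a function $\|\cdot\|_{\mathcal Q}\colon\mathcal{Q}\to[0,\infty)$; put $\mathcal{Q}(^nE;F)=\mathcal{P}(^nE;F)\cap\mathcal{Q}$. Let $(C_n)_n$, $(K_n)_n$ be sequences of real numbers $\ge 1$ with $C_1=K_1=1$. Consider: (i) each $\mathcal{Q}(^nE;F)$ is a linear subspace of $\mathcal{P}(^nE;F)$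 containing the $n$-homogeneous polynomials of finite type; (ii) $\|\cdot\|_{\mathcal Q}$ restricted to each $\mathcal{Q}(^nE;F)$ is a complete norm; (iii) $\|\widehat{I_n}\|_{\mathcal Q}=1$ for every $n$, where $\widehat{I_n}\colon\mathbb{K}\to\mathbb{K}$, $\widehat{I_n}(\lambda)=\lambda^n$. $\mathcal{Q}$ is a Banach polynomial $(C_n)_n$-hyper-ideal if (i)-(iii) hold and: for all $n,m$ and Banach spaces $E,F,G,H$, if $P\in\mathcal{Q}(^nE;F)$, $Q\in\mathcal{P}(^mG;E)$, $t\in\mathcal{L}(F;H)$, then $t\circ P\circ Q\in\mathcal{Q}(^{mn}G;H)$ and $\|t\circ P\circ Q\|_{\mathcal Q}\le C_m^n\|t\|\,\|P\|_{\mathcal Q}\|Q\|^n$. It is called a Banach polynomial hyper-ideal if $C_n=1$ for all $n$. $\mathcal{Q}$ is a Banach polynomial $(C_n,K_n)_n$-two-sided ideal if (i)-(iii) hold and: for all $n,m,r$ and Banach spaces $E,F,G,H$, if $P\in\mathcal{Q}(^nE;F)$, $Q\in\mathcal{P}(^mG;E)$, $R\in\mathcal{P}(^rF;H)$, then $R\circ P\circ Q\in\mathcal{Q}(^{rmn}G;H)$ and $\|R\circ P\circ Q\|_{\mathcal Q}\le K_r C_m^{rn}\|R\|\,\|P\|_{\mathcal Q}^r\|Q\|^{rn}$. *)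

theory Defs
  imports
    "HOL-Analysis.Analysis"
    "HOL-Algebra.Module"
    "HOL-Algebra.Algebraic_Closure_Type"
begin

section \<open>Banach spaces with explicit carriers\<close>

text \<open>
  The notions below quantify over all Banach spaces at once, so a Banach space is a structure on
  a carrier set rather than a type of class \<open>banach\<close>.

  The scalar field is a type \<open>'k\<close> of classes \<open>real_normed_field\<close> and \<open>banach\<close>. A commutative field
  with a multiplicative norm extending that of the reals is the real or the complex field
  (Gelfand-Mazur), so these are exactly the two cases, up to isometric isomorphism. The ring
  structure of \<open>'k\<close> is the library's \<open>ring_of_type_algebra\<close>.

  The fields \<open>mult\<close> and \<open>one\<close> that a module record inherits from the ring record play no role.
\<close>

record ('k, 'a) nvs = "('k, 'a) module" +
  nrm :: "'a \<Rightarrow> real"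

text \<open>Outside the carrier the distance is 0, because the locale \<open>Metric_space\<close> asks for symmetry
  and nonnegativity on the whole type.\<close>

definition ndist :: "('k, 'a) nvs \<Rightarrow> 'a \<Rightarrow> 'a \<Rightarrow> real" where
  "ndist E x y = (if x \<in> carrier E \<and> y \<in> carrier E then nrm E (x \<ominus>\<^bsub>E\<^esub> y) else 0)"

definition ntop :: "('k, 'a) nvs \<Rightarrow> 'a topology" where
  "ntop E = Metric_space.mtopology (carrier E) (ndist E)"

definition Banach_space :: "('k::{real_normed_field, banach}, 'a) nvs \<Rightarrow> bool" where
  "Banach_space E \<longleftrightarrow>
     Module.module (ring_of_type_algebra :: 'k ring) E \<and>
     (\<forall>x\<in>carrier E. 0 \<le> nrm E x \<and> (nrm E x = 0 \<longleftrightarrow> x = \<zero>\<^bsub>E\<^esub>)) \<and>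
     (\<forall>a. \<forall>x\<in>carrier E. nrm E (a \<odot>\<^bsub>E\<^esub> x) = norm a * nrm E x) \<and>
     (\<forall>x\<in>carrier E. \<forall>y\<in>carrier E. nrm E (x \<oplus>\<^bsub>E\<^esub> y) \<le> nrm E x + nrm E y) \<and>
     Metric_space.mcomplete (carrier E) (ndist E)"

definition scalar_space :: "('k::{real_normed_field, banach}, 'k) nvs" where
  "scalar_space = \<lparr>carrier = UNIV, monoid.mult = (*), one = 1, ring.zero = 0, add = (+),
     smult = (*), nrm = norm\<rparr>"


section \<open>Continuous homogeneous polynomials\<close>

definition multilinear ::
    "nat \<Rightarrow> ('k::{real_normed_field, banach}, 'a) nvs \<Rightarrow> ('k, 'b) nvs \<Rightarrow> ((nat \<Rightarrow> 'a) \<Rightarrow> 'b) \<Rightarrow> bool"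
  where
  "multilinear n E F A \<longleftrightarrow>
     (\<forall>x \<in> {..<n} \<rightarrow>\<^sub>E carrier E. A x \<in> carrier F) \<and>
     (\<forall>x \<in> {..<n} \<rightarrow>\<^sub>E carrier E. \<forall>i<n. \<forall>u\<in>carrier E. \<forall>v\<in>carrier E.
        A (x(i := u \<oplus>\<^bsub>E\<^esub> v)) = A (x(i := u)) \<oplus>\<^bsub>F\<^esub> A (x(i := v))) \<and>
     (\<forall>x \<in> {..<n} \<rightarrow>\<^sub>E carrier E. \<forall>i<n. \<forall>a. \<forall>u\<in>carrier E.
        A (x(i := a \<odot>\<^bsub>E\<^esub> u)) = a \<odot>\<^bsub>F\<^esub> A (x(i := u)))"

text \<open>Polynomials are extensional functions (\<open>undefined\<close> outside the carrier of the domain), so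
  that equality of polynomials is equality of functions.\<close>

definition hom_polys ::
    "nat \<Rightarrow> ('k::{real_normed_field, banach}, 'a) nvs \<Rightarrow> ('k, 'b) nvs \<Rightarrow> ('a \<Rightarrow> 'b) set" where
  "hom_polys n E F = {P \<in> carrier E \<rightarrow>\<^sub>E carrier F.
     continuous_map (ntop E) (ntop F) P \<and>
     (\<exists>A. multilinear n E F A \<and> (\<forall>x\<in>carrier E. P x = A (\<lambda>i\<in>{..<n}. x)))}"

definition sup_norm ::
    "('k::{real_normed_field, banach}, 'a) nvs \<Rightarrow> ('k, 'b) nvs \<Rightarrow> ('a \<Rightarrow> 'b) \<Rightarrow> real" where
  "sup_norm E F P = (SUP x\<in>{x \<in> carrier E. nrm E x \<le> 1}. nrm F (P x))"

definition hom_poly_space ::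
    "nat \<Rightarrow> ('k::{real_normed_field, banach}, 'a) nvs \<Rightarrow> ('k, 'b) nvs \<Rightarrow> ('k, 'a \<Rightarrow> 'b) nvs" where
  "hom_poly_space n E F = \<lparr>carrier = hom_polys n E F,
     monoid.mult = undefined, one = undefined,
     ring.zero = (\<lambda>x\<in>carrier E. \<zero>\<^bsub>F\<^esub>),
     add = (\<lambda>P Q. \<lambda>x\<in>carrier E. P x \<oplus>\<^bsub>F\<^esub> Q x),
     smult = (\<lambda>a P. \<lambda>x\<in>carrier E. a \<odot>\<^bsub>F\<^esub> P x),
     nrm = sup_norm E F\<rparr>"

definition finite_type ::
    "nat \<Rightarrow> ('k::{real_normed_field, banach}, 'a) nvs \<Rightarrow> ('k, 'b) nvs \<Rightarrow> ('a \<Rightarrow> 'b) set" where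
  "finite_type n E F = {P \<in> carrier E \<rightarrow>\<^sub>E carrier F.
     \<exists>(k::nat) \<phi> y. (\<forall>i<k. \<phi> i \<in> hom_polys 1 E scalar_space \<and> y i \<in> carrier F) \<and>
       (\<forall>x\<in>carrier E. P x = finsum F (\<lambda>i. (\<phi> i x ^ n) \<odot>\<^bsub>F\<^esub> y i) {..<k})}"


section \<open>Hyper-nuclear polynomials\<close>

definition hyper_nuclear_rep ::
    "nat \<Rightarrow> ('k::{real_normed_field, banach}, 'a) nvs \<Rightarrow> ('k, 'b) nvs \<Rightarrow> ('a \<Rightarrow> 'b) \<Rightarrow>
     (nat \<Rightarrow> 'k) \<Rightarrow> (nat \<Rightarrow> 'a \<Rightarrow> 'k) \<Rightarrow> (nat \<Rightarrow> 'b) \<Rightarrow> bool" where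
  "hyper_nuclear_rep n E F P lam p y \<longleftrightarrow>
     summable (\<lambda>j. norm (lam j)) \<and>
     (\<forall>j. p j \<in> hom_polys n E scalar_space) \<and>
     bdd_above (range (\<lambda>j. sup_norm E scalar_space (p j))) \<and>
     (\<forall>j. y j \<in> carrier F) \<and>
     bdd_above (range (\<lambda>j. nrm F (y j))) \<and>
     (\<forall>x\<in>carrier E. limitin (ntop F)
        (\<lambda>N. finsum F (\<lambda>j. (lam j * p j x) \<odot>\<^bsub>F\<^esub> y j) {..<N}) (P x) sequentially)"

definition hyper_nuclear ::
    "nat \<Rightarrow> ('k::{real_normed_field, banach}, 'a) nvs \<Rightarrow> ('k, 'b) nvs \<Rightarrow> ('a \<Rightarrow> 'b) set" where
  "hyper_nuclear n E F = {P \<in> hom_polys n E F. \<exists>lam p y. hyper_nuclear_rep n E F P lam p y}"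

definition hyper_nuclear_norm ::
    "nat \<Rightarrow> ('k::{real_normed_field, banach}, 'a) nvs \<Rightarrow> ('k, 'b) nvs \<Rightarrow> ('a \<Rightarrow> 'b) \<Rightarrow> real" where
  "hyper_nuclear_norm n E F P = Inf {(\<Sum>j. norm (lam j)) *
       (SUP j. sup_norm E scalar_space (p j)) * (SUP j. nrm F (y j)) | lam p y.
     hyper_nuclear_rep n E F P lam p y}"


section \<open>Classes of polynomials and ideals\<close>

text \<open>
  A class of polynomials ranges over all Banach spaces whose carrier is a set of elements of one
  type \<open>'k + 'u\<close>, with \<open>'u\<close> arbitrary; results are polymorphic in \<open>'u\<close>, so every set of Banach
  spaces is covered by a suitable \<open>'u\<close>. The summand \<open>'k\<close> makes the scalar field itself one of
  these spaces.

  A polynomial of the class is recorded together with its domain and codomain space. Its degree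
  is not recorded: it is determined by the polynomial, except that the zero polynomial has every
  degree.
\<close>

type_synonym ('k, 'u) space = "('k, 'k + 'u) nvs"
type_synonym ('k, 'u) class_polynomial =
  "('k, 'u) space \<times> ('k, 'u) space \<times> ('k + 'u \<Rightarrow> 'k + 'u)"

definition scalar_copy :: "('k::{real_normed_field, banach}, 'u) space" where
  "scalar_copy = \<lparr>carrier = range Inl,
     monoid.mult = (\<lambda>x y. Inl (projl x * projl y)), one = Inl 1,
     ring.zero = Inl 0, add = (\<lambda>x y. Inl (projl x + projl y)),
     smult = (\<lambda>a x. Inl (a * projl x)), nrm = (\<lambda>x. norm (projl x))\<rparr>"

definition scalar_power :: "nat \<Rightarrow> 'k::{real_normed_field, banach} + 'u \<Rightarrow> 'k + 'u" where
  "scalar_power n = (\<lambda>x\<in>range Inl. Inl (projl x ^ n))"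

definition comp_of ::
    "('k::{real_normed_field, banach}, 'u) class_polynomial set \<Rightarrow> nat \<Rightarrow>
     ('k, 'u) space \<Rightarrow> ('k, 'u) space \<Rightarrow> ('k + 'u \<Rightarrow> 'k + 'u) set" where
  "comp_of Q n E F = {P \<in> hom_polys n E F. (E, F, P) \<in> Q}"

definition polynomial_class ::
    "('k::{real_normed_field, banach}, 'u) class_polynomial set \<Rightarrow>
     (('k, 'u) class_polynomial \<Rightarrow> real) \<Rightarrow> bool" where
  "polynomial_class Q N \<longleftrightarrow>
     Q \<subseteq> {(E, F, P). Banach_space E \<and> Banach_space F \<and> (\<exists>n\<ge>1. P \<in> hom_polys n E F)} \<and>
     (\<forall>q\<in>Q. 0 \<le> N q)"

definition Banach_polynomial_class ::
    "('k::{real_normed_field, banach}, 'u) class_polynomial set \<Rightarrow>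
     (('k, 'u) class_polynomial \<Rightarrow> real) \<Rightarrow> bool" where
  "Banach_polynomial_class Q N \<longleftrightarrow>
     polynomial_class Q N \<and>
     (\<forall>n\<ge>1. \<forall>E F. Banach_space E \<longrightarrow> Banach_space F \<longrightarrow>
        submodule (comp_of Q n E F) (ring_of_type_algebra :: 'k ring) (hom_poly_space n E F) \<and>
        finite_type n E F \<subseteq> comp_of Q n E F \<and>
        Banach_space (hom_poly_space n E F
          \<lparr>carrier := comp_of Q n E F, nrm := (\<lambda>P. N (E, F, P))\<rparr>)) \<and>
     (\<forall>n\<ge>1. N (scalar_copy, scalar_copy, scalar_power n) = 1)"

definition ideal_constants :: "(nat \<Rightarrow> real) \<Rightarrow> bool" where
  "ideal_constants C \<longleftrightarrow> C 1 = 1 \<and> (\<forall>n\<ge>1. 1 \<le> C n)"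

definition hyper_ideal ::
    "(nat \<Rightarrow> real) \<Rightarrow> ('k::{real_normed_field, banach}, 'u) class_polynomial set \<Rightarrow>
     (('k, 'u) class_polynomial \<Rightarrow> real) \<Rightarrow> bool" where
  "hyper_ideal C Q N \<longleftrightarrow>
     ideal_constants C \<and> Banach_polynomial_class Q N \<and>
     (\<forall>n\<ge>1. \<forall>m\<ge>1. \<forall>E F G H P R t.
        Banach_space E \<longrightarrow> Banach_space F \<longrightarrow> Banach_space G \<longrightarrow> Banach_space H \<longrightarrow>
        P \<in> comp_of Q n E F \<longrightarrow> R \<in> hom_polys m G E \<longrightarrow> t \<in> hom_polys 1 F H \<longrightarrow>
        (let S = compose (carrier G) t (compose (carrier G) P R) in
           S \<in> comp_of Q (m * n) G H \<and>
           N (G, H, S) \<le> C m ^ n * sup_norm F H t * N (E, F, P) * sup_norm G E R ^ n))"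

definition two_sided_ideal ::
    "(nat \<Rightarrow> real) \<Rightarrow> (nat \<Rightarrow> real) \<Rightarrow> ('k::{real_normed_field, banach}, 'u) class_polynomial set \<Rightarrow>
     (('k, 'u) class_polynomial \<Rightarrow> real) \<Rightarrow> bool" where
  "two_sided_ideal C K Q N \<longleftrightarrow>
     ideal_constants C \<and> ideal_constants K \<and> Banach_polynomial_class Q N \<and>
     (\<forall>n\<ge>1. \<forall>m\<ge>1. \<forall>r\<ge>1. \<forall>E F G H P R T.
        Banach_space E \<longrightarrow> Banach_space F \<longrightarrow> Banach_space G \<longrightarrow> Banach_space H \<longrightarrow>
        P \<in> comp_of Q n E F \<longrightarrow> R \<in> hom_polys m G E \<longrightarrow> T \<in> hom_polys r F H \<longrightarrow>
        (let S = compose (carrier G) T (compose (carrier G) P R) in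
           S \<in> comp_of Q (r * m * n) G H \<and>
           N (G, H, S) \<le> K r * C m ^ (r * n) * sup_norm F H T *
             N (E, F, P) ^ r * sup_norm G E R ^ (r * n)))"

definition HN :: "('k::{real_normed_field, banach}, 'u) class_polynomial set" where
  "HN = {(E, F, P). Banach_space E \<and> Banach_space F \<and> (\<exists>n\<ge>1. P \<in> hyper_nuclear n E F)}"

text \<open>The choice of degree matters only for the zero polynomial, whose norm is 0 in every degree.\<close>

definition HN_norm :: "('k::{real_normed_field, banach}, 'u) class_polynomial \<Rightarrow> real" where
  "HN_norm = (\<lambda>(E, F, P). hyper_nuclear_norm (LEAST n. 1 \<le> n \<and> P \<in> hyper_nuclear n E F) E F P)"

end

theory Submission
  imports Defs
begin

text \<open>
  A hyper-nuclear polynomial is the sum of an absolutely convergent series of rank-one polynomials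
  \<open>x \<mapsto> p(x) y\<close>, and its norm is the infimum of the costs \<open>\<Sum> \<parallel>p\<^sub>i\<parallel> \<parallel>y\<^sub>i\<parallel>\<close> of such representations.
  A representation may be indexed by any countable set (\<open>hyper_nuclear_if_nuclear_sum\<close>,
  \<open>hyper_nuclear_nuclear_sum\<close>), so that a series of hyper-nuclear polynomials is represented over
  pairs of indices (\<open>hyper_nuclear_series\<close>, which gives the triangle inequality and completeness),
  and a composition \<open>T \<circ> P \<circ> R\<close> over multi-indices: if \<open>B\<close> is the symmetric \<open>r\<close>-linear map
  belonging to \<open>T\<close>, then \<open>T(P(R(x)))\<close> is the sum of \<open>p\<^sub>j\<^sub>1(R x) \<cdots> p\<^sub>j\<^sub>r(R x) B(y\<^sub>j\<^sub>1, \<dots>, y\<^sub>j\<^sub>r)\<close>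
  over all \<open>(j\<^sub>1, \<dots>, j\<^sub>r)\<close>. The polarization inequality \<open>\<parallel>B\<parallel> \<le> (r^r / r!) \<parallel>T\<parallel>\<close> provides the
  constant of the two-sided ideal property, and the costs multiply to an \<open>r\<close>-th power
  (\<open>hyper_nuclear_compose\<close>).

  Polarization serves a second purpose. It passes a norm bound for a polynomial on to its symmetric
  multilinear map, which makes the polynomial Lipschitz on balls. A homogeneous polynomial is
  therefore continuous if and only if it satisfies \<open>\<parallel>P x\<parallel> \<le> M \<parallel>x\<parallel>^n\<close> (\<open>hom_polysI\<close>, \<open>hom_polysE\<close>),
  and all closure properties of the continuous polynomials, including the one under absolutely
  convergent series (\<open>hom_polys_abs_sums\<close>), are reduced to estimates of norms.

  For minimality, a two-sided ideal is a hyper-ideal, by taking the outer polynomial to be linear.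
  In a hyper-ideal \<open>Q\<close>, the rank-one polynomial \<open>x \<mapsto> p(x) y\<close> is the composition of \<open>p\<close>, the
  identity of the scalars, which has norm 1 in \<open>Q\<close>, and the linear map \<open>\<lambda> \<mapsto> \<lambda> y\<close>; its norm in \<open>Q\<close>
  is thus at most \<open>C\<^sub>n \<parallel>p\<parallel> \<parallel>y\<parallel>\<close> (\<open>rank_one_in_hyper_ideal\<close>). A representation of \<open>P\<close> with cost \<open>c\<close>
  then converges absolutely in \<open>Q\<close> to a polynomial \<open>S\<close> of norm at most \<open>C\<^sub>n c\<close>. It remains to see
  that \<open>S = P\<close>, that is, to compare convergence in \<open>Q\<close> with convergence at a point \<open>x\<close>. Let \<open>q(u)\<close>
  be the norm in \<open>Q\<close> of the polynomial \<open>\<lambda> \<mapsto> \<lambda>^n u\<close> on the scalars. Composing with \<open>\<lambda> \<mapsto> \<lambda> x\<close> shows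
  \<open>q(D x) \<le> \<parallel>D\<parallel>\<^sub>Q \<parallel>x\<parallel>^n\<close> for all \<open>D\<close> in \<open>Q\<close> (\<open>hyper_ideal_eval_bound\<close>), and \<open>q(u) \<le> C\<^sub>n \<parallel>u\<parallel>\<close>
  because \<open>\<lambda> \<mapsto> \<lambda>^n u\<close> has rank one. So the values at \<open>x\<close> of the partial sums tend both to \<open>S x\<close>
  and to \<open>P x\<close> for the norm \<open>q\<close>, and \<open>S x = P x\<close> (\<open>hyper_nuclear_in_hyper_ideal\<close>).
\<close>


section \<open>Normed spaces on a carrier\<close>

lemma ring_of_type_algebra_simps [simp]:
  "carrier (ring_of_type_algebra :: 'k::comm_ring_1 ring) = UNIV"
  "add (ring_of_type_algebra :: 'k::comm_ring_1 ring) = (+)"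
  "monoid.mult (ring_of_type_algebra :: 'k::comm_ring_1 ring) = (*)"
  "ring.zero (ring_of_type_algebra :: 'k::comm_ring_1 ring) = 0"
  "one (ring_of_type_algebra :: 'k::comm_ring_1 ring) = 1"
  by (simp_all add: ring_of_type_algebra_def fun_eq_iff)

lemma ring_of_type_algebra_uminus [simp]:
  "\<ominus>\<^bsub>(ring_of_type_algebra :: 'k::comm_ring_1 ring)\<^esub> x = - x"
proof -
  interpret cring "ring_of_type_algebra :: 'k ring"
    by (rule cring_from_type_algebra)
  show ?thesis
    by (rule minus_equality) simp_all
qed

text \<open>The axioms of a Banach space other than completeness. They are kept apart because a space of
  polynomials has to be recognized as normed before its series can be discussed.\<close>

locale normed_carrier = module "ring_of_type_algebra :: 'k ring" E
  for E :: "('k::{real_normed_field, banach}, 'a) nvs" +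
  assumes nrm_nonneg [simp]: "x \<in> carrier E \<Longrightarrow> 0 \<le> nrm E x"
    and nrm_eq_0_iff [simp]: "x \<in> carrier E \<Longrightarrow> nrm E x = 0 \<longleftrightarrow> x = \<zero>\<^bsub>E\<^esub>"
    and nrm_smult [simp]: "x \<in> carrier E \<Longrightarrow> nrm E (a \<odot>\<^bsub>E\<^esub> x) = norm a * nrm E x"
    and nrm_triangle:
      "x \<in> carrier E \<Longrightarrow> y \<in> carrier E \<Longrightarrow> nrm E (x \<oplus>\<^bsub>E\<^esub> y) \<le> nrm E x + nrm E y"

locale banach_carrier = normed_carrier +
  assumes mcomplete: "Metric_space.mcomplete (carrier E) (ndist E)"

lemma Banach_space_iff: "Banach_space E \<longleftrightarrow> banach_carrier E"
  unfolding Banach_space_def banach_carrier_def banach_carrier_axioms_def normed_carrier_def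
    normed_carrier_axioms_def by blast

lemma normed_carrierI:
  fixes E :: "('k::{real_normed_field, banach}, 'a) nvs"
  assumes "Module.module (ring_of_type_algebra :: 'k ring) E"
    and "\<And>x. x \<in> carrier E \<Longrightarrow> 0 \<le> nrm E x"
    and "\<And>x. x \<in> carrier E \<Longrightarrow> nrm E x = 0 \<longleftrightarrow> x = \<zero>\<^bsub>E\<^esub>"
    and "\<And>a x. x \<in> carrier E \<Longrightarrow> nrm E (a \<odot>\<^bsub>E\<^esub> x) = norm a * nrm E x"
    and "\<And>x y. x \<in> carrier E \<Longrightarrow> y \<in> carrier E \<Longrightarrow> nrm E (x \<oplus>\<^bsub>E\<^esub> y) \<le> nrm E x + nrm E y"
  shows "normed_carrier E"
  using assms by (simp add: normed_carrier_def normed_carrier_axioms_def)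

context normed_carrier
begin

lemma nrm_zero [simp]: "nrm E \<zero>\<^bsub>E\<^esub> = 0"
  by simp

lemma smult_minus_one: "x \<in> carrier E \<Longrightarrow> (- 1) \<odot>\<^bsub>E\<^esub> x = \<ominus>\<^bsub>E\<^esub> x"
  using smult_l_minus[of 1 x] smult_one by simp

lemma nrm_minus [simp]: "x \<in> carrier E \<Longrightarrow> nrm E (\<ominus>\<^bsub>E\<^esub> x) = nrm E x"
  by (metis smult_minus_one nrm_smult norm_minus_cancel norm_one mult_1)

lemma minus_swap: "x \<in> carrier E \<Longrightarrow> y \<in> carrier E \<Longrightarrow> \<ominus>\<^bsub>E\<^esub> (x \<ominus>\<^bsub>E\<^esub> y) = y \<ominus>\<^bsub>E\<^esub> x"
  by (simp add: a_minus_def M.minus_add M.a_comm)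

lemma nrm_diff_commute:
  "x \<in> carrier E \<Longrightarrow> y \<in> carrier E \<Longrightarrow> nrm E (x \<ominus>\<^bsub>E\<^esub> y) = nrm E (y \<ominus>\<^bsub>E\<^esub> x)"
  by (metis minus_swap nrm_minus M.minus_closed)

lemma diff_add_diff:
  "x \<in> carrier E \<Longrightarrow> y \<in> carrier E \<Longrightarrow> z \<in> carrier E \<Longrightarrow>
    (x \<ominus>\<^bsub>E\<^esub> y) \<oplus>\<^bsub>E\<^esub> (y \<ominus>\<^bsub>E\<^esub> z) = x \<ominus>\<^bsub>E\<^esub> z"
  by (simp add: a_minus_def M.a_assoc M.add.inv_solve_left' M.add.inv_mult_group
      flip: M.a_assoc)
    (simp add: M.a_assoc M.l_neg)

lemma nrm_diff_triangle:
  assumes "x \<in> carrier E" "y \<in> carrier E" "z \<in> carrier E"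
  shows "nrm E (x \<ominus>\<^bsub>E\<^esub> z) \<le> nrm E (x \<ominus>\<^bsub>E\<^esub> y) + nrm E (y \<ominus>\<^bsub>E\<^esub> z)"
  using assms nrm_triangle[of "x \<ominus>\<^bsub>E\<^esub> y" "y \<ominus>\<^bsub>E\<^esub> z"] by (simp add: diff_add_diff)

lemma add_diff_add:
  assumes "a \<in> carrier E" "b \<in> carrier E" "c \<in> carrier E" "d \<in> carrier E"
  shows "(a \<oplus>\<^bsub>E\<^esub> b) \<ominus>\<^bsub>E\<^esub> (c \<oplus>\<^bsub>E\<^esub> d) = (a \<ominus>\<^bsub>E\<^esub> c) \<oplus>\<^bsub>E\<^esub> (b \<ominus>\<^bsub>E\<^esub> d)"
  using assms by (simp add: a_minus_def M.minus_add M.a_ac)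

lemma diff_self [simp]: "a \<in> carrier E \<Longrightarrow> a \<ominus>\<^bsub>E\<^esub> a = \<zero>\<^bsub>E\<^esub>"
  by (simp add: a_minus_def M.r_neg)

lemma diff_eq_zero_iff [simp]:
  "a \<in> carrier E \<Longrightarrow> b \<in> carrier E \<Longrightarrow> a \<ominus>\<^bsub>E\<^esub> b = \<zero>\<^bsub>E\<^esub> \<longleftrightarrow> a = b"
  by (metis M.add.inv_closed M.minus_equality M.minus_minus M.r_neg a_minus_def)

lemma nrm_diff_le:
  "x \<in> carrier E \<Longrightarrow> y \<in> carrier E \<Longrightarrow> nrm E (x \<ominus>\<^bsub>E\<^esub> y) \<le> nrm E x + nrm E y"
  using nrm_triangle[of x "\<ominus>\<^bsub>E\<^esub> y"] by (simp add: a_minus_def)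

lemma smult_diff:
  "x \<in> carrier E \<Longrightarrow> y \<in> carrier E \<Longrightarrow>
    a \<odot>\<^bsub>E\<^esub> x \<ominus>\<^bsub>E\<^esub> a \<odot>\<^bsub>E\<^esub> y = a \<odot>\<^bsub>E\<^esub> (x \<ominus>\<^bsub>E\<^esub> y)"
  by (simp add: a_minus_def smult_r_distr smult_r_minus)

lemma diff_zero [simp]: "x \<in> carrier E \<Longrightarrow> x \<ominus>\<^bsub>E\<^esub> \<zero>\<^bsub>E\<^esub> = x"
  using smult_diff[of x "\<zero>\<^bsub>E\<^esub>" 0] smult_minus_one[of "\<zero>\<^bsub>E\<^esub>"] by (simp add: a_minus_def)

lemma nrm_le_add_diff:
  assumes "x \<in> carrier E" "y \<in> carrier E"
  shows "nrm E x \<le> nrm E y + nrm E (x \<ominus>\<^bsub>E\<^esub> y)"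
  using nrm_diff_triangle[of x y "\<zero>\<^bsub>E\<^esub>"] assms by (simp add: diff_zero)

lemma nrm_finsum_le:
  assumes "f \<in> A \<rightarrow> carrier E"
  shows "nrm E (finsum E f A) \<le> (\<Sum>i\<in>A. nrm E (f i))"
  using assms
proof (induction A rule: infinite_finite_induct)
  case (insert a A)
  then have "nrm E (finsum E f (insert a A)) \<le> nrm E (f a) + nrm E (finsum E f A)"
    by (auto intro!: nrm_triangle simp: Pi_def)
  then show ?case
    using insert by auto
qed auto

lemma Metric_space_ndist: "Metric_space (carrier E) (ndist E)"
proof
  fix x y z
  show "0 \<le> ndist E x y"
    by (simp add: ndist_def)
  show "ndist E x y = ndist E y x"
    by (simp add: ndist_def nrm_diff_commute)
  assume "x \<in> carrier E" "y \<in> carrier E"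
  then show "ndist E x y = 0 \<longleftrightarrow> x = y"
    by (simp add: ndist_def)
  assume "z \<in> carrier E"
  then show "ndist E x z \<le> ndist E x y + ndist E y z"
    using \<open>x \<in> carrier E\<close> \<open>y \<in> carrier E\<close> by (simp add: ndist_def nrm_diff_triangle)
qed

sublocale metric: Metric_space "carrier E" "ndist E"
  by (rule Metric_space_ndist)

lemma limitin_ntop_iff:
  assumes "\<And>n. f n \<in> carrier E"
  shows "limitin (ntop E) f l F \<longleftrightarrow>
    l \<in> carrier E \<and> ((\<lambda>n. nrm E (f n \<ominus>\<^bsub>E\<^esub> l)) \<longlongrightarrow> 0) F"
proof (cases "l \<in> carrier E")
  case True
  then have "(\<lambda>n. ndist E (f n) l) = (\<lambda>n. nrm E (f n \<ominus>\<^bsub>E\<^esub> l))"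
    using assms by (simp add: ndist_def)
  then show ?thesis
    using assms True by (simp add: ntop_def metric.limitin_metric_dist_null)
qed (use metric.limitin_mspace in \<open>auto simp: ntop_def\<close>)

lemma limitin_ntop_unique:
  assumes "limitin (ntop E) f l F" "limitin (ntop E) f l' F" "F \<noteq> bot"
  shows "l = l'"
  using metric.limitin_metric_unique assms unfolding ntop_def by blast

text \<open>The summands that the two sums have in common cancel.\<close>

lemma nrm_finsum_diff_le:
  assumes "finite A" "finite B" "f \<in> A \<union> B \<rightarrow> carrier E"
  shows "nrm E (finsum E f A \<ominus>\<^bsub>E\<^esub> finsum E f B) \<le>
    (\<Sum>i\<in>A - B. nrm E (f i)) + (\<Sum>i\<in>B - A. nrm E (f i))"
proof -
  have split: "finsum E f S = finsum E f (S \<inter> T) \<oplus>\<^bsub>E\<^esub> finsum E f (S - T)"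
    if "finite S" "f \<in> S \<rightarrow> carrier E" for S T
  proof -
    have "finsum E f ((S \<inter> T) \<union> (S - T)) = finsum E f (S \<inter> T) \<oplus>\<^bsub>E\<^esub> finsum E f (S - T)"
      by (rule M.finsum_Un_disjoint) (use that in auto)
    moreover have "(S \<inter> T) \<union> (S - T) = S"
      by blast
    ultimately show ?thesis
      by simp
  qed
  have "f \<in> A \<inter> B \<rightarrow> carrier E" "f \<in> A - B \<rightarrow> carrier E" "f \<in> B - A \<rightarrow> carrier E"
    using assms(3) by auto
  note cl = this[THEN M.finsum_closed]
  have "finsum E f A \<ominus>\<^bsub>E\<^esub> finsum E f B =
      (finsum E f (A \<inter> B) \<oplus>\<^bsub>E\<^esub> finsum E f (A - B)) \<ominus>\<^bsub>E\<^esub>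
      (finsum E f (A \<inter> B) \<oplus>\<^bsub>E\<^esub> finsum E f (B - A))"
    using split[of A B] split[of B A] assms by (simp add: Int_commute)
  also have "\<dots> = finsum E f (A - B) \<ominus>\<^bsub>E\<^esub> finsum E f (B - A)"
    by (subst add_diff_add) (auto simp: cl)
  finally have "nrm E (finsum E f A \<ominus>\<^bsub>E\<^esub> finsum E f B) \<le>
      nrm E (finsum E f (A - B)) + nrm E (finsum E f (B - A))"
    using nrm_diff_le[OF cl(2,3)] by auto
  also have "\<dots> \<le> (\<Sum>i\<in>A - B. nrm E (f i)) + (\<Sum>i\<in>B - A. nrm E (f i))"
    using assms by (intro add_mono nrm_finsum_le) auto
  finally show ?thesis .
qed

end


section \<open>Absolutely convergent sums\<close>

lemma eventually_filterlim_finite_subsets: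
  assumes "filterlim h (finite_subsets_at_top I) F"
  shows "\<forall>\<^sub>F n in F. finite (h n) \<and> h n \<subseteq> I"
proof -
  have "\<forall>\<^sub>F A in finite_subsets_at_top I. finite A \<and> A \<subseteq> I"
    by (rule eventually_finite_subsets_at_top_weakI) simp
  then show ?thesis
    using assms unfolding filterlim_iff by blast
qed

lemma infsum_Diff_finite_tendsto_0:
  fixes g :: "'i \<Rightarrow> real"
  assumes "g summable_on I" "filterlim h (finite_subsets_at_top I) F"
  shows "((\<lambda>n. \<Sum>\<^sub>\<infinity>i\<in>I - h n. g i) \<longlongrightarrow> 0) F"
proof -
  have *: "(\<Sum>\<^sub>\<infinity>i\<in>I - A. g i) = (\<Sum>\<^sub>\<infinity>i\<in>I. g i) - sum g A" if "finite A" "A \<subseteq> I" for A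
    using infsum_Diff[OF assms(1), of A] that by simp
  have "((\<lambda>n. (\<Sum>\<^sub>\<infinity>i\<in>I. g i) - sum g (h n)) \<longlongrightarrow> (\<Sum>\<^sub>\<infinity>i\<in>I. g i) - (\<Sum>\<^sub>\<infinity>i\<in>I. g i)) F"
    by (intro tendsto_diff tendsto_const filterlim_compose[OF infsum_tendsto assms(2)] assms)
  moreover from eventually_filterlim_finite_subsets[OF assms(2)] have "\<forall>\<^sub>F n in F. (\<Sum>\<^sub>\<infinity>i\<in>I. g i) - sum g (h n) = (\<Sum>\<^sub>\<infinity>i\<in>I - h n. g i)"
    by eventually_elim (simp add: *)
  ultimately show ?thesis
    by (simp add: tendsto_cong)
qed

lemma infsum_Diff_finite_small:
  fixes g :: "'i \<Rightarrow> real"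
  assumes "g summable_on I" "e > 0"
  obtains A where "finite A" "A \<subseteq> I" "(\<Sum>\<^sub>\<infinity>i\<in>I - A. g i) < e"
proof -
  have "((\<lambda>A. \<Sum>\<^sub>\<infinity>i\<in>I - A. g i) \<longlongrightarrow> 0) (finite_subsets_at_top I)"
    using infsum_Diff_finite_tendsto_0[OF assms(1), of "\<lambda>x. x"] filterlim_ident by blast
  then have "\<forall>\<^sub>F A in finite_subsets_at_top I. (\<Sum>\<^sub>\<infinity>i\<in>I - A. g i) < e"
    using assms(2) order_tendstoD(2) by blast
  then show thesis
    using that unfolding eventually_finite_subsets_at_top by blast
qed

lemma sum_le_infsum_subset:
  fixes g :: "'i \<Rightarrow> real"
  assumes "g summable_on I" "finite A" "A \<subseteq> B" "B \<subseteq> I" "\<And>i. i \<in> I \<Longrightarrow> 0 \<le> g i"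
  shows "sum g A \<le> infsum g B"
  using assms by (intro finite_sum_le_infsum summable_on_subset_banach[OF assms(1)]) auto

text \<open>Absolutely convergent summation over an arbitrary index set. The sum is pinned down by an
  estimate of the remainders instead of a limit: the estimate survives reindexing and splitting of
  the index set directly, and at \<open>A = {}\<close> it bounds the norm of the sum.\<close>

definition abs_sums ::
    "('k::{real_normed_field, banach}, 'a) nvs \<Rightarrow> ('i \<Rightarrow> 'a) \<Rightarrow> 'i set \<Rightarrow> 'a \<Rightarrow> bool" where
  "abs_sums E f I s \<longleftrightarrow>
     f \<in> I \<rightarrow> carrier E \<and> s \<in> carrier E \<and> (\<lambda>i. nrm E (f i)) summable_on I \<and>
     (\<forall>A. finite A \<longrightarrow> A \<subseteq> I \<longrightarrow>
        nrm E (s \<ominus>\<^bsub>E\<^esub> finsum E f A) \<le> (\<Sum>\<^sub>\<infinity>i\<in>I - A. nrm E (f i)))"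

context normed_carrier
begin

lemma abs_sumsD:
  assumes "abs_sums E f I s"
  shows "f \<in> I \<rightarrow> carrier E" "s \<in> carrier E" "(\<lambda>i. nrm E (f i)) summable_on I"
    "\<And>A. finite A \<Longrightarrow> A \<subseteq> I \<Longrightarrow>
      nrm E (s \<ominus>\<^bsub>E\<^esub> finsum E f A) \<le> (\<Sum>\<^sub>\<infinity>i\<in>I - A. nrm E (f i))"
  using assms by (auto simp: abs_sums_def)

lemma abs_sums_tendsto:
  assumes "abs_sums E f I s" "filterlim h (finite_subsets_at_top I) F"
  shows "((\<lambda>n. nrm E (finsum E f (h n) \<ominus>\<^bsub>E\<^esub> s)) \<longlongrightarrow> 0) F"
proof (rule tendsto_sandwich[OF _ _ tendsto_const
      infsum_Diff_finite_tendsto_0[OF abs_sumsD(3)[OF assms(1)] assms(2)]])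
  note D = abs_sumsD[OF assms(1)]
  note ev = eventually_filterlim_finite_subsets[OF assms(2)]
  have cl: "finsum E f A \<in> carrier E" if "A \<subseteq> I" for A
    using D(1) that by (intro M.finsum_closed) auto
  from ev show "\<forall>\<^sub>F n in F. 0 \<le> nrm E (finsum E f (h n) \<ominus>\<^bsub>E\<^esub> s)"
    by eventually_elim (simp add: cl D(2))
  from ev show "\<forall>\<^sub>F n in F. nrm E (finsum E f (h n) \<ominus>\<^bsub>E\<^esub> s) \<le> (\<Sum>\<^sub>\<infinity>i\<in>I - h n. nrm E (f i))"
    by eventually_elim (simp add: nrm_diff_commute[OF cl D(2)] D(4))
qed

lemma abs_sums_unique:
  assumes "abs_sums E f I s" "abs_sums E f I t"
  shows "s = t"
proof (rule ccontr)
  assume "s \<noteq> t"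
  note S = abs_sumsD[OF assms(1)] and T = abs_sumsD[OF assms(2)]
  have "nrm E (s \<ominus>\<^bsub>E\<^esub> t) > 0"
    using \<open>s \<noteq> t\<close> S(2) T(2) by (simp add: order.strict_iff_order)
  then obtain A where A: "finite A" "A \<subseteq> I"
      "(\<Sum>\<^sub>\<infinity>i\<in>I - A. nrm E (f i)) < nrm E (s \<ominus>\<^bsub>E\<^esub> t) / 2"
    using infsum_Diff_finite_small[OF S(3), of "nrm E (s \<ominus>\<^bsub>E\<^esub> t) / 2"] by auto
  have cl: "finsum E f A \<in> carrier E"
    using S(1) A by (intro M.finsum_closed) auto
  have "nrm E (s \<ominus>\<^bsub>E\<^esub> t) \<le> nrm E (s \<ominus>\<^bsub>E\<^esub> finsum E f A) + nrm E (finsum E f A \<ominus>\<^bsub>E\<^esub> t)"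
    by (rule nrm_diff_triangle) (use S T cl in auto)
  then show False
    using S(4)[OF A(1,2)] T(4)[OF A(1,2)] A(3) nrm_diff_commute[OF T(2) cl] by linarith
qed

lemma abs_sums_nrm_le:
  assumes "abs_sums E f I s"
  shows "nrm E s \<le> (\<Sum>\<^sub>\<infinity>i\<in>I. nrm E (f i))"
  using abs_sumsD(4)[OF assms, of "{}"] abs_sumsD(2)[OF assms] by simp

lemma abs_sums_cong:
  assumes "\<And>i. i \<in> I \<Longrightarrow> f i = g i" "I = J" "s = t"
  shows "abs_sums E f I s \<longleftrightarrow> abs_sums E g J t"
proof -
  have *: "abs_sums E g I s" if "abs_sums E f I s" "\<And>i. i \<in> I \<Longrightarrow> f i = g i" for f g
  proof -
    note D = abs_sumsD[OF that(1)]
    have g: "g \<in> I \<rightarrow> carrier E"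
      using D(1) that(2) by (auto simp: Pi_iff)
    show ?thesis
      unfolding abs_sums_def
    proof (intro conjI allI impI g D(2))
      show "(\<lambda>i. nrm E (g i)) summable_on I"
        using D(3) that(2) summable_on_cong[of I "\<lambda>i. nrm E (f i)" "\<lambda>i. nrm E (g i)"] by simp
      fix A assume A: "finite A" "A \<subseteq> I"
      have "finsum E f A = finsum E g A"
        by (rule M.finsum_cong') (use A g that in auto)
      moreover have "(\<Sum>\<^sub>\<infinity>i\<in>I - A. nrm E (f i)) = (\<Sum>\<^sub>\<infinity>i\<in>I - A. nrm E (g i))"
        by (rule infsum_cong) (simp add: that)
      ultimately show "nrm E (s \<ominus>\<^bsub>E\<^esub> finsum E g A) \<le> (\<Sum>\<^sub>\<infinity>i\<in>I - A. nrm E (g i))"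
        using D(4)[OF A] by simp
    qed
  qed
  show ?thesis
    using *[of f g] *[of g f] assms by auto
qed

lemma abs_sums_finite:
  assumes "finite I" "f \<in> I \<rightarrow> carrier E"
  shows "abs_sums E f I (finsum E f I)"
  unfolding abs_sums_def
proof (intro conjI allI impI)
  fix A assume A: "finite A" "A \<subseteq> I"
  then have *: "f \<in> I \<union> A \<rightarrow> carrier E" "A - I = {}"
    using assms by auto
  show "nrm E (finsum E f I \<ominus>\<^bsub>E\<^esub> finsum E f A) \<le> (\<Sum>\<^sub>\<infinity>i\<in>I - A. nrm E (f i))"
    using nrm_finsum_diff_le[OF assms(1) A(1) *(1)] assms(1) by (simp add: *(2))
qed (use assms in auto)

lemma abs_sums_Un_disjoint:
  assumes "abs_sums E f I s" "abs_sums E f J t" "I \<inter> J = {}"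
  shows "abs_sums E f (I \<union> J) (s \<oplus>\<^bsub>E\<^esub> t)"
  unfolding abs_sums_def
proof (intro conjI allI impI)
  note S = abs_sumsD[OF assms(1)] and T = abs_sumsD[OF assms(2)]
  show "f \<in> I \<union> J \<rightarrow> carrier E" "s \<oplus>\<^bsub>E\<^esub> t \<in> carrier E"
    using S T by auto
  show "(\<lambda>i. nrm E (f i)) summable_on I \<union> J"
    using S(3) T(3) assms(3) by (rule summable_on_Un_disjoint)
  fix A assume A: "finite A" "A \<subseteq> I \<union> J"
  define B C where "B = A \<inter> I" and "C = A \<inter> J"
  have BC: "finite B" "B \<subseteq> I" "finite C" "C \<subseteq> J" "B \<inter> C = {}" "A = B \<union> C"
    using A assms(3) by (auto simp: B_def C_def)
  have cl: "finsum E f B \<in> carrier E" "finsum E f C \<in> carrier E"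
    using S(1) T(1) BC by (auto intro!: M.finsum_closed)
  have "finsum E f A = finsum E f B \<oplus>\<^bsub>E\<^esub> finsum E f C"
    unfolding BC(6) by (rule M.finsum_Un_disjoint) (use BC S(1) T(1) in auto)
  then have "nrm E (s \<oplus>\<^bsub>E\<^esub> t \<ominus>\<^bsub>E\<^esub> finsum E f A) =
      nrm E ((s \<ominus>\<^bsub>E\<^esub> finsum E f B) \<oplus>\<^bsub>E\<^esub> (t \<ominus>\<^bsub>E\<^esub> finsum E f C))"
    by (simp add: add_diff_add cl S T)
  also have "\<dots> \<le> nrm E (s \<ominus>\<^bsub>E\<^esub> finsum E f B) + nrm E (t \<ominus>\<^bsub>E\<^esub> finsum E f C)"
    by (rule nrm_triangle) (use cl S T in auto)
  also have "\<dots> \<le> (\<Sum>\<^sub>\<infinity>i\<in>I - B. nrm E (f i)) + (\<Sum>\<^sub>\<infinity>i\<in>J - C. nrm E (f i))"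
    using S(4)[OF BC(1,2)] T(4)[OF BC(3,4)] by simp
  also have "\<dots> = (\<Sum>\<^sub>\<infinity>i\<in>(I - B) \<union> (J - C). nrm E (f i))"
    by (rule infsum_Un_disjoint[symmetric])
      (use assms(3) in \<open>auto intro: summable_on_subset_banach[OF S(3)] summable_on_subset_banach[OF T(3)]\<close>)
  also have "(I - B) \<union> (J - C) = I \<union> J - A"
    using BC assms(3) by auto
  finally show "nrm E (s \<oplus>\<^bsub>E\<^esub> t \<ominus>\<^bsub>E\<^esub> finsum E f A) \<le> (\<Sum>\<^sub>\<infinity>i\<in>I \<union> J - A. nrm E (f i))" .
qed

lemma abs_sums_zero:
  assumes "\<And>i. i \<in> I \<Longrightarrow> f i = \<zero>\<^bsub>E\<^esub>"
  shows "abs_sums E f I \<zero>\<^bsub>E\<^esub>"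
proof -
  have "abs_sums E (\<lambda>i. \<zero>\<^bsub>E\<^esub>) I \<zero>\<^bsub>E\<^esub>"
    unfolding abs_sums_def by auto
  then show ?thesis
    by (subst abs_sums_cong[OF assms refl refl])
qed

lemma abs_sums_reindex:
  assumes "inj_on h I" "abs_sums E (\<lambda>i. f (h i)) I s"
  shows "abs_sums E f (h ` I) s"
  unfolding abs_sums_def
proof (intro conjI allI impI)
  note S = abs_sumsD[OF assms(2)]
  show f: "f \<in> h ` I \<rightarrow> carrier E" "s \<in> carrier E"
    using S by auto
  show "(\<lambda>i. nrm E (f i)) summable_on h ` I"
    using S(3) summable_on_reindex[OF assms(1), of "\<lambda>i. nrm E (f i)"] by (simp add: o_def)
  fix B assume B: "finite B" "B \<subseteq> h ` I"
  then obtain A where A: "finite A" "A \<subseteq> I" "B = h ` A"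
    by (metis finite_subset_image)
  have inj: "inj_on h A" "inj_on h (I - A)"
    using A assms(1) by (auto intro: inj_on_subset)
  have "finsum E f B = finsum E (\<lambda>i. f (h i)) A"
    unfolding A(3) by (rule M.finsum_reindex) (use f A inj in auto)
  moreover have "h ` I - B = h ` (I - A)"
    using A assms(1) by (auto simp: inj_on_def)
  then have "(\<Sum>\<^sub>\<infinity>i\<in>h ` I - B. nrm E (f i)) = (\<Sum>\<^sub>\<infinity>i\<in>I - A. nrm E (f (h i)))"
    using infsum_reindex[OF inj(2), of "\<lambda>i. nrm E (f i)"] by (simp add: o_def)
  ultimately show "nrm E (s \<ominus>\<^bsub>E\<^esub> finsum E f B) \<le> (\<Sum>\<^sub>\<infinity>i\<in>h ` I - B. nrm E (f i))"
    using S(4)[OF A(1,2)] by simp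
qed

text \<open>The unconditional limit satisfies the estimate of the remainders, since a finite set \<open>B \<supseteq> A\<close>
  adds only summands outside \<open>A\<close>.\<close>

lemma abs_sumsI:
  assumes f: "f \<in> I \<rightarrow> carrier E" and s: "s \<in> carrier E"
    and summable: "(\<lambda>i. nrm E (f i)) summable_on I"
    and lim: "((\<lambda>A. nrm E (finsum E f A \<ominus>\<^bsub>E\<^esub> s)) \<longlongrightarrow> 0) (finite_subsets_at_top I)"
  shows "abs_sums E f I s"
  unfolding abs_sums_def
proof (intro conjI allI impI assms)
  fix A assume A: "finite A" "A \<subseteq> I"
  have cl: "finsum E f B \<in> carrier E" if "B \<subseteq> I" for B
    using f that by (intro M.finsum_closed) auto
  show "nrm E (s \<ominus>\<^bsub>E\<^esub> finsum E f A) \<le> (\<Sum>\<^sub>\<infinity>i\<in>I - A. nrm E (f i))"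
  proof (rule tendsto_le[OF finite_subsets_at_top_neq_bot _ tendsto_const])
    show "((\<lambda>B. nrm E (finsum E f B \<ominus>\<^bsub>E\<^esub> s) + (\<Sum>\<^sub>\<infinity>i\<in>I - A. nrm E (f i)))
        \<longlongrightarrow> (\<Sum>\<^sub>\<infinity>i\<in>I - A. nrm E (f i))) (finite_subsets_at_top I)"
      using tendsto_add[OF lim tendsto_const] by simp
    have "nrm E (s \<ominus>\<^bsub>E\<^esub> finsum E f A) \<le> nrm E (finsum E f B \<ominus>\<^bsub>E\<^esub> s) + (\<Sum>\<^sub>\<infinity>i\<in>I - A. nrm E (f i))"
      if B: "finite B" "A \<subseteq> B" "B \<subseteq> I" for B
    proof -
      have "nrm E (s \<ominus>\<^bsub>E\<^esub> finsum E f A) \<le>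
          nrm E (s \<ominus>\<^bsub>E\<^esub> finsum E f B) + nrm E (finsum E f B \<ominus>\<^bsub>E\<^esub> finsum E f A)"
        by (rule nrm_diff_triangle) (use s cl A B in auto)
      also have *: "f \<in> B \<union> A \<rightarrow> carrier E" "A - B = {}"
        using f B A by auto
      have "nrm E (finsum E f B \<ominus>\<^bsub>E\<^esub> finsum E f A) \<le> (\<Sum>i\<in>B - A. nrm E (f i))"
        using nrm_finsum_diff_le[OF B(1) A(1) *(1)] by (simp add: *(2))
      also have "\<dots> \<le> (\<Sum>\<^sub>\<infinity>i\<in>I - A. nrm E (f i))"
        by (rule sum_le_infsum_subset[OF summable]) (use B f in \<open>auto simp: Pi_iff\<close>)
      finally show ?thesis
        using nrm_diff_commute[OF s cl[OF B(3)]] by simp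
    qed
    then show "\<forall>\<^sub>F B in finite_subsets_at_top I. nrm E (s \<ominus>\<^bsub>E\<^esub> finsum E f A) \<le>
        nrm E (finsum E f B \<ominus>\<^bsub>E\<^esub> s) + (\<Sum>\<^sub>\<infinity>i\<in>I - A. nrm E (f i))"
      unfolding eventually_finite_subsets_at_top using A by blast
  qed
qed

lemma abs_sums_add:
  assumes "abs_sums E f I s" "abs_sums E g I t"
  shows "abs_sums E (\<lambda>i. f i \<oplus>\<^bsub>E\<^esub> g i) I (s \<oplus>\<^bsub>E\<^esub> t)"
proof (rule abs_sumsI)
  note S = abs_sumsD[OF assms(1)] and T = abs_sumsD[OF assms(2)]
  show "(\<lambda>i. f i \<oplus>\<^bsub>E\<^esub> g i) \<in> I \<rightarrow> carrier E" "s \<oplus>\<^bsub>E\<^esub> t \<in> carrier E"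
    using S(1,2) T(1,2) by (auto simp: Pi_def)
  have "(\<lambda>i. nrm E (f i) + nrm E (g i)) summable_on I"
    using S(3) T(3) by (rule summable_on_add)
  then show "(\<lambda>i. nrm E (f i \<oplus>\<^bsub>E\<^esub> g i)) summable_on I"
    by (rule summable_on_comparison_test) (use S(1) T(1) in \<open>auto simp: Pi_def intro!: nrm_triangle\<close>)
  note lims = abs_sums_tendsto[OF assms(1) filterlim_ident]
    abs_sums_tendsto[OF assms(2) filterlim_ident]
  show "((\<lambda>A. nrm E (finsum E (\<lambda>i. f i \<oplus>\<^bsub>E\<^esub> g i) A \<ominus>\<^bsub>E\<^esub> (s \<oplus>\<^bsub>E\<^esub> t))) \<longlongrightarrow> 0)
      (finite_subsets_at_top I)"
  proof (rule tendsto_sandwich[OF _ _ tendsto_const tendsto_add[OF lims, simplified]])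
    have cl: "finsum E f A \<in> carrier E" "finsum E g A \<in> carrier E" if "A \<subseteq> I" for A
      using S(1) T(1) that by (auto intro!: M.finsum_closed)
    have eq: "finsum E (\<lambda>i. f i \<oplus>\<^bsub>E\<^esub> g i) A = finsum E f A \<oplus>\<^bsub>E\<^esub> finsum E g A" if "A \<subseteq> I" for A
      by (rule M.finsum_addf) (use that S(1) T(1) in auto)
    show "\<forall>\<^sub>F A in finite_subsets_at_top I.
        0 \<le> nrm E (finsum E (\<lambda>i. f i \<oplus>\<^bsub>E\<^esub> g i) A \<ominus>\<^bsub>E\<^esub> (s \<oplus>\<^bsub>E\<^esub> t))"
      by (intro eventually_finite_subsets_at_top_weakI) (simp add: eq cl S(2) T(2))
    show "\<forall>\<^sub>F A in finite_subsets_at_top I.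
        nrm E (finsum E (\<lambda>i. f i \<oplus>\<^bsub>E\<^esub> g i) A \<ominus>\<^bsub>E\<^esub> (s \<oplus>\<^bsub>E\<^esub> t)) \<le>
        nrm E (finsum E f A \<ominus>\<^bsub>E\<^esub> s) + nrm E (finsum E g A \<ominus>\<^bsub>E\<^esub> t)"
      by (intro eventually_finite_subsets_at_top_weakI)
        (simp add: eq add_diff_add nrm_triangle cl S(2) T(2))
  qed
qed

lemma abs_sums_smult:
  assumes "abs_sums E f I s"
  shows "abs_sums E (\<lambda>i. a \<odot>\<^bsub>E\<^esub> f i) I (a \<odot>\<^bsub>E\<^esub> s)"
  unfolding abs_sums_def
proof (intro conjI allI impI)
  note S = abs_sumsD[OF assms]
  show f: "(\<lambda>i. a \<odot>\<^bsub>E\<^esub> f i) \<in> I \<rightarrow> carrier E" "a \<odot>\<^bsub>E\<^esub> s \<in> carrier E"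
    using S by (auto simp: Pi_def)
  have nrm: "nrm E (a \<odot>\<^bsub>E\<^esub> f i) = norm a * nrm E (f i)" if "i \<in> I" for i
    using that S(1) by (simp add: Pi_def)
  show "(\<lambda>i. nrm E (a \<odot>\<^bsub>E\<^esub> f i)) summable_on I"
    using summable_on_cong[of I "\<lambda>i. nrm E (a \<odot>\<^bsub>E\<^esub> f i)", OF nrm] summable_on_cmult_right[OF S(3)]
    by simp
  fix A assume A: "finite A" "A \<subseteq> I"
  have fA: "f \<in> A \<rightarrow> carrier E"
    using S(1) A by auto
  have eq: "(\<Oplus>\<^bsub>E\<^esub>i\<in>A. a \<odot>\<^bsub>E\<^esub> f i) = a \<odot>\<^bsub>E\<^esub> finsum E f A"
    using finsum_smult_ldistr[OF A(1) _ fA, of a] by simp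
  have "nrm E (a \<odot>\<^bsub>E\<^esub> s \<ominus>\<^bsub>E\<^esub> (\<Oplus>\<^bsub>E\<^esub>i\<in>A. a \<odot>\<^bsub>E\<^esub> f i)) = nrm E (a \<odot>\<^bsub>E\<^esub> (s \<ominus>\<^bsub>E\<^esub> finsum E f A))"
    unfolding eq using S(2) M.finsum_closed[OF fA] by (simp only: smult_diff)
  also have "\<dots> \<le> norm a * (\<Sum>\<^sub>\<infinity>i\<in>I - A. nrm E (f i))"
    using S(4)[OF A] S(2) M.finsum_closed[OF fA] by (simp add: mult_left_mono)
  also have "\<dots> = (\<Sum>\<^sub>\<infinity>i\<in>I - A. nrm E (a \<odot>\<^bsub>E\<^esub> f i))"
    by (subst infsum_cmult_right'[symmetric], rule infsum_cong) (simp add: nrm)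
  finally show "nrm E (a \<odot>\<^bsub>E\<^esub> s \<ominus>\<^bsub>E\<^esub> (\<Oplus>\<^bsub>E\<^esub>i\<in>A. a \<odot>\<^bsub>E\<^esub> f i)) \<le>
      (\<Sum>\<^sub>\<infinity>i\<in>I - A. nrm E (a \<odot>\<^bsub>E\<^esub> f i))" .
qed

end

context banach_carrier
begin

text \<open>Finite sets whose remainders are below \<open>(1 / 2)^n\<close> have partial sums that form a Cauchy
  sequence. Any finite set \<open>A\<close> can then be compared with these sets.\<close>

lemma abs_sums_exists:
  assumes "f \<in> I \<rightarrow> carrier E" "(\<lambda>i. nrm E (f i)) summable_on I"
  shows "\<exists>s. abs_sums E f I s"
proof -
  have "\<exists>A. finite A \<and> A \<subseteq> I \<and> (\<Sum>\<^sub>\<infinity>i\<in>I - A. nrm E (f i)) < (1 / 2) ^ n" for n :: nat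
    by (rule infsum_Diff_finite_small[OF assms(2), of "(1 / 2) ^ n"]) auto
  then have "\<forall>n. \<exists>A. finite A \<and> A \<subseteq> I \<and> (\<Sum>\<^sub>\<infinity>i\<in>I - A. nrm E (f i)) < (1 / 2) ^ n"
    by blast
  from choice[OF this] obtain h where h: "\<And>n. finite (h n)" "\<And>n. h n \<subseteq> I"
      "\<And>n. (\<Sum>\<^sub>\<infinity>i\<in>I - h n. nrm E (f i)) < (1 / 2) ^ n"
    by blast
  have cl: "finsum E f A \<in> carrier E" if "A \<subseteq> I" for A
    using assms(1) that by (intro M.finsum_closed) auto
  have tail: "(\<Sum>i\<in>B - A. nrm E (f i)) \<le> (\<Sum>\<^sub>\<infinity>i\<in>I - A. nrm E (f i))"
    if "finite B" "B \<subseteq> I" for A B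
    by (rule sum_le_infsum_subset[OF assms(2)]) (use that assms(1) in \<open>auto simp: Pi_iff\<close>)
  have diff: "nrm E (finsum E f A \<ominus>\<^bsub>E\<^esub> finsum E f B) \<le>
      (\<Sum>\<^sub>\<infinity>i\<in>I - A. nrm E (f i)) + (\<Sum>\<^sub>\<infinity>i\<in>I - B. nrm E (f i))"
    if "finite A" "A \<subseteq> I" "finite B" "B \<subseteq> I" for A B
  proof -
    have "f \<in> A \<union> B \<rightarrow> carrier E"
      using assms(1) that by auto
    then show ?thesis
      using nrm_finsum_diff_le[OF that(1,3), of f] tail[OF that(1,2), of B] tail[OF that(3,4), of A]
      by linarith
  qed
  have "metric.MCauchy (\<lambda>n. finsum E f (h n))"
    unfolding metric.MCauchy_def
  proof (intro conjI allI impI)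
    show "range (\<lambda>n. finsum E f (h n)) \<subseteq> carrier E"
      using cl h(2) by auto
    fix e :: real assume "e > 0"
    then obtain N where N: "(1 / 2) ^ N < e / 2"
      using real_arch_pow_inv[of "e / 2" "1 / 2"] by auto
    show "\<exists>N. \<forall>n n'. N \<le> n \<longrightarrow> N \<le> n' \<longrightarrow>
        ndist E (finsum E f (h n)) (finsum E f (h n')) < e"
    proof (intro exI allI impI)
      fix n n' assume "N \<le> n" "N \<le> n'"
      then have "(1 / 2 :: real) ^ n \<le> (1 / 2) ^ N" "(1 / 2 :: real) ^ n' \<le> (1 / 2) ^ N"
        by (simp_all add: power_decreasing)
      then have "nrm E (finsum E f (h n) \<ominus>\<^bsub>E\<^esub> finsum E f (h n')) < e"
        using diff[OF h(1,2) h(1,2), of n n'] h(3)[of n] h(3)[of n'] N by linarith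
      then show "ndist E (finsum E f (h n)) (finsum E f (h n')) < e"
        using cl h(2) by (simp add: ndist_def)
    qed
  qed
  then obtain s where s: "limitin (ntop E) (\<lambda>n. finsum E f (h n)) s sequentially"
    using mcomplete unfolding metric.mcomplete_def ntop_def by blast
  then have sc: "s \<in> carrier E" and lim: "(\<lambda>n. nrm E (finsum E f (h n) \<ominus>\<^bsub>E\<^esub> s)) \<longlonglongrightarrow> 0"
    using cl h(2) by (simp_all add: limitin_ntop_iff)
  have "nrm E (s \<ominus>\<^bsub>E\<^esub> finsum E f A) \<le> (\<Sum>\<^sub>\<infinity>i\<in>I - A. nrm E (f i))"
    if A: "finite A" "A \<subseteq> I" for A
  proof (rule tendsto_le[OF sequentially_bot _ tendsto_const])
    have "(\<lambda>n. (1 / 2 :: real) ^ n) \<longlonglongrightarrow> 0"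
      by (simp add: LIMSEQ_power_zero)
    from tendsto_add[OF tendsto_add[OF lim tendsto_const] this]
    show "(\<lambda>n. nrm E (finsum E f (h n) \<ominus>\<^bsub>E\<^esub> s) + (\<Sum>\<^sub>\<infinity>i\<in>I - A. nrm E (f i)) + (1 / 2) ^ n)
        \<longlonglongrightarrow> (\<Sum>\<^sub>\<infinity>i\<in>I - A. nrm E (f i))"
      by simp
    show "\<forall>\<^sub>F n in sequentially. nrm E (s \<ominus>\<^bsub>E\<^esub> finsum E f A) \<le>
        nrm E (finsum E f (h n) \<ominus>\<^bsub>E\<^esub> s) + (\<Sum>\<^sub>\<infinity>i\<in>I - A. nrm E (f i)) + (1 / 2) ^ n"
    proof (intro always_eventually allI)
      fix n
      have "nrm E (s \<ominus>\<^bsub>E\<^esub> finsum E f A) \<le>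
          nrm E (s \<ominus>\<^bsub>E\<^esub> finsum E f (h n)) + nrm E (finsum E f (h n) \<ominus>\<^bsub>E\<^esub> finsum E f A)"
        by (rule nrm_diff_triangle) (use sc cl h A in auto)
      then show "nrm E (s \<ominus>\<^bsub>E\<^esub> finsum E f A) \<le>
          nrm E (finsum E f (h n) \<ominus>\<^bsub>E\<^esub> s) + (\<Sum>\<^sub>\<infinity>i\<in>I - A. nrm E (f i)) + (1 / 2) ^ n"
        using diff[OF h(1,2) A, of n] h(3)[of n] nrm_diff_commute[OF sc cl[OF h(2)[of n]]]
        by linarith
    qed
  qed
  then show ?thesis
    unfolding abs_sums_def using sc assms by blast
qed

text \<open>Over the natural numbers, this notion of sum agrees with the convergence of partial sums in
  the definition of hyper-nuclear polynomials.\<close>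

lemma abs_sums_nat_iff:
  assumes "f \<in> UNIV \<rightarrow> carrier E" "summable (\<lambda>j. nrm E (f j))"
  shows "limitin (ntop E) (\<lambda>N. finsum E f {..<N}) s sequentially \<longleftrightarrow> abs_sums E f (UNIV :: nat set) s"
proof -
  have *: "filterlim (\<lambda>N. {..<N::nat}) (finite_subsets_at_top UNIV) sequentially"
    by (rule filterlim_lessThan_at_top)
  have cl: "finsum E f A \<in> carrier E" for A
    using assms(1) by (intro M.finsum_closed) auto
  have lim: "limitin (ntop E) (\<lambda>N. finsum E f {..<N}) t sequentially"
    if "abs_sums E f UNIV t" for t
    using abs_sums_tendsto[OF that *] abs_sumsD(2)[OF that] by (simp add: limitin_ntop_iff cl)
  have "(\<lambda>i. nrm E (f i)) summable_on UNIV"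
    using assms by (subst summable_on_UNIV_nonneg_real_iff) (auto simp: Pi_iff)
  then obtain t where "abs_sums E f UNIV t"
    using abs_sums_exists[of f UNIV] assms(1) by auto
  then show ?thesis
    using lim limitin_ntop_unique[OF _ _ sequentially_bot] by metis
qed

end

text \<open>One direction of Fubini's theorem. The pairs with first index in a finite set \<open>D\<close> contribute
  \<open>finsum E g D\<close> exactly, and the others at most the sum of the row norms \<open>h\<close> outside \<open>D\<close>.\<close>

lemma (in banach_carrier) abs_sums_Sigma:
  assumes total: "abs_sums E (\<lambda>(a, b). f a b) (Sigma A B) s"
    and inner: "\<And>a. a \<in> A \<Longrightarrow> abs_sums E (f a) (B a) (g a)"
  shows "abs_sums E g A s"
proof -
  note T = abs_sumsD[OF total]
  let ?n = "\<lambda>(a, b). nrm E (f a b)"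
  have n: "?n summable_on Sigma A B"
    using T(3) by (simp add: case_prod_unfold)
  define h where "h a = (\<Sum>\<^sub>\<infinity>b\<in>B a. nrm E (f a b))" for a
  have h: "h summable_on A"
    unfolding h_def using n by (rule summable_on_Sigma_banach)
  have g: "g a \<in> carrier E" "nrm E (g a) \<le> h a" if "a \<in> A" for a
    using abs_sumsD(2)[OF inner[OF that]] abs_sums_nrm_le[OF inner[OF that]] by (simp_all add: h_def)
  have fin: "abs_sums E (\<lambda>(a, b). f a b) (Sigma D B) (finsum E g D)" if "finite D" "D \<subseteq> A" for D
    using that
  proof (induction D)
    case empty
    then show ?case
      using abs_sums_zero[of "{}" "\<lambda>(a, b). f a b"] by simp
  next
    case (insert d D)
    have eq: "Sigma (insert d D) B = Pair d ` B d \<union> Sigma D B"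
      by auto
    have "abs_sums E (\<lambda>(a, b). f a b) (Pair d ` B d) (g d)"
      by (rule abs_sums_reindex) (use inner insert.prems in \<open>simp_all add: inj_on_def\<close>)
    moreover have "abs_sums E (\<lambda>(a, b). f a b) (Sigma D B) (finsum E g D)"
      using insert by simp
    ultimately have "abs_sums E (\<lambda>(a, b). f a b) (Sigma (insert d D) B) (g d \<oplus>\<^bsub>E\<^esub> finsum E g D)"
      unfolding eq by (rule abs_sums_Un_disjoint) (use insert.hyps in auto)
    moreover have "finsum E g (insert d D) = g d \<oplus>\<^bsub>E\<^esub> finsum E g D"
      by (rule M.finsum_insert) (use insert.hyps insert.prems g in auto)
    ultimately show ?case
      by simp
  qed
  have summable: "(\<lambda>a. nrm E (g a)) summable_on A"
    by (rule summable_on_comparison_test[OF h g(2) nrm_nonneg[OF g(1)]])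
  have tail: "nrm E (finsum E g D \<ominus>\<^bsub>E\<^esub> s) \<le> (\<Sum>\<^sub>\<infinity>a\<in>A - D. h a)" if D: "finite D" "D \<subseteq> A" for D
  proof -
    have n': "?n summable_on Sigma (A - D) B"
      by (rule summable_on_subset_banach[OF n]) auto
    have "\<exists>t. abs_sums E (\<lambda>(a, b). f a b) (Sigma (A - D) B) t"
      by (rule abs_sums_exists) (use T(1) n' in \<open>auto simp: Pi_iff case_prod_unfold\<close>)
    then obtain t where t: "abs_sums E (\<lambda>(a, b). f a b) (Sigma (A - D) B) t" ..
    have "Sigma A B = Sigma D B \<union> Sigma (A - D) B"
      using D(2) by auto
    then have "abs_sums E (\<lambda>(a, b). f a b) (Sigma A B) (finsum E g D \<oplus>\<^bsub>E\<^esub> t)"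
      using abs_sums_Un_disjoint[OF fin[OF D] t] by auto
    then have s: "s = finsum E g D \<oplus>\<^bsub>E\<^esub> t"
      by (rule abs_sums_unique[OF total])
    have cl: "finsum E g D \<in> carrier E" "t \<in> carrier E"
      using abs_sumsD(2)[OF fin[OF D]] abs_sumsD(2)[OF t] .
    have "s \<ominus>\<^bsub>E\<^esub> finsum E g D = t"
      using cl add_diff_add[of "finsum E g D" t "finsum E g D" "\<zero>\<^bsub>E\<^esub>"] by (simp add: s)
    then have "nrm E (finsum E g D \<ominus>\<^bsub>E\<^esub> s) = nrm E t"
      using nrm_diff_commute[OF cl(1) T(2)] by simp
    also have "\<dots> \<le> (\<Sum>\<^sub>\<infinity>x\<in>Sigma (A - D) B. ?n x)"
      using abs_sums_nrm_le[OF t] by (simp add: case_prod_unfold)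
    also have "\<dots> = (\<Sum>\<^sub>\<infinity>a\<in>A - D. h a)"
      unfolding h_def by (rule infsum_Sigma'_banach[OF n', symmetric])
    finally show ?thesis .
  qed
  show ?thesis
  proof (rule abs_sumsI[OF _ T(2) summable])
    show "g \<in> A \<rightarrow> carrier E"
      using g(1) by auto
    show "((\<lambda>D. nrm E (finsum E g D \<ominus>\<^bsub>E\<^esub> s)) \<longlongrightarrow> 0) (finite_subsets_at_top A)"
    proof (rule tendsto_sandwich[OF _ _ tendsto_const infsum_Diff_finite_tendsto_0[OF h filterlim_ident]])
      show "\<forall>\<^sub>F D in finite_subsets_at_top A. nrm E (finsum E g D \<ominus>\<^bsub>E\<^esub> s) \<le> (\<Sum>\<^sub>\<infinity>a\<in>A - D. h a)"
        by (intro eventually_finite_subsets_at_top_weakI tail)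
      show "\<forall>\<^sub>F D in finite_subsets_at_top A. 0 \<le> nrm E (finsum E g D \<ominus>\<^bsub>E\<^esub> s)"
      proof (intro eventually_finite_subsets_at_top_weakI)
        fix D assume "finite D" "D \<subseteq> A"
        then show "0 \<le> nrm E (finsum E g D \<ominus>\<^bsub>E\<^esub> s)"
          by (intro nrm_nonneg M.minus_closed T(2) abs_sumsD(2)[OF fin])
      qed
    qed
  qed
qed

context normed_carrier
begin

lemma telescope_finsum:
  assumes "\<And>n. s n \<in> carrier E"
  shows "finsum E (\<lambda>k. s (Suc k) \<ominus>\<^bsub>E\<^esub> s k) {..<N} = s N \<ominus>\<^bsub>E\<^esub> s 0"
proof (induction N)
  case (Suc N)
  have "finsum E (\<lambda>k. s (Suc k) \<ominus>\<^bsub>E\<^esub> s k) {..<Suc N} =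
      (s (Suc N) \<ominus>\<^bsub>E\<^esub> s N) \<oplus>\<^bsub>E\<^esub> finsum E (\<lambda>k. s (Suc k) \<ominus>\<^bsub>E\<^esub> s k) {..<N}"
    unfolding lessThan_Suc by (rule M.finsum_insert) (use assms in auto)
  then show ?case
    using assms by (simp add: Suc diff_add_diff)
qed (use assms in simp)

text \<open>A Cauchy sequence has a subsequence whose successive differences have summable norms, and
  the series of these differences telescopes.\<close>

lemma mcompleteI_series:
  assumes series: "\<And>f. (\<And>k. f k \<in> carrier E) \<Longrightarrow> summable (\<lambda>k. nrm E (f k)) \<Longrightarrow>
    \<exists>s. limitin (ntop E) (\<lambda>N. finsum E f {..<N}) s sequentially"
  shows "Metric_space.mcomplete (carrier E) (ndist E)"
  unfolding metric.mcomplete_def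
proof (intro allI impI)
  fix u assume u: "metric.MCauchy u"
  then have u_cl: "u n \<in> carrier E" for n
    unfolding metric.MCauchy_def by blast
  have "\<exists>N. \<forall>n n'. N \<le> n \<longrightarrow> N \<le> n' \<longrightarrow> nrm E (u n \<ominus>\<^bsub>E\<^esub> u n') < e" if "0 < e" for e
    using u that u_cl unfolding metric.MCauchy_def ndist_def by simp
  then have "\<forall>k. \<exists>N. \<forall>n n'. N \<le> n \<longrightarrow> N \<le> n' \<longrightarrow> nrm E (u n \<ominus>\<^bsub>E\<^esub> u n') < (1 / 2) ^ k"
    by simp
  then obtain M where M: "\<And>k n n'. M k \<le> n \<Longrightarrow> M k \<le> n' \<Longrightarrow> nrm E (u n \<ominus>\<^bsub>E\<^esub> u n') < (1 / 2) ^ k"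
    unfolding choice_iff by blast
  \<comment> \<open>The summand \<open>k\<close> makes \<open>r\<close> strictly increasing; the sum makes it dominate \<open>M\<close>.\<close>
  define r where "r k = k + (\<Sum>i\<le>k. M i)" for k
  have r: "strict_mono r"
    unfolding strict_mono_Suc_iff r_def by simp
  have Mr: "M k \<le> r k" for k
    unfolding r_def using member_le_sum[of k "{..k}" M] by simp
  have step: "nrm E (u (r (Suc k)) \<ominus>\<^bsub>E\<^esub> u (r k)) \<le> (1 / 2) ^ k" for k
    using M[of k "r (Suc k)" "r k"] Mr[of k] strict_monoD[OF r, of k "Suc k"] by simp
  have "summable (\<lambda>k. nrm E (u (r (Suc k)) \<ominus>\<^bsub>E\<^esub> u (r k)))"
    by (rule summable_comparison_test'[of "\<lambda>k. (1 / 2) ^ k" 0])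
      (use step u_cl in \<open>auto simp: summable_geometric\<close>)
  then obtain s where s: "limitin (ntop E) (\<lambda>N. finsum E (\<lambda>k. u (r (Suc k)) \<ominus>\<^bsub>E\<^esub> u (r k)) {..<N}) s sequentially"
    using series[of "\<lambda>k. u (r (Suc k)) \<ominus>\<^bsub>E\<^esub> u (r k)"] u_cl by auto
  have lim: "limitin (ntop E) (\<lambda>N. u (r N) \<ominus>\<^bsub>E\<^esub> u (r 0)) s sequentially"
    using s telescope_finsum[of "\<lambda>k. u (r k)"] u_cl by simp
  then have sc: "s \<in> carrier E" and tend: "(\<lambda>N. nrm E ((u (r N) \<ominus>\<^bsub>E\<^esub> u (r 0)) \<ominus>\<^bsub>E\<^esub> s)) \<longlonglongrightarrow> 0"
    using u_cl by (simp_all add: limitin_ntop_iff)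
  have "(u (r N) \<ominus>\<^bsub>E\<^esub> u (r 0)) \<ominus>\<^bsub>E\<^esub> s = u (r N) \<ominus>\<^bsub>E\<^esub> (s \<oplus>\<^bsub>E\<^esub> u (r 0))" for N
    using u_cl sc by (simp add: a_minus_def M.minus_add M.a_ac)
  then have "limitin (ntop E) (\<lambda>N. u (r N)) (s \<oplus>\<^bsub>E\<^esub> u (r 0)) sequentially"
    using tend u_cl sc by (simp add: limitin_ntop_iff)
  then have "limitin metric.mtopology (u \<circ> r) (s \<oplus>\<^bsub>E\<^esub> u (r 0)) sequentially"
    by (simp add: ntop_def o_def)
  then show "\<exists>x. limitin metric.mtopology u x sequentially"
    using metric.MCauchy_convergent_subsequence[OF u r] by blast
qed

end


section \<open>Expanding multilinear maps\<close>

lemma (in abelian_monoid) finsum_cartesian: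
  assumes "finite A" "finite B" "\<And>a b. a \<in> A \<Longrightarrow> b \<in> B \<Longrightarrow> g a b \<in> carrier G"
  shows "finsum G (\<lambda>a. finsum G (g a) B) A = finsum G (\<lambda>(a, b). g a b) (A \<times> B)"
  using assms(1,3)
proof (induction A)
  case (insert a A)
  have cl: "finsum G (g a') B \<in> carrier G" if "a' \<in> insert a A" for a'
    using insert.prems that by (intro finsum_closed) auto
  have split: "insert a A \<times> B = Pair a ` B \<union> A \<times> B"
    by auto
  have g: "(\<lambda>(a, b). g a b) \<in> Pair a ` B \<rightarrow> carrier G" "(\<lambda>(a, b). g a b) \<in> A \<times> B \<rightarrow> carrier G"
    using insert.prems by auto
  have "finsum G (\<lambda>(a, b). g a b) (Pair a ` B \<union> A \<times> B) =
      finsum G (\<lambda>(a, b). g a b) (Pair a ` B) \<oplus> finsum G (\<lambda>(a, b). g a b) (A \<times> B)"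
    by (rule finsum_Un_disjoint[OF _ _ _ g]) (use insert.hyps assms(2) in auto)
  also have "finsum G (\<lambda>(a, b). g a b) (Pair a ` B) = finsum G (g a) B"
    using finsum_reindex[OF g(1)] by (simp add: inj_on_def)
  also have "finsum G (\<lambda>(a, b). g a b) (A \<times> B) = finsum G (\<lambda>a. finsum G (g a) B) A"
    using insert.IH insert.prems by simp
  also have "finsum G (g a) B \<oplus> \<dots> = finsum G (\<lambda>a. finsum G (g a) B) (insert a A)"
    by (rule finsum_insert[symmetric]) (use insert.hyps cl in auto)
  finally show ?case
    unfolding split by simp
qed simp

context normed_carrier
begin

text \<open>Two finite sums are interchanged and the coefficients of each vector are collected. This is
  how identities between signed sums of vectors become identities between sums of signs.\<close>

lemma finsum_lincomb:
  assumes "finite S" "finite T" "\<And>t. t \<in> T \<Longrightarrow> v t \<in> carrier E"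
  shows "finsum E (\<lambda>s. b s \<odot>\<^bsub>E\<^esub> finsum E (\<lambda>t. c s t \<odot>\<^bsub>E\<^esub> v t) T) S =
    finsum E (\<lambda>t. (\<Sum>s\<in>S. b s * c s t) \<odot>\<^bsub>E\<^esub> v t) T"
  using assms(1)
proof (induction S)
  case empty
  have "finsum E (\<lambda>t. 0 \<odot>\<^bsub>E\<^esub> v t) T = finsum E (\<lambda>t. \<zero>\<^bsub>E\<^esub>) T"
    using smult_l_null assms(3) by (intro M.finsum_cong') auto
  then show ?case
    by simp
next
  case (insert s S)
  have cl: "finsum E (\<lambda>t. d t \<odot>\<^bsub>E\<^esub> v t) T \<in> carrier E" for d :: "'c \<Rightarrow> 'k"
    using assms(3) by (intro M.finsum_closed) auto
  have "b s \<odot>\<^bsub>E\<^esub> finsum E (\<lambda>t. c s t \<odot>\<^bsub>E\<^esub> v t) T = finsum E (\<lambda>t. b s \<odot>\<^bsub>E\<^esub> (c s t \<odot>\<^bsub>E\<^esub> v t)) T"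
    using assms by (intro finsum_smult_ldistr) auto
  also have "\<dots> = finsum E (\<lambda>t. (b s * c s t) \<odot>\<^bsub>E\<^esub> v t) T"
    by (rule M.finsum_cong') (use assms(3) smult_assoc1 in auto)
  finally have eq: "b s \<odot>\<^bsub>E\<^esub> finsum E (\<lambda>t. c s t \<odot>\<^bsub>E\<^esub> v t) T = \<dots>" .
  have "finsum E (\<lambda>s. b s \<odot>\<^bsub>E\<^esub> finsum E (\<lambda>t. c s t \<odot>\<^bsub>E\<^esub> v t) T) (insert s S) =
      finsum E (\<lambda>t. (b s * c s t) \<odot>\<^bsub>E\<^esub> v t) T \<oplus>\<^bsub>E\<^esub>
      finsum E (\<lambda>t. (\<Sum>s\<in>S. b s * c s t) \<odot>\<^bsub>E\<^esub> v t) T"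
    using insert cl by (subst M.finsum_insert) (auto simp: eq)
  also have "\<dots> = finsum E (\<lambda>t. (b s * c s t) \<odot>\<^bsub>E\<^esub> v t \<oplus>\<^bsub>E\<^esub> (\<Sum>s\<in>S. b s * c s t) \<odot>\<^bsub>E\<^esub> v t) T"
    using assms(3) by (intro M.finsum_addf[symmetric]) auto
  also have "\<dots> = finsum E (\<lambda>t. (\<Sum>s\<in>insert s S. b s * c s t) \<odot>\<^bsub>E\<^esub> v t) T"
    using assms(3) insert(1,2) smult_l_distr by (intro M.finsum_cong') auto
  finally show ?case .
qed

lemma finsum_single: "f i \<in> carrier E \<Longrightarrow> finsum E f {i} = f i"
  using M.finsum_insert[of "{}" i f] by simp

lemma finsum_const_smult:
  assumes "v \<in> carrier E"
  shows "finsum E (\<lambda>s. v) S = of_nat (card S) \<odot>\<^bsub>E\<^esub> v"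
proof (induction S rule: infinite_finite_induct)
  case (insert s S)
  then show ?case
    using assms smult_l_distr[of 1 "of_nat (card S)" v] smult_one[of v] by (subst M.finsum_insert) auto
qed (use assms smult_l_null in auto)

end

locale normed_pair = E: normed_carrier E + F: normed_carrier F
  for E :: "('k::{real_normed_field, banach}, 'a) nvs" and F :: "('k, 'b) nvs"
begin

context
  fixes n :: nat and A :: "(nat \<Rightarrow> 'a) \<Rightarrow> 'b"
  assumes A: "multilinear n E F A"
begin

lemma multilinear_closed: "x \<in> {..<n} \<rightarrow>\<^sub>E carrier E \<Longrightarrow> A x \<in> carrier F"
  using A by (simp add: multilinear_def)

lemma multilinear_add:
  "x \<in> {..<n} \<rightarrow>\<^sub>E carrier E \<Longrightarrow> i < n \<Longrightarrow> u \<in> carrier E \<Longrightarrow> v \<in> carrier E \<Longrightarrow>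
    A (x(i := u \<oplus>\<^bsub>E\<^esub> v)) = A (x(i := u)) \<oplus>\<^bsub>F\<^esub> A (x(i := v))"
  using A by (simp add: multilinear_def)

lemma multilinear_smult:
  "x \<in> {..<n} \<rightarrow>\<^sub>E carrier E \<Longrightarrow> i < n \<Longrightarrow> u \<in> carrier E \<Longrightarrow>
    A (x(i := a \<odot>\<^bsub>E\<^esub> u)) = a \<odot>\<^bsub>F\<^esub> A (x(i := u))"
  using A by (simp add: multilinear_def)

lemma upd_closed:
  "x \<in> {..<n} \<rightarrow>\<^sub>E carrier E \<Longrightarrow> i < n \<Longrightarrow> u \<in> carrier E \<Longrightarrow> x(i := u) \<in> {..<n} \<rightarrow>\<^sub>E carrier E"
  by (auto simp: PiE_iff extensional_def)

lemma multilinear_zero: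
  assumes "x \<in> {..<n} \<rightarrow>\<^sub>E carrier E" "i < n" "x i = \<zero>\<^bsub>E\<^esub>"
  shows "A x = \<zero>\<^bsub>F\<^esub>"
  using multilinear_smult[OF assms(1,2), of "\<zero>\<^bsub>E\<^esub>" 0] multilinear_closed[OF assms(1)]
    E.smult_l_null[of "\<zero>\<^bsub>E\<^esub>"] F.smult_l_null[of "A x"] assms(3)
  by (simp add: fun_upd_idem)

lemma multilinear_diff:
  assumes "x \<in> {..<n} \<rightarrow>\<^sub>E carrier E" "i < n" "u \<in> carrier E" "v \<in> carrier E"
  shows "A (x(i := u \<ominus>\<^bsub>E\<^esub> v)) = A (x(i := u)) \<ominus>\<^bsub>F\<^esub> A (x(i := v))"
proof -
  note cl = multilinear_closed[OF upd_closed[OF assms(1,2,3)]]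
    multilinear_closed[OF upd_closed[OF assms(1,2,4)]]
  have "A (x(i := u \<ominus>\<^bsub>E\<^esub> v)) = A (x(i := u \<oplus>\<^bsub>E\<^esub> (- 1) \<odot>\<^bsub>E\<^esub> v))"
    using E.smult_minus_one[OF assms(4)] by (simp only: a_minus_def)
  also have "\<dots> = A (x(i := u)) \<oplus>\<^bsub>F\<^esub> (- 1) \<odot>\<^bsub>F\<^esub> A (x(i := v))"
    by (subst multilinear_add[OF assms(1-3) E.smult_closed[OF _ assms(4)]],
        simp, subst multilinear_smult[OF assms(1,2,4)], rule refl)
  finally show ?thesis
    using F.smult_minus_one[OF cl(2)] by (simp only: a_minus_def)
qed

lemma multilinear_finsum_slot:
  assumes "x \<in> {..<n} \<rightarrow>\<^sub>E carrier E" "i < n" "finite S" "g \<in> S \<rightarrow> carrier E"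
  shows "A (x(i := finsum E g S)) = finsum F (\<lambda>j. A (x(i := g j))) S"
  using assms(3,4)
proof (induction S)
  case empty
  show ?case
    by (simp only: E.M.finsum_empty F.M.finsum_empty
        multilinear_zero[OF upd_closed[OF assms(1,2) E.M.zero_closed] assms(2) fun_upd_same])
next
  case (insert s S)
  have cl: "A (x(i := g j)) \<in> carrier F" if "j \<in> insert s S" for j
    using insert.prems that assms(1,2) by (auto intro!: multilinear_closed upd_closed)
  have "A (x(i := finsum E g (insert s S))) = A (x(i := g s \<oplus>\<^bsub>E\<^esub> finsum E g S))"
    using insert by (subst E.M.finsum_insert) auto
  also have "\<dots> = A (x(i := g s)) \<oplus>\<^bsub>F\<^esub> A (x(i := finsum E g S))"
    using insert assms(1,2) by (intro multilinear_add) auto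
  also have "A (x(i := finsum E g S)) = finsum F (\<lambda>j. A (x(i := g j))) S"
    using insert.prems by (intro insert.IH) simp
  also have "A (x(i := g s)) \<oplus>\<^bsub>F\<^esub> \<dots> = finsum F (\<lambda>j. A (x(i := g j))) (insert s S)"
    by (rule F.M.finsum_insert[symmetric]) (use insert.hyps in \<open>auto intro!: cl\<close>)
  finally show ?case .
qed

text \<open>The slots are expanded one at a time; in the map \<open>?w k f\<close> the first \<open>k\<close> slots have been
  expanded along the multi-index \<open>f\<close>.\<close>

lemma multilinear_finsum_expand:
  assumes "finite S" "z \<in> S \<rightarrow> carrier E"
  shows "A (\<lambda>i\<in>{..<n}. finsum E z S) =
    finsum F (\<lambda>f. A (\<lambda>i\<in>{..<n}. z (f i))) ({..<n} \<rightarrow>\<^sub>E S)"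
proof -
  let ?w = "\<lambda>k f. \<lambda>i\<in>{..<n}. if i < k then z (f i) else finsum E z S"
  have sum_cl: "finsum E z S \<in> carrier E"
    using assms by (intro E.M.finsum_closed) auto
  have w_cl: "?w k f \<in> {..<n} \<rightarrow>\<^sub>E carrier E" if "f \<in> {..<k} \<rightarrow>\<^sub>E S" for k f
  proof (rule restrict_PiE_iff[THEN iffD2], intro ballI)
    fix i assume "i \<in> {..<n}"
    show "(if i < k then z (f i) else finsum E z S) \<in> carrier E"
      using PiE_mem[OF that, of i] funcset_mem[OF assms(2)] sum_cl by simp
  qed
  have "A (\<lambda>i\<in>{..<n}. finsum E z S) = finsum F (\<lambda>f. A (?w k f)) ({..<k} \<rightarrow>\<^sub>E S)" if "k \<le> n" for k
    using that
  proof (induction k)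
    case 0
    have "A (\<lambda>i\<in>{..<n}. finsum E z S) \<in> carrier F"
      using sum_cl by (intro multilinear_closed) auto
    then show ?case
      unfolding lessThan_0 PiE_empty_domain less_nat_zero_code if_False
      by (rule F.finsum_single[of "\<lambda>_. A (\<lambda>i\<in>{..<n}. finsum E z S)", symmetric])
  next
    case (Suc k)
    let ?h = "\<lambda>(f, j). f(k := j)"
    have fin: "finite ({..<k} \<rightarrow>\<^sub>E S)"
      using assms by (intro finite_PiE) auto
    have slot: "A (?w k f) = finsum F (\<lambda>j. A (?w (Suc k) (f(k := j)))) S"
      if f: "f \<in> {..<k} \<rightarrow>\<^sub>E S" for f
    proof -
      have "A (?w k f) = A ((?w k f)(k := finsum E z S))"
        using Suc.prems by (intro arg_cong[where f = A]) (auto simp: fun_eq_iff)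
      also have "\<dots> = finsum F (\<lambda>j. A ((?w k f)(k := z j))) S"
        using Suc.prems assms w_cl[OF f] by (intro multilinear_finsum_slot) auto
      also have "\<dots> = finsum F (\<lambda>j. A (?w (Suc k) (f(k := j)))) S"
      proof (rule F.M.finsum_cong')
        fix j assume j: "j \<in> S"
        show "A ((?w k f)(k := z j)) = A (?w (Suc k) (f(k := j)))"
          using Suc.prems by (intro arg_cong[where f = A]) (auto simp: fun_eq_iff less_Suc_eq)
      next
        have "f(k := j) \<in> {..<Suc k} \<rightarrow>\<^sub>E S" if "j \<in> S" for j
          using f that by (auto simp: PiE_iff extensional_def less_Suc_eq)
        then show "(\<lambda>j. A (?w (Suc k) (f(k := j)))) \<in> S \<rightarrow> carrier F"
          by (intro funcsetI multilinear_closed w_cl)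
      qed simp
      finally show ?thesis .
    qed
    have upd: "f(k := j) \<in> {..<Suc k} \<rightarrow>\<^sub>E S" if "f \<in> {..<k} \<rightarrow>\<^sub>E S" "j \<in> S" for f j
      using that by (auto simp: PiE_iff extensional_def less_Suc_eq)
    have cl: "A (?w (Suc k) (f(k := j))) \<in> carrier F" if "f \<in> {..<k} \<rightarrow>\<^sub>E S" "j \<in> S" for f j
      using multilinear_closed[OF w_cl[OF upd[OF that]]] .
    have img: "?h ` (({..<k} \<rightarrow>\<^sub>E S) \<times> S) = {..<Suc k} \<rightarrow>\<^sub>E S"
      unfolding lessThan_Suc PiE_insert_eq product_swap[of "{..<k} \<rightarrow>\<^sub>E S" S, symmetric] image_image
      by (simp add: split_def)
    have inj: "inj_on ?h (({..<k} \<rightarrow>\<^sub>E S) \<times> S)"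
    proof (rule inj_onI, clarify)
      fix f j f' j' assume f: "f \<in> {..<k} \<rightarrow>\<^sub>E S" "f' \<in> {..<k} \<rightarrow>\<^sub>E S" and eq: "f(k := j) = f'(k := j')"
      have "f i = f' i" for i
        using f fun_cong[OF eq, of i] by (cases "i = k") (auto simp: PiE_iff extensional_def)
      then show "f = f' \<and> j = j'"
        using fun_cong[OF eq, of k] by auto
    qed
    have "A (\<lambda>i\<in>{..<n}. finsum E z S) = finsum F (\<lambda>f. A (?w k f)) ({..<k} \<rightarrow>\<^sub>E S)"
      using Suc.IH Suc_leD[OF Suc.prems] by blast
    also have "\<dots> = finsum F (\<lambda>f. finsum F (\<lambda>j. A (?w (Suc k) (f(k := j)))) S) ({..<k} \<rightarrow>\<^sub>E S)"
      by (rule F.M.finsum_cong'[OF refl _ slot]) (intro funcsetI F.M.finsum_closed cl)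
    also have "\<dots> = finsum F (\<lambda>(f, j). A (?w (Suc k) (f(k := j)))) (({..<k} \<rightarrow>\<^sub>E S) \<times> S)"
      using fin assms(1) cl by (intro F.M.finsum_cartesian) auto
    also have "\<dots> = finsum F (\<lambda>f. A (?w (Suc k) f)) (?h ` (({..<k} \<rightarrow>\<^sub>E S) \<times> S))"
    proof (subst F.M.finsum_reindex[OF _ inj])
      show "(\<lambda>f. A (?w (Suc k) f)) \<in> ?h ` (({..<k} \<rightarrow>\<^sub>E S) \<times> S) \<rightarrow> carrier F"
        unfolding img by (intro funcsetI multilinear_closed w_cl)
    qed (simp only: split_def)
    finally show ?case
      unfolding img .
  qed
  from this[of n] have "A (\<lambda>i\<in>{..<n}. finsum E z S) = finsum F (\<lambda>f. A (?w n f)) ({..<n} \<rightarrow>\<^sub>E S)"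
    by simp
  also have "?w n = (\<lambda>f. \<lambda>i\<in>{..<n}. z (f i))"
    by (auto simp: fun_eq_iff)
  finally show ?thesis .
qed

lemma multilinear_prod_smult:
  assumes "x \<in> {..<n} \<rightarrow> carrier E"
  shows "A (\<lambda>i\<in>{..<n}. c i \<odot>\<^bsub>E\<^esub> x i) = (\<Prod>i<n. c i) \<odot>\<^bsub>F\<^esub> A (\<lambda>i\<in>{..<n}. x i)"
proof -
  let ?w = "\<lambda>k. \<lambda>i\<in>{..<n}. if i < k then c i \<odot>\<^bsub>E\<^esub> x i else x i"
  have w_cl: "?w k \<in> {..<n} \<rightarrow>\<^sub>E carrier E" for k
    using assms by (auto simp: Pi_iff)
  have "A (?w k) = (\<Prod>i<k. c i) \<odot>\<^bsub>F\<^esub> A (?w 0)" if "k \<le> n" for k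
    using that
  proof (induction k)
    case 0
    show ?case
      using F.smult_one[OF multilinear_closed[OF w_cl[of 0]]]
      by (simp only: lessThan_0 prod.empty ring_of_type_algebra_simps)
  next
    case (Suc k)
    have "A (?w (Suc k)) = A ((?w k)(k := c k \<odot>\<^bsub>E\<^esub> x k))"
      using Suc.prems by (intro arg_cong[where f = A]) (auto simp: fun_eq_iff less_Suc_eq)
    also have "\<dots> = c k \<odot>\<^bsub>F\<^esub> A ((?w k)(k := x k))"
      using Suc.prems w_cl assms by (intro multilinear_smult) auto
    also have "(?w k)(k := x k) = ?w k"
      using Suc.prems by (auto simp: fun_eq_iff)
    also have "A (?w k) = (\<Prod>i<k. c i) \<odot>\<^bsub>F\<^esub> A (?w 0)"
      using Suc.IH Suc_leD[OF Suc.prems] by blast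
    also have "c k \<odot>\<^bsub>F\<^esub> \<dots> = (c k * (\<Prod>i<k. c i)) \<odot>\<^bsub>F\<^esub> A (?w 0)"
      using F.smult_assoc1[OF _ _ multilinear_closed[OF w_cl[of 0]], of "c k" "\<Prod>i<k. c i"]
      by (simp only: ring_of_type_algebra_simps UNIV_I)
    also have "c k * (\<Prod>i<k. c i) = (\<Prod>i<Suc k. c i)"
      by (simp add: mult.commute)
    finally show ?case .
  qed
  moreover have "?w n = (\<lambda>i\<in>{..<n}. c i \<odot>\<^bsub>E\<^esub> x i)" "?w 0 = (\<lambda>i\<in>{..<n}. x i)"
    by auto
  ultimately show ?thesis
    by (metis order_refl)
qed

lemma multilinear_diag_smult:
  assumes "u \<in> carrier E"
  shows "A (\<lambda>i\<in>{..<n}. c \<odot>\<^bsub>E\<^esub> u) = c ^ n \<odot>\<^bsub>F\<^esub> A (\<lambda>i\<in>{..<n}. u)"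
  using multilinear_prod_smult[of "\<lambda>_. u" "\<lambda>_. c"] assms by simp

lemma multilinear_lincomb_expand:
  assumes "finite S" "y \<in> S \<rightarrow> carrier E"
  shows "A (\<lambda>i\<in>{..<n}. finsum E (\<lambda>j. a j \<odot>\<^bsub>E\<^esub> y j) S) =
    finsum F (\<lambda>f. (\<Prod>i<n. a (f i)) \<odot>\<^bsub>F\<^esub> A (\<lambda>i\<in>{..<n}. y (f i))) ({..<n} \<rightarrow>\<^sub>E S)"
proof -
  have cl: "(\<lambda>i\<in>{..<n}. y (f i)) \<in> {..<n} \<rightarrow>\<^sub>E carrier E" if "f \<in> {..<n} \<rightarrow>\<^sub>E S" for f
    using that assms(2) by auto
  have "A (\<lambda>i\<in>{..<n}. finsum E (\<lambda>j. a j \<odot>\<^bsub>E\<^esub> y j) S) =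
      finsum F (\<lambda>f. A (\<lambda>i\<in>{..<n}. a (f i) \<odot>\<^bsub>E\<^esub> y (f i))) ({..<n} \<rightarrow>\<^sub>E S)"
    using assms by (intro multilinear_finsum_expand) auto
  also have "\<dots> = finsum F (\<lambda>f. (\<Prod>i<n. a (f i)) \<odot>\<^bsub>F\<^esub> A (\<lambda>i\<in>{..<n}. y (f i))) ({..<n} \<rightarrow>\<^sub>E S)"
  proof (rule F.M.finsum_cong')
    fix f assume f: "f \<in> {..<n} \<rightarrow>\<^sub>E S"
    then show "A (\<lambda>i\<in>{..<n}. a (f i) \<odot>\<^bsub>E\<^esub> y (f i)) =
        (\<Prod>i<n. a (f i)) \<odot>\<^bsub>F\<^esub> A (\<lambda>i\<in>{..<n}. y (f i))"
      using assms(2) by (intro multilinear_prod_smult) auto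
  next
    show "(\<lambda>f. (\<Prod>i<n. a (f i)) \<odot>\<^bsub>F\<^esub> A (\<lambda>i\<in>{..<n}. y (f i))) \<in> ({..<n} \<rightarrow>\<^sub>E S) \<rightarrow> carrier F"
      by (intro funcsetI F.smult_closed multilinear_closed cl) simp_all
  qed simp
  finally show ?thesis .
qed

end

end


section \<open>Polarization\<close>

abbreviation signs :: "nat \<Rightarrow> (nat \<Rightarrow> 'k::real_normed_field) set" where
  "signs n \<equiv> {..<n} \<rightarrow>\<^sub>E {-1, 1}"

text \<open>If \<open>f\<close> is not injective, then it misses some \<open>k < n\<close>, and flipping the sign \<open>\<epsilon> k\<close> flips the
  sign of each summand. If \<open>f\<close> is a permutation, each summand is a product of squares of signs.\<close>

lemma sum_signs_prod:
  assumes f: "f \<in> {..<n} \<rightarrow>\<^sub>E {..<n}"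
  shows "(\<Sum>\<epsilon>\<in>signs n. (\<Prod>i<n. \<epsilon> i) * (\<Prod>i<n. \<epsilon> (f i))) =
    (if inj_on f {..<n} then 2 ^ n else 0 :: 'k::real_normed_field)"
proof (cases "inj_on f {..<n}")
  case True
  then have "bij_betw f {..<n} {..<n}"
    using f by (intro bij_betw_imageI endo_inj_surj) auto
  have "(\<Prod>i<n. \<epsilon> i) * (\<Prod>i<n. \<epsilon> (f i)) = 1" if "\<epsilon> \<in> signs n" for \<epsilon> :: "nat \<Rightarrow> 'k"
  proof -
    have "(\<Prod>i<n. \<epsilon> (f i)) = (\<Prod>i<n. \<epsilon> i)"
      using \<open>bij_betw f {..<n} {..<n}\<close> by (rule prod.reindex_bij_betw)
    then have "(\<Prod>i<n. \<epsilon> i) * (\<Prod>i<n. \<epsilon> (f i)) = (\<Prod>i<n. \<epsilon> i * \<epsilon> i)"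
      by (simp add: prod.distrib)
    also have "\<dots> = 1"
      using that by (intro prod.neutral) (force simp: PiE_iff)
    finally show ?thesis .
  qed
  then have "(\<Sum>\<epsilon>\<in>signs n. (\<Prod>i<n. \<epsilon> i) * (\<Prod>i<n. \<epsilon> (f i))) =
      (\<Sum>\<epsilon>\<in>(signs n :: (nat \<Rightarrow> 'k) set). 1 :: 'k)"
    by (intro sum.cong) auto
  also have "\<dots> = of_nat (card (signs n :: (nat \<Rightarrow> 'k) set))"
    by simp
  also have "card (signs n :: (nat \<Rightarrow> 'k) set) = 2 ^ n"
    by (simp add: card_funcsetE flip: numeral_2_eq_2)
  finally show ?thesis
    using True by simp
next
  case False
  have "f ` {..<n} \<noteq> {..<n}"
    using False eq_card_imp_inj_on[of "{..<n}" f] by auto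
  then obtain k where k: "k < n" "k \<notin> f ` {..<n}"
    using f by (auto simp: PiE_iff)
  let ?flip = "\<lambda>\<epsilon> :: nat \<Rightarrow> 'k. \<epsilon>(k := - \<epsilon> k)"
  have flip: "?flip \<epsilon> \<in> signs n" if "\<epsilon> \<in> signs n" for \<epsilon>
  proof -
    have "\<epsilon> k = -1 \<or> \<epsilon> k = 1"
      using PiE_mem[OF that, of k] k(1) by simp
    then have "- \<epsilon> k \<in> {-1, 1}"
      by auto
    from PiE_fun_upd[where x = k and T = "\<lambda>_. {- 1, 1}", OF this that] show ?thesis
      using k(1) by (simp add: insert_absorb)
  qed
  have flip_term: "(\<Prod>i<n. ?flip \<epsilon> i) * (\<Prod>i<n. ?flip \<epsilon> (f i)) = - ((\<Prod>i<n. \<epsilon> i) * (\<Prod>i<n. \<epsilon> (f i)))"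
    for \<epsilon> :: "nat \<Rightarrow> 'k"
  proof -
    have "(\<Prod>i<n. ?flip \<epsilon> (f i)) = (\<Prod>i<n. \<epsilon> (f i))"
      using k by (intro prod.cong) auto
    moreover have "(\<Prod>i<n. ?flip \<epsilon> i) = - (\<Prod>i<n. \<epsilon> i)"
    proof -
      have "(\<Prod>i<n. ?flip \<epsilon> i) = - \<epsilon> k * (\<Prod>i\<in>{..<n} - {k}. ?flip \<epsilon> i)"
        using k by (subst prod.remove[of _ k]) auto
      also have "(\<Prod>i\<in>{..<n} - {k}. ?flip \<epsilon> i) = (\<Prod>i\<in>{..<n} - {k}. \<epsilon> i)"
        by (rule prod.cong) auto
      finally show ?thesis
        using k by (subst prod.remove[of "{..<n}" k]) auto
    qed
    ultimately show ?thesis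
      by simp
  qed
  let ?s = "\<Sum>\<epsilon>\<in>signs n. (\<Prod>i<n. \<epsilon> i) * (\<Prod>i<n. \<epsilon> (f i)) :: 'k"
  have "?s = (\<Sum>\<epsilon>\<in>signs n. (\<Prod>i<n. ?flip \<epsilon> i) * (\<Prod>i<n. ?flip \<epsilon> (f i)))"
    by (rule sum.reindex_bij_witness[of _ ?flip ?flip]) (use flip in auto)
  also have "\<dots> = - ?s"
    by (simp only: flip_term sum_negf)
  finally have "2 * ?s = 0"
    by simp
  then have "?s = 0"
    by (simp only: mult_eq_0_iff) simp
  then show ?thesis
    using False by simp
qed

text \<open>The permutations of \<open>{..<n}\<close>, as a subset of the multi-indices over which a multilinear map
  is expanded.\<close>

definition self_injections :: "nat \<Rightarrow> (nat \<Rightarrow> nat) set" where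
  "self_injections n = {f \<in> {..<n} \<rightarrow>\<^sub>E {..<n}. inj_on f {..<n}}"

lemma finite_self_injections [simp]: "finite (self_injections n)"
  unfolding self_injections_def by (rule finite_subset[of _ "{..<n} \<rightarrow>\<^sub>E {..<n}"]) (auto intro: finite_PiE)

lemma card_self_injections: "card (self_injections n) = fact n"
proof -
  have "card (self_injections n) = prod ((-) n) {0..<n}"
    unfolding self_injections_def using card_inj_on_subset_funcset[of "{..<n}" "{..<n}" "{..<n}"] by simp
  also have "\<dots> = fact n"
    using fact_prod_rev[of n, where 'a = nat] by simp
  finally show ?thesis .
qed

text \<open>The polarization formula for the symmetric multilinear map of a homogeneous polynomial. It
  refers only to the values of the polynomial, and so inherits estimates from them.\<close>

definition polar_form ::
    "nat \<Rightarrow> ('k::{real_normed_field, banach}, 'a) nvs \<Rightarrow> ('k, 'b) nvs \<Rightarrow> ('a \<Rightarrow> 'b) \<Rightarrow> (nat \<Rightarrow> 'a) \<Rightarrow> 'b"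
  where
  "polar_form n E F P x = inverse (2 ^ n * fact n) \<odot>\<^bsub>F\<^esub>
     finsum F (\<lambda>\<epsilon>. (\<Prod>i<n. \<epsilon> i) \<odot>\<^bsub>F\<^esub> P (finsum E (\<lambda>i. \<epsilon> i \<odot>\<^bsub>E\<^esub> x i) {..<n})) (signs n)"

context normed_pair
begin

context
  fixes n :: nat and A :: "(nat \<Rightarrow> 'a) \<Rightarrow> 'b" and P :: "'a \<Rightarrow> 'b"
  assumes A: "multilinear n E F A" and P: "\<And>x. x \<in> carrier E \<Longrightarrow> P x = A (\<lambda>i\<in>{..<n}. x)"
begin

text \<open>When \<open>P\<close> is expanded at the signed sums of the \<open>x i\<close>, the coefficient of \<open>A(x \<circ> f)\<close> becomes
  the sum of signs computed in \<open>sum_signs_prod\<close>, which only permutations survive.\<close>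

lemma polar_form_eq:
  assumes x: "x \<in> {..<n} \<rightarrow>\<^sub>E carrier E"
  shows "polar_form n E F P x = inverse (fact n) \<odot>\<^bsub>F\<^esub>
    finsum F (\<lambda>f. A (\<lambda>i\<in>{..<n}. x (f i))) (self_injections n)"
proof -
  let ?v = "\<lambda>f. A (\<lambda>i\<in>{..<n}. x (f i))" and ?M = "{..<n} \<rightarrow>\<^sub>E {..<n}"
  have v: "?v f \<in> carrier F" if "f \<in> ?M" for f
    using x that by (intro multilinear_closed[OF A] restrict_PiE_iff[THEN iffD2]) auto
  have fin: "finite (signs n :: (nat \<Rightarrow> 'k) set)" "finite ?M"
    by (auto intro: finite_PiE)
  have sum_cl: "finsum E (\<lambda>i. \<epsilon> i \<odot>\<^bsub>E\<^esub> x i) {..<n} \<in> carrier E" for \<epsilon> :: "nat \<Rightarrow> 'k"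
    using PiE_mem[OF x] by (intro E.M.finsum_closed funcsetI E.smult_closed) simp_all
  have expand: "P (finsum E (\<lambda>i. \<epsilon> i \<odot>\<^bsub>E\<^esub> x i) {..<n}) =
      finsum F (\<lambda>f. (\<Prod>i<n. \<epsilon> (f i)) \<odot>\<^bsub>F\<^esub> ?v f) ?M" for \<epsilon> :: "nat \<Rightarrow> 'k"
    unfolding P[OF sum_cl] using x
    by (intro multilinear_lincomb_expand[OF A, where a = \<epsilon> and y = x and S = "{..<n}"]) auto
  have cl: "finsum F (\<lambda>f. c f \<odot>\<^bsub>F\<^esub> ?v f) S \<in> carrier F" if "S \<subseteq> ?M" for c :: "_ \<Rightarrow> 'k" and S
    by (intro F.M.finsum_closed funcsetI F.smult_closed v subsetD[OF that]) simp_all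
  have "finsum F (\<lambda>\<epsilon>. (\<Prod>i<n. \<epsilon> i) \<odot>\<^bsub>F\<^esub> P (finsum E (\<lambda>i. \<epsilon> i \<odot>\<^bsub>E\<^esub> x i) {..<n})) (signs n) =
      finsum F (\<lambda>f. (\<Sum>\<epsilon>\<in>signs n. (\<Prod>i<n. \<epsilon> i) * (\<Prod>i<n. \<epsilon> (f i))) \<odot>\<^bsub>F\<^esub> ?v f) ?M"
    unfolding expand by (rule F.finsum_lincomb[OF fin v])
  also have "\<dots> = finsum F (\<lambda>f. 2 ^ n \<odot>\<^bsub>F\<^esub> ?v f) (self_injections n)"
  proof (rule F.M.add.finprod_mono_neutral_cong_right)
    show "self_injections n \<subseteq> ?M"
      by (auto simp: self_injections_def)
    show "(\<lambda>f. (\<Sum>\<epsilon>\<in>signs n. (\<Prod>i<n. \<epsilon> i) * (\<Prod>i<n. \<epsilon> (f i))) \<odot>\<^bsub>F\<^esub> ?v f) \<in> ?M \<rightarrow> carrier F"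
      by (intro funcsetI F.smult_closed v) simp_all
    show "(\<Sum>\<epsilon>\<in>signs n. (\<Prod>i<n. \<epsilon> i) * (\<Prod>i<n. \<epsilon> (f i))) \<odot>\<^bsub>F\<^esub> ?v f = \<zero>\<^bsub>F\<^esub>"
      if "f \<in> ?M - self_injections n" for f
    proof -
      have f: "f \<in> ?M" "\<not> inj_on f {..<n}"
        using that by (auto simp: self_injections_def)
      show ?thesis
        unfolding sum_signs_prod[OF f(1)] using f F.smult_l_null[OF v[OF f(1)]] by simp
    qed
    show "(\<Sum>\<epsilon>\<in>signs n. (\<Prod>i<n. \<epsilon> i) * (\<Prod>i<n. \<epsilon> (f i))) \<odot>\<^bsub>F\<^esub> ?v f = 2 ^ n \<odot>\<^bsub>F\<^esub> ?v f"
      if "f \<in> self_injections n" for f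
    proof -
      have f: "f \<in> ?M" "inj_on f {..<n}"
        using that by (auto simp: self_injections_def)
      show ?thesis
        unfolding sum_signs_prod[OF f(1)] using f(2) by simp
    qed
  qed (rule fin)
  also have "\<dots> = 2 ^ n \<odot>\<^bsub>F\<^esub> finsum F ?v (self_injections n)"
    by (rule F.finsum_smult_ldistr[symmetric], rule finite_self_injections, simp,
        intro funcsetI v, simp add: self_injections_def)
  finally have "polar_form n E F P x =
      inverse (2 ^ n * fact n) \<odot>\<^bsub>F\<^esub> (2 ^ n \<odot>\<^bsub>F\<^esub> finsum F ?v (self_injections n))"
    unfolding polar_form_def by (rule arg_cong)
  also have "\<dots> = (inverse (2 ^ n * fact n) * 2 ^ n) \<odot>\<^bsub>F\<^esub> finsum F ?v (self_injections n)"
  proof -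
    have "finsum F ?v (self_injections n) \<in> carrier F"
      using v by (intro F.M.finsum_closed) (auto simp: self_injections_def)
    from F.smult_assoc1[OF _ _ this, of "inverse (2 ^ n * fact n)" "2 ^ n"] show ?thesis
      by simp
  qed
  also have "inverse (2 ^ n * fact n) * 2 ^ n = (inverse (fact n) :: 'k)"
    by (simp add: field_simps)
  finally show ?thesis .
qed

lemma polar_form_closed:
  assumes x: "x \<in> {..<n} \<rightarrow>\<^sub>E carrier E"
  shows "polar_form n E F P x \<in> carrier F"
proof -
  have "(\<lambda>i\<in>{..<n}. x (f i)) \<in> {..<n} \<rightarrow>\<^sub>E carrier E" if "f \<in> self_injections n" for f
    using that x by (auto simp: self_injections_def)
  then show ?thesis
    unfolding polar_form_eq[OF x]
    by (intro F.smult_closed F.M.finsum_closed funcsetI multilinear_closed[OF A]) simp_all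
qed

lemma polar_form_diag:
  assumes "x \<in> carrier E"
  shows "polar_form n E F P (\<lambda>i\<in>{..<n}. x) = P x"
proof -
  have x: "(\<lambda>i\<in>{..<n}. x) \<in> {..<n} \<rightarrow>\<^sub>E carrier E"
    using assms by auto
  have Px: "P x \<in> carrier F"
    using multilinear_closed[OF A x] P[OF assms] by simp
  have "finsum F (\<lambda>f. A (\<lambda>i\<in>{..<n}. (\<lambda>i\<in>{..<n}. x) (f i))) (self_injections n) =
      finsum F (\<lambda>f. P x) (self_injections n)"
  proof (rule F.M.finsum_cong')
    fix f assume "f \<in> self_injections n"
    then have "(\<lambda>i\<in>{..<n}. (\<lambda>i\<in>{..<n}. x) (f i)) = (\<lambda>i\<in>{..<n}. x)"
      by (intro restrict_ext) (auto simp: self_injections_def PiE_iff)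
    then show "A (\<lambda>i\<in>{..<n}. (\<lambda>i\<in>{..<n}. x) (f i)) = P x"
      using P[OF assms] by simp
  qed (use Px in auto)
  also have "\<dots> = fact n \<odot>\<^bsub>F\<^esub> P x"
    using F.finsum_const_smult[OF Px, of "self_injections n"] by (simp add: card_self_injections)
  finally have "polar_form n E F P (\<lambda>i\<in>{..<n}. x) = inverse (fact n) \<odot>\<^bsub>F\<^esub> (fact n \<odot>\<^bsub>F\<^esub> P x)"
    unfolding polar_form_eq[OF x] by (rule arg_cong)
  also have "\<dots> = P x"
    using F.smult_assoc1[OF _ _ Px, of "inverse (fact n)" "fact n"] F.smult_one[OF Px] by simp
  finally show ?thesis .
qed

lemma multilinear_polar_form: "multilinear n E F (polar_form n E F P)"
  unfolding multilinear_def
proof (intro conjI ballI allI impI)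
  fix x assume x: "x \<in> {..<n} \<rightarrow>\<^sub>E carrier E"
  then show "polar_form n E F P x \<in> carrier F"
    by (rule polar_form_closed)
  fix i assume i: "i < n"
  let ?w = "\<lambda>u f. \<lambda>j\<in>{..<n}. (x(i := u)) (f j)"
  have upd: "x(i := u) \<in> {..<n} \<rightarrow>\<^sub>E carrier E" if "u \<in> carrier E" for u
    using x i that by (rule upd_closed[OF A])
  have w_cl: "?w u f \<in> {..<n} \<rightarrow>\<^sub>E carrier E" if "u \<in> carrier E" "f \<in> self_injections n" for u f
  proof (intro restrict_PiE_iff[THEN iffD2] ballI PiE_mem[OF upd[OF that(1)]])
    fix j assume "j \<in> {..<n}"
    then show "f j \<in> {..<n}"
      using that(2) by (auto simp: self_injections_def)
  qed
  have A_cl: "A (?w u f) \<in> carrier F" if "u \<in> carrier E" "f \<in> self_injections n" for u f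
    using multilinear_closed[OF A w_cl[OF that]] .
  \<comment> \<open>In the summand of the permutation \<open>f\<close>, the \<open>i\<close>-th vector occupies the slot \<open>k f\<close>.\<close>
  define k where "k f = inv_into {..<n} f i" for f
  have k: "k f < n" "?w u f = (\<lambda>j\<in>{..<n}. x (f j))(k f := u)" if "f \<in> self_injections n" for f u
  proof -
    have f: "f \<in> {..<n} \<rightarrow>\<^sub>E {..<n}" "inj_on f {..<n}"
      using that by (auto simp: self_injections_def)
    then have "f ` {..<n} = {..<n}"
      by (intro endo_inj_surj) auto
    then have "i \<in> f ` {..<n}"
      using i by simp
    then have *: "k f \<in> {..<n}" "f (k f) = i"
      unfolding k_def by (rule inv_into_into, rule f_inv_into_f)
    then have "j < n \<Longrightarrow> f j = i \<longleftrightarrow> j = k f" for j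
      using f(2) by (auto dest: inj_onD)
    with * show "k f < n" "?w u f = (\<lambda>j\<in>{..<n}. x (f j))(k f := u)"
      by (auto simp: fun_eq_iff)
  qed
  have xf: "(\<lambda>j\<in>{..<n}. x (f j)) \<in> {..<n} \<rightarrow>\<^sub>E carrier E" if "f \<in> self_injections n" for f
    using that PiE_mem[OF x]
    by (intro restrict_PiE_iff[THEN iffD2]) (auto simp: self_injections_def)
  have sum_cl: "finsum F (\<lambda>f. A (?w u f)) (self_injections n) \<in> carrier F" if "u \<in> carrier E" for u
    by (intro F.M.finsum_closed funcsetI A_cl that)
  {
    fix u v assume uv: "u \<in> carrier E" "v \<in> carrier E"
    have "finsum F (\<lambda>f. A (?w (u \<oplus>\<^bsub>E\<^esub> v) f)) (self_injections n) =
        finsum F (\<lambda>f. A (?w u f) \<oplus>\<^bsub>F\<^esub> A (?w v f)) (self_injections n)"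
    proof (rule F.M.finsum_cong')
      fix f assume f: "f \<in> self_injections n"
      show "A (?w (u \<oplus>\<^bsub>E\<^esub> v) f) = A (?w u f) \<oplus>\<^bsub>F\<^esub> A (?w v f)"
        unfolding k(2)[OF f] by (rule multilinear_add[OF A xf[OF f] k(1)[OF f] uv])
    qed (rule refl, intro funcsetI F.M.a_closed A_cl uv)
    also have "\<dots> = finsum F (\<lambda>f. A (?w u f)) (self_injections n) \<oplus>\<^bsub>F\<^esub>
        finsum F (\<lambda>f. A (?w v f)) (self_injections n)"
      by (intro F.M.finsum_addf funcsetI A_cl uv)
    finally show "polar_form n E F P (x(i := u \<oplus>\<^bsub>E\<^esub> v)) =
        polar_form n E F P (x(i := u)) \<oplus>\<^bsub>F\<^esub> polar_form n E F P (x(i := v))"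
      unfolding polar_form_eq[OF upd[OF uv(1)]] polar_form_eq[OF upd[OF uv(2)]]
        polar_form_eq[OF upd[OF E.M.a_closed[OF uv]]]
      using F.smult_r_distr[OF _ sum_cl[OF uv(1)] sum_cl[OF uv(2)]] by simp
  next
    fix a u assume u: "u \<in> carrier E"
    then have au: "a \<odot>\<^bsub>E\<^esub> u \<in> carrier E"
      by (intro E.smult_closed) simp
    have "finsum F (\<lambda>f. A (?w (a \<odot>\<^bsub>E\<^esub> u) f)) (self_injections n) =
        finsum F (\<lambda>f. a \<odot>\<^bsub>F\<^esub> A (?w u f)) (self_injections n)"
    proof (rule F.M.finsum_cong')
      fix f assume f: "f \<in> self_injections n"
      show "A (?w (a \<odot>\<^bsub>E\<^esub> u) f) = a \<odot>\<^bsub>F\<^esub> A (?w u f)"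
        unfolding k(2)[OF f] by (rule multilinear_smult[OF A xf[OF f] k(1)[OF f] u])
    qed (rule refl, intro funcsetI F.smult_closed A_cl u, simp)
    also have "\<dots> = a \<odot>\<^bsub>F\<^esub> finsum F (\<lambda>f. A (?w u f)) (self_injections n)"
      by (intro F.finsum_smult_ldistr[symmetric] funcsetI A_cl u) simp_all
    finally have "polar_form n E F P (x(i := a \<odot>\<^bsub>E\<^esub> u)) =
        inverse (fact n) \<odot>\<^bsub>F\<^esub> (a \<odot>\<^bsub>F\<^esub> finsum F (\<lambda>f. A (?w u f)) (self_injections n))"
      unfolding polar_form_eq[OF upd[OF au]]
      by (rule arg_cong)
    also have "\<dots> = a \<odot>\<^bsub>F\<^esub> (inverse (fact n) \<odot>\<^bsub>F\<^esub> finsum F (\<lambda>f. A (?w u f)) (self_injections n))"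
      using F.smult_assoc1[OF _ _ sum_cl[OF u], of a "inverse (fact n)"]
        F.smult_assoc1[OF _ _ sum_cl[OF u], of "inverse (fact n)" a] by (simp add: mult.commute)
    finally show "polar_form n E F P (x(i := a \<odot>\<^bsub>E\<^esub> u)) = a \<odot>\<^bsub>F\<^esub> polar_form n E F P (x(i := u))"
      unfolding polar_form_eq[OF upd[OF u]] .
  }
qed

lemma polynomial_smult: "u \<in> carrier E \<Longrightarrow> P (c \<odot>\<^bsub>E\<^esub> u) = c ^ n \<odot>\<^bsub>F\<^esub> P u"
  using multilinear_diag_smult[OF A, of u c] P[of u] P[of "c \<odot>\<^bsub>E\<^esub> u"] by simp

text \<open>The polarization inequality. For unit vectors, each of the \<open>2^n\<close> signed sums has norm at
  most \<open>n\<close>; vectors of other norms are rescaled slot by slot.\<close>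

lemma nrm_polar_form_le:
  assumes bound: "\<And>u. u \<in> carrier E \<Longrightarrow> nrm F (P u) \<le> M * nrm E u ^ n"
    and M: "0 \<le> M" and x: "x \<in> {..<n} \<rightarrow>\<^sub>E carrier E"
  shows "nrm F (polar_form n E F P x) \<le> real n ^ n / fact n * M * (\<Prod>i<n. nrm E (x i))"
proof -
  have unit: "nrm F (polar_form n E F P z) \<le> real n ^ n / fact n * M"
    if z: "z \<in> {..<n} \<rightarrow>\<^sub>E carrier E" and one: "\<And>i. i < n \<Longrightarrow> nrm E (z i) = 1" for z
  proof -
    let ?s = "\<lambda>\<epsilon> :: nat \<Rightarrow> 'k. finsum E (\<lambda>i. \<epsilon> i \<odot>\<^bsub>E\<^esub> z i) {..<n}"
    have zi: "z i \<in> carrier E" if "i < n" for i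
      using PiE_mem[OF z] that by simp
    have s_cl: "?s \<epsilon> \<in> carrier E" for \<epsilon>
      using zi by (intro E.M.finsum_closed funcsetI E.smult_closed) auto
    have P_cl: "P u \<in> carrier F" if "u \<in> carrier E" for u
      using multilinear_closed[OF A, of "\<lambda>i\<in>{..<n}. u"] P that by auto
    have summand: "nrm F ((\<Prod>i<n. \<epsilon> i) \<odot>\<^bsub>F\<^esub> P (?s \<epsilon>)) \<le> M * real n ^ n" if \<epsilon>: "\<epsilon> \<in> signs n" for \<epsilon>
    proof -
      have norm1: "norm (\<epsilon> i) = 1" if "i < n" for i
        using PiE_mem[OF \<epsilon>, of i] that by auto
      have "nrm E (?s \<epsilon>) \<le> (\<Sum>i<n. nrm E (\<epsilon> i \<odot>\<^bsub>E\<^esub> z i))"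
        using zi by (intro E.nrm_finsum_le funcsetI E.smult_closed) auto
      also have "\<dots> = (\<Sum>i<n. 1)"
        using zi one norm1 by (intro sum.cong) auto
      finally have "nrm E (?s \<epsilon>) ^ n \<le> real n ^ n"
        using s_cl by (intro power_mono) auto
      then have "nrm F (P (?s \<epsilon>)) \<le> M * real n ^ n"
        using bound[OF s_cl[of \<epsilon>]] mult_left_mono[OF _ M] order_trans by blast
      moreover have "norm (\<Prod>i<n. \<epsilon> i) = 1"
        using norm1 by (simp add: prod_norm[symmetric])
      ultimately show ?thesis
        using P_cl[OF s_cl] by simp
    qed
    have cl: "(\<lambda>\<epsilon>. (\<Prod>i<n. \<epsilon> i) \<odot>\<^bsub>F\<^esub> P (?s \<epsilon>)) \<in> signs n \<rightarrow> carrier F"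
      using P_cl s_cl by (intro funcsetI F.smult_closed) auto
    have "nrm F (finsum F (\<lambda>\<epsilon>. (\<Prod>i<n. \<epsilon> i) \<odot>\<^bsub>F\<^esub> P (?s \<epsilon>)) (signs n)) \<le>
        (\<Sum>\<epsilon>\<in>signs n. nrm F ((\<Prod>i<n. \<epsilon> i) \<odot>\<^bsub>F\<^esub> P (?s \<epsilon>)))"
      by (rule F.nrm_finsum_le[OF cl])
    also have "\<dots> \<le> (\<Sum>\<epsilon>\<in>(signs n :: (nat \<Rightarrow> 'k) set). M * real n ^ n)"
      by (rule sum_mono[OF summand])
    also have "\<dots> = 2 ^ n * (M * real n ^ n)"
      by (simp add: card_funcsetE flip: numeral_2_eq_2)
    finally have "norm (inverse (2 ^ n * fact n) :: 'k) *
          nrm F (finsum F (\<lambda>\<epsilon>. (\<Prod>i<n. \<epsilon> i) \<odot>\<^bsub>F\<^esub> P (?s \<epsilon>)) (signs n)) \<le>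
        norm (inverse (2 ^ n * fact n) :: 'k) * (2 ^ n * (M * real n ^ n))"
      by (rule mult_left_mono) simp
    also have "norm (inverse (2 ^ n * fact n) :: 'k) = inverse (2 ^ n * fact n)"
      by (simp add: norm_inverse norm_mult norm_power norm_fact)
    also have "inverse (2 ^ n * fact n) * (2 ^ n * (M * real n ^ n)) = real n ^ n / fact n * M"
      by (simp add: field_simps)
    finally show ?thesis
      unfolding polar_form_def using F.M.finsum_closed[OF cl]
      by (simp add: norm_inverse norm_mult norm_power norm_fact)
  qed
  have xi: "x i \<in> carrier E" if "i < n" for i
    using PiE_mem[OF x] that by simp
  note multi = multilinear_polar_form
  show ?thesis
  proof (cases "\<exists>i<n. x i = \<zero>\<^bsub>E\<^esub>")
    case True
    then obtain i where i: "i < n" "x i = \<zero>\<^bsub>E\<^esub>"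
      by blast
    then have "(\<Prod>i<n. nrm E (x i)) = 0"
      by (intro prod_zero bexI[of _ i]) auto
    moreover have "polar_form n E F P x = \<zero>\<^bsub>F\<^esub>"
      by (rule multilinear_zero[OF multi x i])
    ultimately show ?thesis
      by (simp only: F.nrm_zero mult_zero_right order_refl)
  next
    case False
    let ?c = "\<lambda>i. of_real (nrm E (x i)) :: 'k" and ?z = "\<lambda>i. inverse (of_real (nrm E (x i))) \<odot>\<^bsub>E\<^esub> x i"
    have nz: "nrm E (x i) \<noteq> 0" if "i < n" for i
      using False xi[OF that] that by auto
    have z_cl: "?z \<in> {..<n} \<rightarrow> carrier E"
      using xi by (intro funcsetI E.smult_closed) auto
    have "x = (\<lambda>i\<in>{..<n}. ?c i \<odot>\<^bsub>E\<^esub> ?z i)"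
    proof
      fix i
      show "x i = (\<lambda>i\<in>{..<n}. ?c i \<odot>\<^bsub>E\<^esub> ?z i) i"
      proof (cases "i < n")
        case True
        then show ?thesis
          using E.smult_assoc1[OF _ _ xi[OF True], of "?c i" "inverse (?c i)"] E.smult_one[OF xi[OF True]]
            nz[OF True] by simp
      qed (use x in \<open>auto simp: PiE_iff extensional_def\<close>)
    qed
    then have eq: "polar_form n E F P x = (\<Prod>i<n. ?c i) \<odot>\<^bsub>F\<^esub> polar_form n E F P (\<lambda>i\<in>{..<n}. ?z i)"
      using multilinear_prod_smult[OF multi z_cl, of ?c] by simp
    have z': "(\<lambda>i\<in>{..<n}. ?z i) \<in> {..<n} \<rightarrow>\<^sub>E carrier E"
      using z_cl by auto
    have one: "nrm E ((\<lambda>i\<in>{..<n}. ?z i) i) = 1" if "i < n" for i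
      using xi[OF that] nz[OF that] that by (simp add: norm_inverse)
    have "nrm F (polar_form n E F P x) = (\<Prod>i<n. nrm E (x i)) * nrm F (polar_form n E F P (\<lambda>i\<in>{..<n}. ?z i))"
      unfolding eq using polar_form_closed[OF z'] xi
      by (simp add: prod_norm[symmetric])
    also have "\<dots> \<le> (\<Prod>i<n. nrm E (x i)) * (real n ^ n / fact n * M)"
      by (intro mult_left_mono prod_nonneg E.nrm_nonneg xi unit[OF z' one]) simp_all
    finally show ?thesis
      by (simp add: mult.commute)
  qed
qed

end

end


section \<open>Continuous homogeneous polynomials\<close>

context normed_pair
begin

text \<open>The vector \<open>a\<close> is replaced by \<open>x\<close> in one slot of the polar form after the other, and each
  replacement costs a multiple of \<open>nrm E (x \<ominus>\<^bsub>E\<^esub> a)\<close>.\<close>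

lemma nrm_polynomial_diff_le:
  assumes A: "multilinear n E F A" and P: "\<And>x. x \<in> carrier E \<Longrightarrow> P x = A (\<lambda>i\<in>{..<n}. x)"
    and bound: "\<And>u. u \<in> carrier E \<Longrightarrow> nrm F (P u) \<le> M * nrm E u ^ n" and M: "0 \<le> M"
    and x: "x \<in> carrier E" "nrm E x \<le> R" and a: "a \<in> carrier E" "nrm E a \<le> R"
  shows "nrm F (P x \<ominus>\<^bsub>F\<^esub> P a) \<le> real n * (real n ^ n / fact n * M * R ^ (n - 1)) * nrm E (x \<ominus>\<^bsub>E\<^esub> a)"
proof -
  let ?B = "polar_form n E F P" and ?K = "real n ^ n / fact n * M"
  define w where "w k = (\<lambda>i\<in>{..<n}. if i < k then x else a)" for k
  note B = multilinear_polar_form[OF A P]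
  have w: "w k \<in> {..<n} \<rightarrow>\<^sub>E carrier E" for k
    using x(1) a(1) by (auto simp: w_def)
  have B_cl: "?B (w k) \<in> carrier F" for k
    by (rule multilinear_closed[OF B w])
  have xa: "x \<ominus>\<^bsub>E\<^esub> a \<in> carrier E"
    using x(1) a(1) by (rule E.M.minus_closed)
  have R: "0 \<le> R"
    using E.nrm_nonneg[OF x(1)] x(2) by linarith
  have step: "nrm F (?B (w (Suc k)) \<ominus>\<^bsub>F\<^esub> ?B (w k)) \<le> ?K * R ^ (n - 1) * nrm E (x \<ominus>\<^bsub>E\<^esub> a)"
    if k: "k < n" for k
  proof -
    have "w (Suc k) = (w k)(k := x)" "w k = (w k)(k := a)"
      using k by (auto simp: w_def fun_eq_iff less_Suc_eq)
    then have "?B (w (Suc k)) \<ominus>\<^bsub>F\<^esub> ?B (w k) = ?B ((w k)(k := x \<ominus>\<^bsub>E\<^esub> a))"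
      using multilinear_diff[OF B w k x(1) a(1)] by metis
    also have "nrm F \<dots> \<le> ?K * (\<Prod>i<n. nrm E (((w k)(k := x \<ominus>\<^bsub>E\<^esub> a)) i))"
      by (rule nrm_polar_form_le[OF A P bound M upd_closed[OF A w k xa]])
    also have "\<dots> \<le> ?K * (nrm E (x \<ominus>\<^bsub>E\<^esub> a) * R ^ (n - 1))"
    proof (rule mult_left_mono)
      have "(\<Prod>i<n. nrm E (((w k)(k := x \<ominus>\<^bsub>E\<^esub> a)) i)) =
          nrm E (x \<ominus>\<^bsub>E\<^esub> a) * (\<Prod>i\<in>{..<n} - {k}. nrm E (((w k)(k := x \<ominus>\<^bsub>E\<^esub> a)) i))"
        using k by (subst prod.remove[of _ k]) auto
      also have "\<dots> \<le> nrm E (x \<ominus>\<^bsub>E\<^esub> a) * (\<Prod>i\<in>{..<n} - {k}. R)"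
        using x a xa by (intro mult_left_mono prod_mono) (auto simp: w_def)
      also have "(\<Prod>i\<in>{..<n} - {k}. R) = R ^ (n - 1)"
        using k by simp
      finally show "(\<Prod>i<n. nrm E (((w k)(k := x \<ominus>\<^bsub>E\<^esub> a)) i)) \<le> nrm E (x \<ominus>\<^bsub>E\<^esub> a) * R ^ (n - 1)" .
    qed (use M in simp)
    finally show ?thesis
      by (simp only: mult_ac)
  qed
  have "nrm F (?B (w k) \<ominus>\<^bsub>F\<^esub> ?B (w 0)) \<le> real k * (?K * R ^ (n - 1) * nrm E (x \<ominus>\<^bsub>E\<^esub> a))"
    if "k \<le> n" for k
    using that
  proof (induction k)
    case 0
    then show ?case
      using F.diff_self[OF B_cl[of 0]] by simp
  next
    case (Suc k)
    have "nrm F (?B (w (Suc k)) \<ominus>\<^bsub>F\<^esub> ?B (w 0)) \<le>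
        nrm F (?B (w (Suc k)) \<ominus>\<^bsub>F\<^esub> ?B (w k)) + nrm F (?B (w k) \<ominus>\<^bsub>F\<^esub> ?B (w 0))"
      by (rule F.nrm_diff_triangle[OF B_cl B_cl B_cl])
    also have "\<dots> \<le> ?K * R ^ (n - 1) * nrm E (x \<ominus>\<^bsub>E\<^esub> a) +
        real k * (?K * R ^ (n - 1) * nrm E (x \<ominus>\<^bsub>E\<^esub> a))"
      using Suc.prems by (intro add_mono step Suc.IH) auto
    finally show ?case
      by (simp add: distrib_right add_divide_distrib)
  qed
  from this[of n] have "nrm F (?B (w n) \<ominus>\<^bsub>F\<^esub> ?B (w 0)) \<le>
      real n * (?K * R ^ (n - 1) * nrm E (x \<ominus>\<^bsub>E\<^esub> a))"
    by simp
  moreover have "w n = (\<lambda>i\<in>{..<n}. x)" "w 0 = (\<lambda>i\<in>{..<n}. a)"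
    by (auto simp: w_def)
  ultimately show ?thesis
    using polar_form_diag[OF A P x(1)] polar_form_diag[OF A P a(1)] by (simp only: mult.assoc)
qed

lemma continuous_map_ntop_iff:
  "continuous_map (ntop E) (ntop F) P \<longleftrightarrow> P ` carrier E \<subseteq> carrier F \<and>
     (\<forall>a\<in>carrier E. \<forall>e>0. \<exists>d>0. \<forall>x\<in>carrier E.
        nrm E (x \<ominus>\<^bsub>E\<^esub> a) < d \<longrightarrow> nrm F (P x \<ominus>\<^bsub>F\<^esub> P a) < e)"
proof -
  have "ndist E a x = nrm E (x \<ominus>\<^bsub>E\<^esub> a)" if "a \<in> carrier E" "x \<in> carrier E" for a x
    using that E.nrm_diff_commute by (simp add: ndist_def)
  moreover have "ndist F a x = nrm F (x \<ominus>\<^bsub>F\<^esub> a)" if "a \<in> carrier F" "x \<in> carrier F" for a x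
    using that F.nrm_diff_commute by (simp add: ndist_def)
  ultimately show ?thesis
    unfolding ntop_def E.metric.metric_continuous_map[OF F.Metric_space_ndist]
    by (simp add: image_subset_iff Ball_def imp_conjL cong: conj_cong)
qed

text \<open>A bounded homogeneous polynomial is Lipschitz on each ball, hence continuous. Together with
  \<open>hom_polysE\<close> this characterizes continuous homogeneous polynomials without reference to a
  topology.\<close>

lemma hom_polysI:
  assumes "P \<in> carrier E \<rightarrow>\<^sub>E carrier F" and A: "multilinear n E F A"
    and P: "\<And>x. x \<in> carrier E \<Longrightarrow> P x = A (\<lambda>i\<in>{..<n}. x)"
    and bound: "\<And>u. u \<in> carrier E \<Longrightarrow> nrm F (P u) \<le> M * nrm E u ^ n" and M: "0 \<le> M"
  shows "P \<in> hom_polys n E F"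
proof -
  have "\<exists>d>0. \<forall>x\<in>carrier E. nrm E (x \<ominus>\<^bsub>E\<^esub> a) < d \<longrightarrow> nrm F (P x \<ominus>\<^bsub>F\<^esub> P a) < e"
    if a: "a \<in> carrier E" and e: "0 < e" for a e
  proof -
    \<comment> \<open>This is a Lipschitz constant of \<open>P\<close> on the ball of radius \<open>nrm E a + 1\<close>.\<close>
    define K where "K = real n * (real n ^ n / fact n * M * (nrm E a + 1) ^ (n - 1))"
    have K: "0 \<le> K"
      unfolding K_def using M E.nrm_nonneg[OF a] by simp
    have "nrm F (P x \<ominus>\<^bsub>F\<^esub> P a) < e"
      if x: "x \<in> carrier E" and d: "nrm E (x \<ominus>\<^bsub>E\<^esub> a) < min 1 (e / (K + 1))" for x
    proof -
      have "nrm E x \<le> nrm E a + 1"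
        using E.nrm_le_add_diff[OF x a] d by simp
      then have "nrm F (P x \<ominus>\<^bsub>F\<^esub> P a) \<le> K * nrm E (x \<ominus>\<^bsub>E\<^esub> a)"
        unfolding K_def by (intro nrm_polynomial_diff_le[OF A P bound M x _ a]) auto
      also have "\<dots> \<le> (K + 1) * nrm E (x \<ominus>\<^bsub>E\<^esub> a)"
        using E.nrm_nonneg[OF E.M.minus_closed[OF x a]] by (intro mult_right_mono) auto
      also have "\<dots> < e"
        using d K by (simp add: field_simps)
      finally show ?thesis .
    qed
    then show ?thesis
      using e K by (intro exI[of _ "min 1 (e / (K + 1))"]) auto
  qed
  then show ?thesis
    unfolding hom_polys_def continuous_map_ntop_iff using assms(1) A P by blast
qed

text \<open>Continuity at 0 bounds \<open>P\<close> on a ball of some radius \<open>d\<close>, and homogeneity carries the bound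
  over to all vectors.\<close>

lemma hom_polysE:
  assumes "P \<in> hom_polys n E F"
  obtains A M where "P \<in> carrier E \<rightarrow>\<^sub>E carrier F" "multilinear n E F A"
    "\<And>x. x \<in> carrier E \<Longrightarrow> P x = A (\<lambda>i\<in>{..<n}. x)" "0 \<le> M"
    "\<And>u. u \<in> carrier E \<Longrightarrow> nrm F (P u) \<le> M * nrm E u ^ n"
proof -
  from assms obtain A where ext: "P \<in> carrier E \<rightarrow>\<^sub>E carrier F" and A: "multilinear n E F A"
    and P: "\<And>x. x \<in> carrier E \<Longrightarrow> P x = A (\<lambda>i\<in>{..<n}. x)"
    and cont: "continuous_map (ntop E) (ntop F) P"
    unfolding hom_polys_def by blast
  have P_cl: "P x \<in> carrier F" if "x \<in> carrier E" for x
    using ext that by auto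
  note smult = polynomial_smult[OF A P]
  obtain d where d: "0 < d"
    "\<And>x. x \<in> carrier E \<Longrightarrow> nrm E (x \<ominus>\<^bsub>E\<^esub> \<zero>\<^bsub>E\<^esub>) < d \<Longrightarrow> nrm F (P x \<ominus>\<^bsub>F\<^esub> P \<zero>\<^bsub>E\<^esub>) < 1"
    using cont[unfolded continuous_map_ntop_iff, THEN conjunct2, rule_format,
        OF E.M.zero_closed zero_less_one] by blast
  define L where "L = 1 + nrm F (P \<zero>\<^bsub>E\<^esub>)"
  have L: "1 \<le> L"
    unfolding L_def using F.nrm_nonneg[OF P_cl[OF E.M.zero_closed]] by simp
  have small: "nrm F (P x) \<le> L" if x: "x \<in> carrier E" "nrm E x < d" for x
  proof -
    have "nrm F (P x \<ominus>\<^bsub>F\<^esub> P \<zero>\<^bsub>E\<^esub>) < 1"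
      by (rule d(2)[OF x(1)]) (simp add: E.diff_zero[OF x(1)] x(2))
    then show ?thesis
      using F.nrm_le_add_diff[OF P_cl P_cl, OF x(1) E.M.zero_closed] unfolding L_def by linarith
  qed
  have "nrm F (P x) \<le> L * (2 / d) ^ n * nrm E x ^ n" if x: "x \<in> carrier E" for x
  proof (cases "nrm E x = 0")
    case True
    then have x0: "x = \<zero>\<^bsub>E\<^esub>"
      using x by simp
    show ?thesis
    proof (cases "n = 0")
      case True
      then show ?thesis
        using small[OF x] \<open>nrm E x = 0\<close> d(1) by simp
    next
      case False
      have "P (0 \<odot>\<^bsub>E\<^esub> x) = 0 ^ n \<odot>\<^bsub>F\<^esub> P x"
        by (rule smult) (use x in auto)
      moreover have "0 \<odot>\<^bsub>E\<^esub> x = x" "0 ^ n = (0 :: 'k)"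
        using False x0 E.smult_l_null[OF x] by simp_all
      ultimately have "P x = \<zero>\<^bsub>F\<^esub>"
        using F.smult_l_null[OF P_cl[OF x]] by simp
      then show ?thesis
        using False \<open>nrm E x = 0\<close> by (simp add: power_0_left)
    qed
  next
    case False
    then have pos: "0 < nrm E x"
      using E.nrm_nonneg[OF x] by linarith
    \<comment> \<open>The factor \<open>c\<close> scales \<open>x\<close> to norm \<open>d / 2\<close>.\<close>
    define c where "c = d / (2 * nrm E x)"
    have c: "0 < c"
      unfolding c_def using d(1) pos by simp
    have cx: "(of_real c :: 'k) \<odot>\<^bsub>E\<^esub> x \<in> carrier E"
      using x by (intro E.smult_closed) auto
    have "nrm E ((of_real c :: 'k) \<odot>\<^bsub>E\<^esub> x) = c * nrm E x"
      using x c by simp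
    also have "\<dots> = d / 2"
      unfolding c_def using False by (simp only: field_simps) simp
    finally have "nrm E ((of_real c :: 'k) \<odot>\<^bsub>E\<^esub> x) = d / 2" .
    then have "nrm F (P ((of_real c :: 'k) \<odot>\<^bsub>E\<^esub> x)) \<le> L"
      using small[OF cx] d(1) by simp
    moreover have "nrm F (P ((of_real c :: 'k) \<odot>\<^bsub>E\<^esub> x)) = c ^ n * nrm F (P x)"
      by (subst smult) (use x c P_cl[OF x] in \<open>auto simp: norm_power\<close>)
    ultimately have "nrm F (P x) \<le> L / c ^ n"
      using c by (simp add: pos_le_divide_eq mult.commute)
    also have "\<dots> = L * (2 / d) ^ n * nrm E x ^ n"
      unfolding c_def using pos d(1) by (simp add: power_divide power_mult_distrib)
    finally show ?thesis .
  qed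
  moreover have "0 \<le> L * (2 / d) ^ n"
    using L d(1) by simp
  ultimately show thesis
    using that[OF ext A P] by blast
qed

lemma hom_polys_closed: "P \<in> hom_polys n E F \<Longrightarrow> x \<in> carrier E \<Longrightarrow> P x \<in> carrier F"
  by (auto simp: hom_polys_def)

lemma hom_polys_extensional: "P \<in> hom_polys n E F \<Longrightarrow> P \<in> carrier E \<rightarrow>\<^sub>E carrier F"
  by (simp add: hom_polys_def)

lemma hom_polys_smult_arg:
  assumes "P \<in> hom_polys n E F" "x \<in> carrier E"
  shows "P (c \<odot>\<^bsub>E\<^esub> x) = c ^ n \<odot>\<^bsub>F\<^esub> P x"
  using assms polynomial_smult unfolding hom_polys_def by blast

lemma sup_norm_le:
  assumes "0 \<le> M" "\<And>x. x \<in> carrier E \<Longrightarrow> nrm F (P x) \<le> M * nrm E x ^ n"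
  shows "sup_norm E F P \<le> M"
  unfolding sup_norm_def
proof (rule cSUP_least)
  show "{x \<in> carrier E. nrm E x \<le> 1} \<noteq> {}"
    using E.M.zero_closed E.nrm_zero by (metis (mono_tags, lifting) empty_iff mem_Collect_eq zero_le_one)
next
  fix x assume x: "x \<in> {x \<in> carrier E. nrm E x \<le> 1}"
  then have "nrm E x ^ n \<le> 1"
    by (intro power_le_one) auto
  then show "nrm F (P x) \<le> M"
    using assms(2)[of x] x mult_left_mono[of "nrm E x ^ n" 1 M] assms(1) by auto
qed

lemma hom_polys_bounded:
  assumes "P \<in> hom_polys n E F"
  obtains M where "0 \<le> M" "\<And>u. u \<in> carrier E \<Longrightarrow> nrm F (P u) \<le> M * nrm E u ^ n"
  using assms by (rule hom_polysE) (rule that)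

lemma hom_polys_zero_arg:
  assumes "P \<in> hom_polys n E F" "n \<noteq> 0"
  shows "P \<zero>\<^bsub>E\<^esub> = \<zero>\<^bsub>F\<^esub>"
proof -
  have "P (0 \<odot>\<^bsub>E\<^esub> \<zero>\<^bsub>E\<^esub>) = 0 ^ n \<odot>\<^bsub>F\<^esub> P \<zero>\<^bsub>E\<^esub>"
    by (rule hom_polys_smult_arg[OF assms(1) E.M.zero_closed])
  moreover have "0 \<odot>\<^bsub>E\<^esub> \<zero>\<^bsub>E\<^esub> = \<zero>\<^bsub>E\<^esub>" "0 ^ n = (0 :: 'k)"
    using assms(2) E.smult_l_null[OF E.M.zero_closed] by simp_all
  ultimately show ?thesis
    using F.smult_l_null[OF hom_polys_closed[OF assms(1) E.M.zero_closed]] by simp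
qed

lemma nrm_le_sup_norm_unit:
  assumes P: "P \<in> hom_polys n E F" and x: "x \<in> carrier E" "nrm E x \<le> 1"
  shows "nrm F (P x) \<le> sup_norm E F P"
proof -
  obtain M where M: "0 \<le> M" "\<And>u. u \<in> carrier E \<Longrightarrow> nrm F (P u) \<le> M * nrm E u ^ n"
    using P by (rule hom_polys_bounded) blast
  have "nrm F (P u) \<le> M" if "u \<in> carrier E" "nrm E u \<le> 1" for u
  proof -
    have "nrm E u ^ n \<le> 1"
      using that by (intro power_le_one) auto
    then show ?thesis
      using M(2)[OF that(1)] mult_left_mono[of "nrm E u ^ n" 1 M] M(1) by simp
  qed
  then have "bdd_above ((\<lambda>x. nrm F (P x)) ` {x \<in> carrier E. nrm E x \<le> 1})"
    by (intro bdd_aboveI[of _ M]) auto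
  then show ?thesis
    unfolding sup_norm_def using x by (intro cSUP_upper) auto
qed

lemma sup_norm_nonneg:
  assumes "P \<in> hom_polys n E F"
  shows "0 \<le> sup_norm E F P"
proof -
  have "nrm F (P \<zero>\<^bsub>E\<^esub>) \<le> sup_norm E F P"
    by (rule nrm_le_sup_norm_unit[OF assms]) auto
  moreover have "0 \<le> nrm F (P \<zero>\<^bsub>E\<^esub>)"
    by (rule F.nrm_nonneg[OF hom_polys_closed[OF assms E.M.zero_closed]])
  ultimately show ?thesis
    by linarith
qed

lemma nrm_le_sup_norm:
  assumes P: "P \<in> hom_polys n E F" and x: "x \<in> carrier E"
  shows "nrm F (P x) \<le> sup_norm E F P * nrm E x ^ n"
proof (cases "nrm E x = 0")
  case True
  then have x0: "x = \<zero>\<^bsub>E\<^esub>"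
    using x by simp
  show ?thesis
  proof (cases "n = 0")
    case True
    then show ?thesis
      using nrm_le_sup_norm_unit[OF P x] \<open>nrm E x = 0\<close> by simp
  next
    case False
    then have "P x = \<zero>\<^bsub>F\<^esub>"
      using hom_polys_zero_arg[OF P] x0 by simp
    then show ?thesis
      using False \<open>nrm E x = 0\<close> by (simp add: power_0_left)
  qed
next
  case False
  then have pos: "0 < nrm E x"
    using E.nrm_nonneg[OF x] by linarith
  let ?c = "inverse (of_real (nrm E x)) :: 'k"
  have cx: "?c \<odot>\<^bsub>E\<^esub> x \<in> carrier E"
    using x by (intro E.smult_closed) auto
  have "nrm E (?c \<odot>\<^bsub>E\<^esub> x) = 1"
    using x left_inverse[OF False] by (simp add: norm_inverse)
  then have "nrm F (P (?c \<odot>\<^bsub>E\<^esub> x)) \<le> sup_norm E F P"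
    by (intro nrm_le_sup_norm_unit[OF P cx]) simp
  moreover have "nrm F (P (?c \<odot>\<^bsub>E\<^esub> x)) = nrm F (P x) / nrm E x ^ n"
  proof -
    have "norm (?c ^ n) = inverse (nrm E x ^ n)"
      using pos by (simp add: norm_power norm_inverse power_inverse)
    then show ?thesis
      unfolding hom_polys_smult_arg[OF P x] F.nrm_smult[OF hom_polys_closed[OF P x]]
      by (simp add: divide_inverse)
  qed
  ultimately show ?thesis
    using pos by (simp add: pos_divide_le_eq)
qed

end

lemma (in normed_pair) sup_norm_scale_le:
  assumes "P \<in> hom_polys n E F"
  shows "sup_norm E F (\<lambda>x\<in>carrier E. a \<odot>\<^bsub>F\<^esub> P x) \<le> norm a * sup_norm E F P"
proof (rule sup_norm_le[where n = n])
  show "0 \<le> norm a * sup_norm E F P"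
    using sup_norm_nonneg[OF assms] by simp
  fix x assume x: "x \<in> carrier E"
  show "nrm F ((\<lambda>x\<in>carrier E. a \<odot>\<^bsub>F\<^esub> P x) x) \<le> norm a * sup_norm E F P * nrm E x ^ n"
    using nrm_le_sup_norm[OF assms x] hom_polys_closed[OF assms x] x
    by (simp add: mult.assoc mult_left_mono)
qed

context normed_pair
begin

lemma hom_polys_add:
  assumes P: "P \<in> hom_polys n E F" and Q: "Q \<in> hom_polys n E F"
  shows "(\<lambda>x\<in>carrier E. P x \<oplus>\<^bsub>F\<^esub> Q x) \<in> hom_polys n E F"
proof -
  from P obtain A M where A: "P \<in> carrier E \<rightarrow>\<^sub>E carrier F" "multilinear n E F A"
    "\<And>x. x \<in> carrier E \<Longrightarrow> P x = A (\<lambda>i\<in>{..<n}. x)" "0 \<le> M"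
    "\<And>u. u \<in> carrier E \<Longrightarrow> nrm F (P u) \<le> M * nrm E u ^ n"
    by (rule hom_polysE) blast
  from Q obtain B L where B: "Q \<in> carrier E \<rightarrow>\<^sub>E carrier F" "multilinear n E F B"
    "\<And>x. x \<in> carrier E \<Longrightarrow> Q x = B (\<lambda>i\<in>{..<n}. x)" "0 \<le> L"
    "\<And>u. u \<in> carrier E \<Longrightarrow> nrm F (Q u) \<le> L * nrm E u ^ n"
    by (rule hom_polysE) blast
  note cl = multilinear_closed[OF A(2)] multilinear_closed[OF B(2)]
  show ?thesis
  proof (rule hom_polysI[where A = "\<lambda>x. A x \<oplus>\<^bsub>F\<^esub> B x" and M = "M + L"])
    show "multilinear n E F (\<lambda>x. A x \<oplus>\<^bsub>F\<^esub> B x)"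
      unfolding multilinear_def
    proof (intro conjI ballI allI impI)
      fix x assume x: "x \<in> {..<n} \<rightarrow>\<^sub>E carrier E"
      show "A x \<oplus>\<^bsub>F\<^esub> B x \<in> carrier F"
        by (intro F.M.a_closed cl x)
      fix i assume i: "i < n"
      have upd: "A (x(i := u)) \<in> carrier F" "B (x(i := u)) \<in> carrier F" if "u \<in> carrier E" for u
        by (intro cl upd_closed[OF A(2)] x i that)+
      {
        fix u v assume uv: "u \<in> carrier E" "v \<in> carrier E"
        show "A (x(i := u \<oplus>\<^bsub>E\<^esub> v)) \<oplus>\<^bsub>F\<^esub> B (x(i := u \<oplus>\<^bsub>E\<^esub> v)) =
            A (x(i := u)) \<oplus>\<^bsub>F\<^esub> B (x(i := u)) \<oplus>\<^bsub>F\<^esub> (A (x(i := v)) \<oplus>\<^bsub>F\<^esub> B (x(i := v)))"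
          unfolding multilinear_add[OF A(2) x i uv] multilinear_add[OF B(2) x i uv]
          using upd[OF uv(1)] upd[OF uv(2)] by (simp only: F.M.a_ac F.M.a_closed)
      next
        fix a u assume u: "u \<in> carrier E"
        show "A (x(i := a \<odot>\<^bsub>E\<^esub> u)) \<oplus>\<^bsub>F\<^esub> B (x(i := a \<odot>\<^bsub>E\<^esub> u)) =
            a \<odot>\<^bsub>F\<^esub> (A (x(i := u)) \<oplus>\<^bsub>F\<^esub> B (x(i := u)))"
          unfolding multilinear_smult[OF A(2) x i u] multilinear_smult[OF B(2) x i u]
          by (rule F.smult_r_distr[symmetric]) (use upd[OF u] in simp_all)
      }
    qed
    fix u assume u: "u \<in> carrier E"
    have "nrm F (P u \<oplus>\<^bsub>F\<^esub> Q u) \<le> nrm F (P u) + nrm F (Q u)"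
      by (rule F.nrm_triangle) (use u hom_polys_closed P Q in blast)+
    then show "nrm F ((\<lambda>x\<in>carrier E. P x \<oplus>\<^bsub>F\<^esub> Q x) u) \<le> (M + L) * nrm E u ^ n"
      using A(5)[OF u] B(5)[OF u] u by (simp add: distrib_right)
  qed (use A B in auto)
qed

lemma hom_polys_scale:
  assumes P: "P \<in> hom_polys n E F"
  shows "(\<lambda>x\<in>carrier E. a \<odot>\<^bsub>F\<^esub> P x) \<in> hom_polys n E F"
proof -
  from P obtain A M where A: "P \<in> carrier E \<rightarrow>\<^sub>E carrier F" "multilinear n E F A"
    "\<And>x. x \<in> carrier E \<Longrightarrow> P x = A (\<lambda>i\<in>{..<n}. x)" "0 \<le> M"
    "\<And>u. u \<in> carrier E \<Longrightarrow> nrm F (P u) \<le> M * nrm E u ^ n"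
    by (rule hom_polysE) blast
  note cl = multilinear_closed[OF A(2)]
  show ?thesis
  proof (rule hom_polysI[where A = "\<lambda>x. a \<odot>\<^bsub>F\<^esub> A x" and M = "norm a * M"])
    show "multilinear n E F (\<lambda>x. a \<odot>\<^bsub>F\<^esub> A x)"
      unfolding multilinear_def
    proof (intro conjI ballI allI impI)
      fix x assume x: "x \<in> {..<n} \<rightarrow>\<^sub>E carrier E"
      show "a \<odot>\<^bsub>F\<^esub> A x \<in> carrier F"
        by (rule F.smult_closed[OF _ cl[OF x]]) simp
      fix i assume i: "i < n"
      have upd: "A (x(i := u)) \<in> carrier F" if "u \<in> carrier E" for u
        by (intro cl upd_closed[OF A(2)] x i that)
      {
        fix u v assume uv: "u \<in> carrier E" "v \<in> carrier E"
        show "a \<odot>\<^bsub>F\<^esub> A (x(i := u \<oplus>\<^bsub>E\<^esub> v)) = a \<odot>\<^bsub>F\<^esub> A (x(i := u)) \<oplus>\<^bsub>F\<^esub> a \<odot>\<^bsub>F\<^esub> A (x(i := v))"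
          unfolding multilinear_add[OF A(2) x i uv]
          by (rule F.smult_r_distr) (use upd[OF uv(1)] upd[OF uv(2)] in simp_all)
      next
        fix b u assume u: "u \<in> carrier E"
        show "a \<odot>\<^bsub>F\<^esub> A (x(i := b \<odot>\<^bsub>E\<^esub> u)) = b \<odot>\<^bsub>F\<^esub> (a \<odot>\<^bsub>F\<^esub> A (x(i := u)))"
          unfolding multilinear_smult[OF A(2) x i u]
          using F.smult_assoc1[OF _ _ upd[OF u], of a b] F.smult_assoc1[OF _ _ upd[OF u], of b a]
          by (simp add: mult.commute)
      }
    qed
    fix u assume u: "u \<in> carrier E"
    show "nrm F ((\<lambda>x\<in>carrier E. a \<odot>\<^bsub>F\<^esub> P x) u) \<le> norm a * M * nrm E u ^ n"
      using A(5)[OF u] u hom_polys_closed[OF P u]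
      by (simp add: mult.assoc mult_left_mono)
  qed (use A in auto)
qed

lemma hom_polys_zero: "(\<lambda>x\<in>carrier E. \<zero>\<^bsub>F\<^esub>) \<in> hom_polys n E F"
proof (rule hom_polysI[where A = "\<lambda>x. \<zero>\<^bsub>F\<^esub>" and M = 0])
  show "multilinear n E F (\<lambda>x. \<zero>\<^bsub>F\<^esub>)"
    unfolding multilinear_def by simp
qed auto

end

text \<open>Both \<open>2^n P(x)\<close> and \<open>2^m P(x)\<close> are equal to \<open>P(2 x)\<close>.\<close>

lemma (in normed_pair) hom_polys_degree_unique:
  assumes P: "P \<in> hom_polys n E F" "P \<in> hom_polys m E F" and nm: "n \<noteq> m"
  shows "P = (\<lambda>x\<in>carrier E. \<zero>\<^bsub>F\<^esub>)"
proof (rule PiE_ext[OF hom_polys_extensional[OF P(1)] hom_polys_extensional[OF hom_polys_zero]])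
  fix x assume x: "x \<in> carrier E"
  have Px: "P x \<in> carrier F"
    by (rule hom_polys_closed[OF P(1) x])
  have ne: "(2 :: 'k) ^ n \<noteq> 2 ^ m"
  proof
    assume "(2 :: 'k) ^ n = 2 ^ m"
    then have "norm ((2 :: 'k) ^ n) = norm ((2 :: 'k) ^ m)"
      by simp
    then show False
      using nm by (simp add: norm_power)
  qed
  have "2 ^ n \<odot>\<^bsub>F\<^esub> P x = 2 ^ m \<odot>\<^bsub>F\<^esub> P x"
    using hom_polys_smult_arg[OF P(1) x, of 2] hom_polys_smult_arg[OF P(2) x, of 2] by simp
  moreover have "(2 ^ n - 2 ^ m) \<odot>\<^bsub>F\<^esub> P x \<oplus>\<^bsub>F\<^esub> 2 ^ m \<odot>\<^bsub>F\<^esub> P x = 2 ^ n \<odot>\<^bsub>F\<^esub> P x"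
    using F.smult_l_distr[OF _ _ Px, of "2 ^ n - 2 ^ m" "2 ^ m"] by simp
  ultimately have "(2 ^ n - 2 ^ m) \<odot>\<^bsub>F\<^esub> P x = \<zero>\<^bsub>F\<^esub>"
    using F.M.add.r_cancel_one[of "2 ^ m \<odot>\<^bsub>F\<^esub> P x" "(2 ^ n - 2 ^ m) \<odot>\<^bsub>F\<^esub> P x"] F.smult_closed[OF _ Px] by simp
  then have "norm ((2 :: 'k) ^ n - 2 ^ m) * nrm F (P x) = 0"
    using F.nrm_smult[OF Px, of "2 ^ n - 2 ^ m"] F.nrm_zero by simp
  then have "nrm F (P x) = 0"
    using ne by simp
  then show "P x = (\<lambda>x\<in>carrier E. \<zero>\<^bsub>F\<^esub>) x"
    using Px x by simp
qed

locale normed_banach_pair = E: normed_carrier E + F: banach_carrier F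
  for E :: "('k::{real_normed_field, banach}, 'a) nvs" and F :: "('k, 'b) nvs"
begin

sublocale normed_pair E F ..

lemma abs_sums_hom_polys_bound:
  assumes p: "\<And>i. i \<in> I \<Longrightarrow> p i \<in> hom_polys n E F"
    and summable: "(\<lambda>i. sup_norm E F (p i)) summable_on I"
    and P: "\<And>x. x \<in> carrier E \<Longrightarrow> abs_sums F (\<lambda>i. p i x) I (P x)"
    and x: "x \<in> carrier E"
  shows "nrm F (P x) \<le> (\<Sum>\<^sub>\<infinity>i\<in>I. sup_norm E F (p i)) * nrm E x ^ n"
proof -
  have "nrm F (P x) \<le> (\<Sum>\<^sub>\<infinity>i\<in>I. nrm F (p i x))"
    by (rule F.abs_sums_nrm_le[OF P[OF x]])
  also have "\<dots> \<le> (\<Sum>\<^sub>\<infinity>i\<in>I. sup_norm E F (p i) * nrm E x ^ n)"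
    by (intro infsum_mono F.abs_sumsD(3)[OF P[OF x]] summable_on_cmult_left summable
        nrm_le_sup_norm p x)
  also have "\<dots> = (\<Sum>\<^sub>\<infinity>i\<in>I. sup_norm E F (p i)) * nrm E x ^ n"
    by (rule infsum_cmult_left')
  finally show ?thesis .
qed

text \<open>By the polarization inequality the polar forms of the \<open>p i\<close> can be summed as well, and their
  sum is a multilinear map for \<open>P\<close>.\<close>

lemma hom_polys_abs_sums:
  assumes p: "\<And>i. i \<in> I \<Longrightarrow> p i \<in> hom_polys n E F"
    and summable: "(\<lambda>i. sup_norm E F (p i)) summable_on I"
    and P: "\<And>x. x \<in> carrier E \<Longrightarrow> abs_sums F (\<lambda>i. p i x) I (P x)"
    and ext: "P \<in> carrier E \<rightarrow>\<^sub>E carrier F"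
  shows "P \<in> hom_polys n E F"
proof -
  let ?B = "\<lambda>i. polar_form n E F (p i)"
  have B: "multilinear n E F (?B i)" "x \<in> carrier E \<Longrightarrow> ?B i (\<lambda>j\<in>{..<n}. x) = p i x"
    "y \<in> {..<n} \<rightarrow>\<^sub>E carrier E \<Longrightarrow>
      nrm F (?B i y) \<le> real n ^ n / fact n * sup_norm E F (p i) * (\<Prod>j<n. nrm E (y j))"
    if i: "i \<in> I" for i x y
  proof -
    obtain A where A: "multilinear n E F A" "\<And>x. x \<in> carrier E \<Longrightarrow> p i x = A (\<lambda>j\<in>{..<n}. x)"
      using p[OF i] unfolding hom_polys_def by blast
    show "multilinear n E F (?B i)"
      by (rule multilinear_polar_form[OF A])
    show "x \<in> carrier E \<Longrightarrow> ?B i (\<lambda>j\<in>{..<n}. x) = p i x"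
      by (rule polar_form_diag[OF A])
    show "y \<in> {..<n} \<rightarrow>\<^sub>E carrier E \<Longrightarrow>
        nrm F (?B i y) \<le> real n ^ n / fact n * sup_norm E F (p i) * (\<Prod>j<n. nrm E (y j))"
      by (rule nrm_polar_form_le[OF A nrm_le_sup_norm[OF p[OF i]] sup_norm_nonneg[OF p[OF i]]])
  qed
  have "\<exists>s. abs_sums F (\<lambda>i. ?B i y) I s" if y: "y \<in> {..<n} \<rightarrow>\<^sub>E carrier E" for y
  proof (rule F.abs_sums_exists)
    show cl: "(\<lambda>i. ?B i y) \<in> I \<rightarrow> carrier F"
      using multilinear_closed[OF B(1) y] by blast
    have "(\<lambda>i. real n ^ n / fact n * sup_norm E F (p i) * (\<Prod>j<n. nrm E (y j))) summable_on I"
      by (intro summable_on_cmult_left summable_on_cmult_right summable)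
    then show "(\<lambda>i. nrm F (?B i y)) summable_on I"
      by (rule summable_on_comparison_test)
        (use B(3)[OF _ y] F.nrm_nonneg[OF funcset_mem[OF cl]] in auto)
  qed
  then obtain A where A: "\<And>y. y \<in> {..<n} \<rightarrow>\<^sub>E carrier E \<Longrightarrow> abs_sums F (\<lambda>i. ?B i y) I (A y)"
    by metis
  show ?thesis
  proof (rule hom_polysI[where A = A and M = "\<Sum>\<^sub>\<infinity>i\<in>I. sup_norm E F (p i)"])
    show "multilinear n E F A"
      unfolding multilinear_def
    proof (intro conjI ballI allI impI)
      fix y assume y: "y \<in> {..<n} \<rightarrow>\<^sub>E carrier E"
      show "A y \<in> carrier F"
        by (rule F.abs_sumsD(2)[OF A[OF y]])
      fix k assume k: "k < n"
      have upd: "y(k := u) \<in> {..<n} \<rightarrow>\<^sub>E carrier E" if "u \<in> carrier E" for u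
        using y k that by (auto simp: PiE_iff extensional_def)
      {
        fix u v assume uv: "u \<in> carrier E" "v \<in> carrier E"
        have "abs_sums F (\<lambda>i. ?B i (y(k := u)) \<oplus>\<^bsub>F\<^esub> ?B i (y(k := v))) I
            (A (y(k := u)) \<oplus>\<^bsub>F\<^esub> A (y(k := v)))"
          by (intro F.abs_sums_add A upd uv)
        then have "abs_sums F (\<lambda>i. ?B i (y(k := u \<oplus>\<^bsub>E\<^esub> v))) I (A (y(k := u)) \<oplus>\<^bsub>F\<^esub> A (y(k := v)))"
          by (subst F.abs_sums_cong[OF _ refl refl]) (rule multilinear_add[OF B(1) y k uv])
        then show "A (y(k := u \<oplus>\<^bsub>E\<^esub> v)) = A (y(k := u)) \<oplus>\<^bsub>F\<^esub> A (y(k := v))"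
          using A[OF upd[OF E.M.a_closed[OF uv]]] by (rule F.abs_sums_unique[symmetric])
      next
        fix a u assume u: "u \<in> carrier E"
        then have au: "a \<odot>\<^bsub>E\<^esub> u \<in> carrier E"
          by (intro E.smult_closed) simp
        have "abs_sums F (\<lambda>i. a \<odot>\<^bsub>F\<^esub> ?B i (y(k := u))) I (a \<odot>\<^bsub>F\<^esub> A (y(k := u)))"
          by (intro F.abs_sums_smult A upd u)
        then have "abs_sums F (\<lambda>i. ?B i (y(k := a \<odot>\<^bsub>E\<^esub> u))) I (a \<odot>\<^bsub>F\<^esub> A (y(k := u)))"
          by (subst F.abs_sums_cong[OF _ refl refl]) (rule multilinear_smult[OF B(1) y k u])
        then show "A (y(k := a \<odot>\<^bsub>E\<^esub> u)) = a \<odot>\<^bsub>F\<^esub> A (y(k := u))"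
          using A[OF upd[OF au]] by (rule F.abs_sums_unique[symmetric])
      }
    qed
    show "P x = A (\<lambda>i\<in>{..<n}. x)" if x: "x \<in> carrier E" for x
    proof -
      have "abs_sums F (\<lambda>i. ?B i (\<lambda>i\<in>{..<n}. x)) I (P x)"
        using P[OF x] by (subst F.abs_sums_cong[OF _ refl refl]) (rule B(2)[OF _ x])
      moreover have "abs_sums F (\<lambda>i. ?B i (\<lambda>i\<in>{..<n}. x)) I (A (\<lambda>i\<in>{..<n}. x))"
        by (rule A) (use x in auto)
      ultimately show ?thesis
        by (rule F.abs_sums_unique)
    qed
    show "nrm F (P u) \<le> (\<Sum>\<^sub>\<infinity>i\<in>I. sup_norm E F (p i)) * nrm E u ^ n" if "u \<in> carrier E" for u
      using p summable P that by (rule abs_sums_hom_polys_bound)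
    show "0 \<le> (\<Sum>\<^sub>\<infinity>i\<in>I. sup_norm E F (p i))"
      by (rule infsum_nonneg) (rule sup_norm_nonneg[OF p])
  qed (rule ext)
qed

end

text \<open>Multilinear maps are substituted into a multilinear map: variable number \<open>i * n + k\<close> is the
  \<open>k\<close>-th variable of the \<open>i\<close>-th inner map. Composition and multiplication of polynomials are both
  of this kind.\<close>

lemma multilinear_blocks:
  assumes "normed_carrier E" "normed_carrier F" "normed_carrier H"
    and A: "\<And>i. i < r \<Longrightarrow> multilinear n E F (A i)" and B: "multilinear r F H B"
  shows "multilinear (r * n) E H (\<lambda>x. B (\<lambda>i\<in>{..<r}. A i (\<lambda>k\<in>{..<n}. x (i * n + k))))"
    and "\<And>u. u \<in> carrier E \<Longrightarrow>
      B (\<lambda>i\<in>{..<r}. A i (\<lambda>k\<in>{..<n}. (\<lambda>i\<in>{..<r * n}. u) (i * n + k))) =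
      B (\<lambda>i\<in>{..<r}. A i (\<lambda>k\<in>{..<n}. u))"
proof -
  interpret E: normed_carrier E by fact
  interpret F: normed_carrier F by fact
  interpret H: normed_carrier H by fact
  interpret EF: normed_pair E F ..
  interpret FH: normed_pair F H ..
  let ?blk = "\<lambda>x i. \<lambda>k\<in>{..<n}. x (i * n + k)"
  let ?C = "\<lambda>x. B (\<lambda>i\<in>{..<r}. A i (?blk x i))"
  have idx: "i * n + k < r * n" if "i < r" "k < n" for i k
  proof -
    have "i * n + k < Suc i * n"
      using that by simp
    also have "\<dots> \<le> r * n"
      using that by (intro mult_le_mono1) simp
    finally show ?thesis .
  qed
  show "?C (\<lambda>i\<in>{..<r * n}. u) = B (\<lambda>i\<in>{..<r}. A i (\<lambda>k\<in>{..<n}. u))" if "u \<in> carrier E" for u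
  proof (intro arg_cong[where f = B] restrict_ext)
    fix i assume "i \<in> {..<r}"
    then have "?blk (\<lambda>i\<in>{..<r * n}. u) i = (\<lambda>k\<in>{..<n}. u)"
      using idx by (intro restrict_ext) auto
    then show "A i (?blk (\<lambda>i\<in>{..<r * n}. u) i) = A i (\<lambda>k\<in>{..<n}. u)"
      by simp
  qed
  have blk: "?blk x i \<in> {..<n} \<rightarrow>\<^sub>E carrier E" if "x \<in> {..<r * n} \<rightarrow>\<^sub>E carrier E" "i < r" for x i
    using PiE_mem[OF that(1)] idx[OF that(2)] by auto
  have arg: "(\<lambda>i\<in>{..<r}. A i (?blk x i)) \<in> {..<r} \<rightarrow>\<^sub>E carrier F"
    if "x \<in> {..<r * n} \<rightarrow>\<^sub>E carrier E" for x
    using EF.multilinear_closed[OF A blk[OF that]] by (intro restrict_PiE_iff[THEN iffD2]) auto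
  show "multilinear (r * n) E H ?C"
    unfolding multilinear_def
  proof (intro conjI ballI allI impI)
    fix x assume x: "x \<in> {..<r * n} \<rightarrow>\<^sub>E carrier E"
    show "?C x \<in> carrier H"
      by (rule FH.multilinear_closed[OF B arg[OF x]])
    fix q assume q: "q < r * n"
    define i k where "i = q div n" and "k = q mod n"
    have n: "0 < n"
      using q by (cases n) auto
    have ik: "i < r" "k < n" "q = i * n + k"
      using q n by (auto simp: i_def k_def less_mult_imp_div_less)
    have upd: "(\<lambda>j\<in>{..<r}. A j (?blk (x(q := u)) j)) =
        (\<lambda>j\<in>{..<r}. A j (?blk x j))(i := A i ((?blk x i)(k := u)))" for u
    proof
      fix j
      have "?blk (x(q := u)) j = (if j = i then (?blk x i)(k := u) else ?blk x j)"
      proof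
        fix l
        have "j * n + l = q \<longleftrightarrow> j = i \<and> l = k" if "l < n"
        proof
          assume "j * n + l = q"
          then show "j = i \<and> l = k"
            using that n unfolding i_def k_def by auto
        qed (simp add: ik)
        then show "?blk (x(q := u)) j l = (if j = i then (?blk x i)(k := u) else ?blk x j) l"
          using ik(2) by auto
      qed
      then show "(\<lambda>j\<in>{..<r}. A j (?blk (x(q := u)) j)) j =
          ((\<lambda>j\<in>{..<r}. A j (?blk x j))(i := A i ((?blk x i)(k := u)))) j"
        using ik(1) by auto
    qed
    note Ai = A[OF ik(1)]
    have A_cl: "A i ((?blk x i)(k := u)) \<in> carrier F" if "u \<in> carrier E" for u
      by (rule EF.multilinear_closed[OF Ai EF.upd_closed[OF Ai blk[OF x ik(1)] ik(2) that]])
    {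
      fix u v assume uv: "u \<in> carrier E" "v \<in> carrier E"
      show "?C (x(q := u \<oplus>\<^bsub>E\<^esub> v)) = ?C (x(q := u)) \<oplus>\<^bsub>H\<^esub> ?C (x(q := v))"
        unfolding upd EF.multilinear_add[OF Ai blk[OF x ik(1)] ik(2) uv]
        by (rule FH.multilinear_add[OF B arg[OF x] ik(1) A_cl[OF uv(1)] A_cl[OF uv(2)]])
    next
      fix a u assume u: "u \<in> carrier E"
      show "?C (x(q := a \<odot>\<^bsub>E\<^esub> u)) = a \<odot>\<^bsub>H\<^esub> ?C (x(q := u))"
        unfolding upd EF.multilinear_smult[OF Ai blk[OF x ik(1)] ik(2) u]
        by (rule FH.multilinear_smult[OF B arg[OF x] ik(1) A_cl[OF u]])
    }
  qed
qed

lemma hom_polys_compose: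
  assumes nc: "normed_carrier E" "normed_carrier F" "normed_carrier H"
    and P: "P \<in> hom_polys n E F" and T: "T \<in> hom_polys r F H"
  shows "compose (carrier E) T P \<in> hom_polys (r * n) E H"
    and "sup_norm E H (compose (carrier E) T P) \<le> sup_norm F H T * sup_norm E F P ^ r"
proof -
  interpret E: normed_carrier E by fact
  interpret F: normed_carrier F by fact
  interpret H: normed_carrier H by fact
  interpret EF: normed_pair E F ..
  interpret FH: normed_pair F H ..
  interpret EH: normed_pair E H ..
  let ?M = "sup_norm F H T * sup_norm E F P ^ r"
  have M: "0 \<le> ?M"
    using EF.sup_norm_nonneg[OF P] FH.sup_norm_nonneg[OF T] by simp
  have bound: "nrm H (compose (carrier E) T P u) \<le> ?M * nrm E u ^ (r * n)" if u: "u \<in> carrier E" for u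
  proof -
    have "nrm H (T (P u)) \<le> sup_norm F H T * nrm F (P u) ^ r"
      by (rule FH.nrm_le_sup_norm[OF T EF.hom_polys_closed[OF P u]])
    also have "\<dots> \<le> sup_norm F H T * (sup_norm E F P * nrm E u ^ n) ^ r"
      by (intro mult_left_mono power_mono EF.nrm_le_sup_norm[OF P u] FH.sup_norm_nonneg[OF T]
          F.nrm_nonneg EF.hom_polys_closed[OF P u])
    also have "\<dots> = ?M * nrm E u ^ (r * n)"
      by (simp add: power_mult_distrib mult.assoc mult.commute[of r n] flip: power_mult)
    finally show ?thesis
      using u by (simp add: compose_eq)
  qed
  then show "sup_norm E H (compose (carrier E) T P) \<le> ?M"
    by (rule EH.sup_norm_le[OF M])
  obtain A where A: "multilinear n E F A" "\<And>x. x \<in> carrier E \<Longrightarrow> P x = A (\<lambda>i\<in>{..<n}. x)"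
    using P unfolding hom_polys_def by blast
  obtain B where B: "multilinear r F H B" "\<And>x. x \<in> carrier F \<Longrightarrow> T x = B (\<lambda>i\<in>{..<r}. x)"
    using T unfolding hom_polys_def by blast
  note C = multilinear_blocks[where A = "\<lambda>_. A", OF nc A(1) B(1)]
  show "compose (carrier E) T P \<in> hom_polys (r * n) E H"
  proof (rule EH.hom_polysI[OF _ C(1) _ bound M])
    show "compose (carrier E) T P \<in> carrier E \<rightarrow>\<^sub>E carrier H"
      using EF.hom_polys_closed[OF P] FH.hom_polys_closed[OF T] by (auto simp: compose_def)
    show "compose (carrier E) T P x =
        B (\<lambda>i\<in>{..<r}. A (\<lambda>k\<in>{..<n}. (\<lambda>i\<in>{..<r * n}. x) (i * n + k)))" if x: "x \<in> carrier E" for x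
      unfolding C(2)[OF x] using A(2)[OF x] B(2)[OF EF.hom_polys_closed[OF P x]] x
      by (simp only: compose_eq)
  qed
qed


section \<open>Scalar-valued polynomials and rank-one polynomials\<close>

lemma scalar_space_simps [simp]:
  "carrier (scalar_space :: ('k::{real_normed_field, banach}, 'k) nvs) = UNIV"
  "x \<oplus>\<^bsub>scalar_space\<^esub> y = x + y" "\<zero>\<^bsub>scalar_space\<^esub> = 0" "a \<odot>\<^bsub>scalar_space\<^esub> x = a * x"
  "nrm scalar_space x = norm x"
  for x y a :: "'k::{real_normed_field, banach}"
  by (simp_all add: scalar_space_def)

lemma scalar_copy_simps [simp]:
  "carrier (scalar_copy :: ('k::{real_normed_field, banach}, 'u) space) = range Inl"
  "Inl x \<oplus>\<^bsub>scalar_copy :: ('k, 'u) space\<^esub> Inl y = Inl (x + y)"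
  "\<zero>\<^bsub>scalar_copy :: ('k, 'u) space\<^esub> = Inl 0"
  "a \<odot>\<^bsub>scalar_copy :: ('k, 'u) space\<^esub> Inl x = Inl (a * x)"
  "nrm (scalar_copy :: ('k, 'u) space) (Inl x) = norm x"
  by (simp_all add: scalar_copy_def)

lemma normed_carrier_scalar_space:
  "normed_carrier (scalar_space :: ('k::{real_normed_field, banach}, 'k) nvs)"
proof (rule normed_carrierI)
  show "Module.module (ring_of_type_algebra :: 'k ring) (scalar_space :: ('k, 'k) nvs)"
  proof (intro moduleI abelian_groupI cring_from_type_algebra)
    fix x :: 'k
    show "\<exists>y\<in>carrier scalar_space. y \<oplus>\<^bsub>scalar_space\<^esub> x = \<zero>\<^bsub>scalar_space\<^esub>"
      by (intro bexI[of _ "- x"]) simp_all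
  qed (simp_all add: algebra_simps)
qed (simp_all add: norm_mult norm_triangle_ineq)

lemma normed_carrier_scalar_copy:
  "normed_carrier (scalar_copy :: ('k::{real_normed_field, banach}, 'u) space)"
proof (rule normed_carrierI)
  show "Module.module (ring_of_type_algebra :: 'k ring) (scalar_copy :: ('k, 'u) space)"
  proof (intro moduleI abelian_groupI cring_from_type_algebra)
    fix x :: "'k + 'u" assume "x \<in> carrier scalar_copy"
    then obtain a where "x = Inl a"
      by auto
    then show "\<exists>y\<in>carrier scalar_copy. y \<oplus>\<^bsub>scalar_copy\<^esub> x = \<zero>\<^bsub>scalar_copy\<^esub>"
      by (intro bexI[of _ "Inl (- a)"]) simp_all
  qed (auto simp: algebra_simps)
qed (auto simp: norm_mult norm_triangle_ineq)

lemma scalar_space_minus: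
  "x \<ominus>\<^bsub>scalar_space\<^esub> y = x - y" for x y :: "'k::{real_normed_field, banach}"
proof -
  interpret normed_carrier "scalar_space :: ('k, 'k) nvs"
    by (rule normed_carrier_scalar_space)
  have "\<ominus>\<^bsub>scalar_space\<^esub> y = - y"
    using smult_minus_one[of y] by simp
  then show ?thesis
    by (simp add: a_minus_def)
qed

lemma scalar_copy_minus:
  "Inl x \<ominus>\<^bsub>scalar_copy :: ('k::{real_normed_field, banach}, 'u) space\<^esub> Inl y = Inl (x - y)"
proof -
  interpret normed_carrier "scalar_copy :: ('k, 'u) space"
    by (rule normed_carrier_scalar_copy)
  have "\<ominus>\<^bsub>scalar_copy :: ('k, 'u) space\<^esub> Inl y = Inl (- y)"
    using smult_minus_one[of "Inl y"] by simp
  then show ?thesis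
    by (simp add: a_minus_def)
qed

lemma banach_carrier_scalar_space:
  "banach_carrier (scalar_space :: ('k::{real_normed_field, banach}, 'k) nvs)"
proof -
  interpret normed_carrier "scalar_space :: ('k, 'k) nvs"
    by (rule normed_carrier_scalar_space)
  have "ndist (scalar_space :: ('k, 'k) nvs) = dist"
    by (simp add: fun_eq_iff ndist_def scalar_space_minus dist_norm)
  then have "Metric_space.mcomplete (carrier scalar_space) (ndist (scalar_space :: ('k, 'k) nvs))"
    using mcomplete_iff_complete[where 'a = 'k] complete_UNIV by simp
  then show ?thesis
    by unfold_locales
qed

lemma banach_carrier_scalar_copy:
  "banach_carrier (scalar_copy :: ('k::{real_normed_field, banach}, 'u) space)"
proof -
  let ?K = "scalar_copy :: ('k, 'u) space"
  interpret normed_carrier ?K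
    by (rule normed_carrier_scalar_copy)
  have dist: "ndist ?K (Inl a) (Inl b) = dist a b" for a b
    by (simp add: ndist_def scalar_copy_minus dist_norm)
  have "metric.mcomplete"
    unfolding metric.mcomplete_def
  proof (intro allI impI)
    fix s :: "nat \<Rightarrow> 'k + 'u" assume s: "metric.MCauchy s"
    then have "range s \<subseteq> carrier ?K"
      unfolding metric.MCauchy_def by (rule conjunct1)
    then have "s n \<in> range Inl" for n
      by (simp only: scalar_copy_simps range_subsetD)
    then have "\<forall>n. \<exists>a. s n = Inl a"
      by blast
    then obtain a where a: "s = (\<lambda>n. Inl (a n))"
      by metis
    have "\<forall>e>0. \<exists>N. \<forall>n n'. N \<le> n \<longrightarrow> N \<le> n' \<longrightarrow> dist (a n) (a n') < e"
      using s unfolding metric.MCauchy_def a dist by (rule conjunct2)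
    then have "Cauchy a"
      unfolding Cauchy_def by (meson order_refl)
    then obtain l where "a \<longlonglongrightarrow> l"
      using Cauchy_convergent_iff convergent_def by blast
    then have "(\<lambda>n. norm (a n - l)) \<longlonglongrightarrow> 0"
      by (intro tendsto_norm_zero LIM_zero)
    then have "limitin (ntop ?K) s (Inl l) sequentially"
      unfolding a by (subst limitin_ntop_iff) (simp_all add: scalar_copy_minus)
    then have "limitin metric.mtopology s (Inl l) sequentially"
      unfolding ntop_def .
    then show "\<exists>x. limitin metric.mtopology s x sequentially"
      by blast
  qed
  then show ?thesis
    by unfold_locales
qed

lemma hom_polys_linear:
  assumes "normed_carrier E" "normed_carrier F"
    and f: "f \<in> carrier E \<rightarrow>\<^sub>E carrier F"
    and add: "\<And>x y. x \<in> carrier E \<Longrightarrow> y \<in> carrier E \<Longrightarrow> f (x \<oplus>\<^bsub>E\<^esub> y) = f x \<oplus>\<^bsub>F\<^esub> f y"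
    and smult: "\<And>a x. x \<in> carrier E \<Longrightarrow> f (a \<odot>\<^bsub>E\<^esub> x) = a \<odot>\<^bsub>F\<^esub> f x"
    and bound: "\<And>x. x \<in> carrier E \<Longrightarrow> nrm F (f x) \<le> M * nrm E x" and M: "0 \<le> M"
  shows "f \<in> hom_polys 1 E F" and "sup_norm E F f \<le> M"
proof -
  interpret E: normed_carrier E by fact
  interpret F: normed_carrier F by fact
  interpret normed_pair E F ..
  show "f \<in> hom_polys 1 E F"
  proof (rule hom_polysI[where A = "\<lambda>x. f (x 0)" and M = M])
    show "multilinear 1 E F (\<lambda>x. f (x 0))"
      unfolding multilinear_def using f add smult by auto
  qed (use f bound M in auto)
  show "sup_norm E F f \<le> M"
    using M by (rule sup_norm_le[where n = 1]) (use bound in simp)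
qed

lemma hom_polys_smult_vector:
  assumes "normed_carrier F" and y: "y \<in> carrier F"
  shows "(\<lambda>a. a \<odot>\<^bsub>F\<^esub> y) \<in> hom_polys 1 scalar_space F"
    and "sup_norm scalar_space F (\<lambda>a. a \<odot>\<^bsub>F\<^esub> y) \<le> nrm F y"
proof -
  interpret F: normed_carrier F by fact
  have f: "(\<lambda>a. a \<odot>\<^bsub>F\<^esub> y) \<in> carrier scalar_space \<rightarrow>\<^sub>E carrier F"
    using y by auto
  note lin = hom_polys_linear[OF normed_carrier_scalar_space assms(1) f, of "nrm F y"]
  have add: "(a + b) \<odot>\<^bsub>F\<^esub> y = a \<odot>\<^bsub>F\<^esub> y \<oplus>\<^bsub>F\<^esub> b \<odot>\<^bsub>F\<^esub> y" and smult: "(a * b) \<odot>\<^bsub>F\<^esub> y = a \<odot>\<^bsub>F\<^esub> (b \<odot>\<^bsub>F\<^esub> y)" for a b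
    using F.smult_l_distr[OF _ _ y, of a b] F.smult_assoc1[OF _ _ y, of a b] by simp_all
  show "(\<lambda>a. a \<odot>\<^bsub>F\<^esub> y) \<in> hom_polys 1 scalar_space F"
    by (rule lin(1)) (use y in \<open>simp_all add: add smult\<close>)
  show "sup_norm scalar_space F (\<lambda>a. a \<odot>\<^bsub>F\<^esub> y) \<le> nrm F y"
    by (rule lin(2)) (use y in \<open>simp_all add: add smult\<close>)
qed

lemma hom_polys_rank_one:
  fixes E :: "('k::{real_normed_field, banach}, 'a) nvs" and F :: "('k, 'b) nvs"
  assumes "normed_carrier E" "normed_carrier F"
    and p: "p \<in> hom_polys n E scalar_space" and y: "y \<in> carrier F"
  shows "(\<lambda>x\<in>carrier E. p x \<odot>\<^bsub>F\<^esub> y) \<in> hom_polys n E F"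
    and "sup_norm E F (\<lambda>x\<in>carrier E. p x \<odot>\<^bsub>F\<^esub> y) \<le> sup_norm E scalar_space p * nrm F y"
proof -
  interpret E: normed_carrier E by fact
  interpret K: normed_carrier "scalar_space :: ('k, 'k) nvs"
    by (rule normed_carrier_scalar_space)
  interpret EK: normed_pair E scalar_space ..
  note c = hom_polys_compose[OF assms(1) normed_carrier_scalar_space assms(2) p
      hom_polys_smult_vector(1)[OF assms(2) y]]
  have eq: "compose (carrier E) (\<lambda>a. a \<odot>\<^bsub>F\<^esub> y) p = (\<lambda>x\<in>carrier E. p x \<odot>\<^bsub>F\<^esub> y)"
    by (simp add: compose_def)
  show "(\<lambda>x\<in>carrier E. p x \<odot>\<^bsub>F\<^esub> y) \<in> hom_polys n E F"
    using c(1) by (simp add: eq)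
  have "sup_norm scalar_space F (\<lambda>a. a \<odot>\<^bsub>F\<^esub> y) * sup_norm E scalar_space p \<le> nrm F y * sup_norm E scalar_space p"
    by (intro mult_right_mono hom_polys_smult_vector(2)[OF assms(2) y] EK.sup_norm_nonneg[OF p])
  then show "sup_norm E F (\<lambda>x\<in>carrier E. p x \<odot>\<^bsub>F\<^esub> y) \<le> sup_norm E scalar_space p * nrm F y"
    using c(2) by (simp add: eq mult.commute)
qed

text \<open>The multilinear map behind powers and products of scalar-valued polynomials.\<close>

lemma multilinear_prod:
  "multilinear r (scalar_space :: ('k::{real_normed_field, banach}, 'k) nvs) scalar_space (\<lambda>x. \<Prod>i<r. x i)"
  unfolding multilinear_def
proof (intro conjI ballI allI impI)
  fix x :: "nat \<Rightarrow> 'k" and k assume k: "k < r"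
  have upd: "(\<Prod>i<r. (x(k := u)) i) = u * (\<Prod>i\<in>{..<r} - {k}. x i)" for u
  proof -
    have "(\<Prod>i<r. (x(k := u)) i) = (x(k := u)) k * (\<Prod>i\<in>{..<r} - {k}. (x(k := u)) i)"
      by (rule prod.remove) (use k in auto)
    also have "(\<Prod>i\<in>{..<r} - {k}. (x(k := u)) i) = (\<Prod>i\<in>{..<r} - {k}. x i)"
      by (rule prod.cong) auto
    finally show ?thesis
      by simp
  qed
  show "(\<Prod>i<r. (x(k := u \<oplus>\<^bsub>scalar_space\<^esub> v)) i) =
      (\<Prod>i<r. (x(k := u)) i) \<oplus>\<^bsub>scalar_space\<^esub> (\<Prod>i<r. (x(k := v)) i)" for u v
    by (simp only: upd scalar_space_simps distrib_right)
  show "(\<Prod>i<r. (x(k := a \<odot>\<^bsub>scalar_space\<^esub> u)) i) = a \<odot>\<^bsub>scalar_space\<^esub> (\<Prod>i<r. (x(k := u)) i)" for a u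
    by (simp only: upd scalar_space_simps mult.assoc)
qed simp

lemma hom_polys_prod:
  fixes E :: "('k::{real_normed_field, banach}, 'a) nvs"
  assumes "normed_carrier E" and p: "\<And>i. i < r \<Longrightarrow> p i \<in> hom_polys n E scalar_space"
  shows "(\<lambda>x\<in>carrier E. \<Prod>i<r. p i x) \<in> hom_polys (r * n) E scalar_space"
    and "sup_norm E scalar_space (\<lambda>x\<in>carrier E. \<Prod>i<r. p i x) \<le> (\<Prod>i<r. sup_norm E scalar_space (p i))"
proof -
  interpret E: normed_carrier E by fact
  interpret K: normed_carrier "scalar_space :: ('k, 'k) nvs"
    by (rule normed_carrier_scalar_space)
  interpret EK: normed_pair E scalar_space ..
  let ?M = "\<Prod>i<r. sup_norm E scalar_space (p i)"
  have M: "0 \<le> ?M"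
    by (intro prod_nonneg) (use EK.sup_norm_nonneg[OF p] in auto)
  have bound: "nrm scalar_space ((\<lambda>x\<in>carrier E. \<Prod>i<r. p i x) u) \<le> ?M * nrm E u ^ (r * n)"
    if u: "u \<in> carrier E" for u
  proof -
    have "(\<Prod>i<r. norm (p i u)) \<le> (\<Prod>i<r. sup_norm E scalar_space (p i) * nrm E u ^ n)"
      using EK.nrm_le_sup_norm[OF p u] by (intro prod_mono) auto
    also have "\<dots> = ?M * nrm E u ^ (r * n)"
      by (simp add: prod.distrib mult.commute[of r n] flip: power_mult)
    finally show ?thesis
      using u by (simp add: prod_norm)
  qed
  then show "sup_norm E scalar_space (\<lambda>x\<in>carrier E. \<Prod>i<r. p i x) \<le> ?M"
    by (rule EK.sup_norm_le[OF M])
  have "\<exists>A. multilinear n E scalar_space A \<and> (\<forall>x\<in>carrier E. p i x = A (\<lambda>i\<in>{..<n}. x))" if "i < r" for i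
    using p[OF that] unfolding hom_polys_def by blast
  then obtain A where A: "\<And>i. i < r \<Longrightarrow> multilinear n E scalar_space (A i)"
      "\<And>i x. i < r \<Longrightarrow> x \<in> carrier E \<Longrightarrow> p i x = A i (\<lambda>i\<in>{..<n}. x)"
    by metis
  note C = multilinear_blocks[where A = A, OF assms(1) normed_carrier_scalar_space
      normed_carrier_scalar_space A(1) multilinear_prod]
  show "(\<lambda>x\<in>carrier E. \<Prod>i<r. p i x) \<in> hom_polys (r * n) E scalar_space"
  proof (rule EK.hom_polysI[OF _ C(1) _ bound M])
    show "(\<lambda>x\<in>carrier E. \<Prod>i<r. p i x) x = (\<Prod>i<r. (\<lambda>i\<in>{..<r}. A i (\<lambda>k\<in>{..<n}. (\<lambda>i\<in>{..<r * n}. x) (i * n + k))) i)"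
      if x: "x \<in> carrier E" for x
      by (subst C(2)) (use A(2)[OF _ x] x in auto)
  qed auto
qed

lemma hom_polys_power:
  "(\<lambda>a. a ^ n) \<in> hom_polys n (scalar_space :: ('k::{real_normed_field, banach}, 'k) nvs) scalar_space"
  "sup_norm (scalar_space :: ('k, 'k) nvs) scalar_space (\<lambda>a. a ^ n) \<le> 1"
proof -
  interpret K: normed_carrier "scalar_space :: ('k, 'k) nvs"
    by (rule normed_carrier_scalar_space)
  interpret KK: normed_pair "scalar_space :: ('k, 'k) nvs" scalar_space ..
  show "(\<lambda>a. a ^ n) \<in> hom_polys n (scalar_space :: ('k, 'k) nvs) scalar_space"
    by (rule KK.hom_polysI[OF _ multilinear_prod, where M = 1]) (auto simp: norm_power)
  show "sup_norm (scalar_space :: ('k, 'k) nvs) scalar_space (\<lambda>a. a ^ n) \<le> 1"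
    by (rule KK.sup_norm_le[where n = n]) (auto simp: norm_power)
qed


section \<open>Spaces of polynomials\<close>

context normed_pair
begin

lemma hom_poly_space_simps [simp]:
  "carrier (hom_poly_space n E F) = hom_polys n E F"
  "P \<oplus>\<^bsub>hom_poly_space n E F\<^esub> Q = (\<lambda>x\<in>carrier E. P x \<oplus>\<^bsub>F\<^esub> Q x)"
  "\<zero>\<^bsub>hom_poly_space n E F\<^esub> = (\<lambda>x\<in>carrier E. \<zero>\<^bsub>F\<^esub>)"
  "a \<odot>\<^bsub>hom_poly_space n E F\<^esub> P = (\<lambda>x\<in>carrier E. a \<odot>\<^bsub>F\<^esub> P x)"
  by (simp_all add: hom_poly_space_def)

text \<open>The norm \<open>g\<close> is arbitrary because an ideal of polynomials comes with a norm of its own.\<close>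

lemma module_poly_subspace:
  assumes W: "W \<subseteq> hom_polys n E F" and zero: "(\<lambda>x\<in>carrier E. \<zero>\<^bsub>F\<^esub>) \<in> W"
    and add: "\<And>P Q. P \<in> W \<Longrightarrow> Q \<in> W \<Longrightarrow> (\<lambda>x\<in>carrier E. P x \<oplus>\<^bsub>F\<^esub> Q x) \<in> W"
    and scale: "\<And>a P. P \<in> W \<Longrightarrow> (\<lambda>x\<in>carrier E. a \<odot>\<^bsub>F\<^esub> P x) \<in> W"
  shows "Module.module (ring_of_type_algebra :: 'k ring) (hom_poly_space n E F\<lparr>carrier := W, nrm := g\<rparr>)"
proof -
  have cl: "P x \<in> carrier F" if "P \<in> W" "x \<in> carrier E" for P x
    by (rule hom_polys_closed[OF subsetD[OF W that(1)] that(2)])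
  have restr: "(\<lambda>x\<in>carrier E. P x) = P" if "P \<in> W" for P
    using hom_polys_extensional[OF subsetD[OF W that]] by (intro extensional_restrict) (simp add: PiE_def)
  let ?S = "hom_poly_space n E F\<lparr>carrier := W, nrm := g\<rparr>"
  have S: "carrier ?S = W" "\<zero>\<^bsub>?S\<^esub> = (\<lambda>x\<in>carrier E. \<zero>\<^bsub>F\<^esub>)"
    "P \<oplus>\<^bsub>?S\<^esub> Q = (\<lambda>x\<in>carrier E. P x \<oplus>\<^bsub>F\<^esub> Q x)"
    "a \<odot>\<^bsub>?S\<^esub> P = (\<lambda>x\<in>carrier E. a \<odot>\<^bsub>F\<^esub> P x)" for P Q a
    by simp_all
  show ?thesis
  proof (rule moduleI[OF cring_from_type_algebra abelian_groupI], unfold S ring_of_type_algebra_simps)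
    fix P Q R assume PQR: "P \<in> W" "Q \<in> W" "R \<in> W"
    show "(\<lambda>x\<in>carrier E. (\<lambda>x\<in>carrier E. P x \<oplus>\<^bsub>F\<^esub> Q x) x \<oplus>\<^bsub>F\<^esub> R x) =
        (\<lambda>x\<in>carrier E. P x \<oplus>\<^bsub>F\<^esub> (\<lambda>x\<in>carrier E. Q x \<oplus>\<^bsub>F\<^esub> R x) x)"
      by (rule restrict_ext) (simp add: F.M.a_assoc cl PQR)
  next
    fix P Q assume PQ: "P \<in> W" "Q \<in> W"
    show "(\<lambda>x\<in>carrier E. P x \<oplus>\<^bsub>F\<^esub> Q x) = (\<lambda>x\<in>carrier E. Q x \<oplus>\<^bsub>F\<^esub> P x)"
      by (rule restrict_ext) (simp add: F.M.a_comm cl PQ)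
    fix a :: 'k
    show "(\<lambda>x\<in>carrier E. a \<odot>\<^bsub>F\<^esub> (\<lambda>x\<in>carrier E. P x \<oplus>\<^bsub>F\<^esub> Q x) x) =
        (\<lambda>x\<in>carrier E. (\<lambda>x\<in>carrier E. a \<odot>\<^bsub>F\<^esub> P x) x \<oplus>\<^bsub>F\<^esub> (\<lambda>x\<in>carrier E. a \<odot>\<^bsub>F\<^esub> Q x) x)"
      by (rule restrict_ext) (simp add: F.smult_r_distr cl PQ)
  next
    fix P assume P: "P \<in> W"
    have "(\<lambda>x\<in>carrier E. (\<lambda>x\<in>carrier E. \<zero>\<^bsub>F\<^esub>) x \<oplus>\<^bsub>F\<^esub> P x) = (\<lambda>x\<in>carrier E. P x)"
      by (rule restrict_ext) (simp add: cl P)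
    then show "(\<lambda>x\<in>carrier E. (\<lambda>x\<in>carrier E. \<zero>\<^bsub>F\<^esub>) x \<oplus>\<^bsub>F\<^esub> P x) = P"
      unfolding restr[OF P] .
    have "(\<lambda>x\<in>carrier E. (\<lambda>x\<in>carrier E. (- 1) \<odot>\<^bsub>F\<^esub> P x) x \<oplus>\<^bsub>F\<^esub> P x) = (\<lambda>x\<in>carrier E. \<zero>\<^bsub>F\<^esub>)"
      by (rule restrict_ext) (simp add: F.smult_minus_one F.M.l_neg cl P)
    then show "\<exists>Q\<in>W. (\<lambda>x\<in>carrier E. Q x \<oplus>\<^bsub>F\<^esub> P x) = (\<lambda>x\<in>carrier E. \<zero>\<^bsub>F\<^esub>)"
      by (rule bexI[OF _ scale[OF P]])
    have "(\<lambda>x\<in>carrier E. 1 \<odot>\<^bsub>F\<^esub> P x) = (\<lambda>x\<in>carrier E. P x)"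
      by (rule restrict_ext) (use F.smult_one cl P in simp)
    then show "(\<lambda>x\<in>carrier E. 1 \<odot>\<^bsub>F\<^esub> P x) = P"
      unfolding restr[OF P] .
    fix a b :: 'k
    show "(\<lambda>x\<in>carrier E. (a + b) \<odot>\<^bsub>F\<^esub> P x) =
        (\<lambda>x\<in>carrier E. (\<lambda>x\<in>carrier E. a \<odot>\<^bsub>F\<^esub> P x) x \<oplus>\<^bsub>F\<^esub> (\<lambda>x\<in>carrier E. b \<odot>\<^bsub>F\<^esub> P x) x)"
      by (rule restrict_ext) (use F.smult_l_distr[OF _ _ cl[OF P], of a b] in simp)
    show "(\<lambda>x\<in>carrier E. (a * b) \<odot>\<^bsub>F\<^esub> P x) =
        (\<lambda>x\<in>carrier E. a \<odot>\<^bsub>F\<^esub> (\<lambda>x\<in>carrier E. b \<odot>\<^bsub>F\<^esub> P x) x)"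
      by (rule restrict_ext) (use F.smult_assoc1[OF _ _ cl[OF P], of a b] in simp)
  qed (use zero add scale in blast)+
qed

lemma module_hom_poly_space:
  "Module.module (ring_of_type_algebra :: 'k ring) (hom_poly_space n E F)"
proof -
  have "hom_poly_space n E F = hom_poly_space n E F\<lparr>carrier := hom_polys n E F, nrm := sup_norm E F\<rparr>"
    by (simp add: hom_poly_space_def)
  then show ?thesis
    using module_poly_subspace[OF order_refl hom_polys_zero hom_polys_add hom_polys_scale] by metis
qed

lemma submodule_hom_poly_space:
  assumes W: "W \<subseteq> hom_polys n E F" and zero: "(\<lambda>x\<in>carrier E. \<zero>\<^bsub>F\<^esub>) \<in> W"
    and add: "\<And>P Q. P \<in> W \<Longrightarrow> Q \<in> W \<Longrightarrow> (\<lambda>x\<in>carrier E. P x \<oplus>\<^bsub>F\<^esub> Q x) \<in> W"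
    and scale: "\<And>a P. P \<in> W \<Longrightarrow> (\<lambda>x\<in>carrier E. a \<odot>\<^bsub>F\<^esub> P x) \<in> W"
  shows "submodule W (ring_of_type_algebra :: 'k ring) (hom_poly_space n E F)"
proof -
  interpret M: Module.module "ring_of_type_algebra :: 'k ring" "hom_poly_space n E F"
    by (rule module_hom_poly_space)
  have eq: "hom_poly_space n E F\<lparr>carrier := W\<rparr> = hom_poly_space n E F\<lparr>carrier := W, nrm := sup_norm E F\<rparr>"
    by (simp add: hom_poly_space_def)
  have "Module.module (ring_of_type_algebra :: 'k ring) (hom_poly_space n E F\<lparr>carrier := W\<rparr>)"
    by (subst eq, rule module_poly_subspace[OF W zero add scale])
  then show ?thesis
    by (intro M.module_incl_imp_submodule) (use W in simp_all)
qed

context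
  fixes n W g
  assumes W: "W \<subseteq> hom_polys n E F"
    and S: "Module.module (ring_of_type_algebra :: 'k ring) (hom_poly_space n E F\<lparr>carrier := W, nrm := g\<rparr>)"
begin

interpretation S: Module.module "ring_of_type_algebra :: 'k ring"
    "hom_poly_space n E F\<lparr>carrier := W, nrm := g\<rparr>"
  by (rule S)

lemma poly_subspace_minus:
  assumes "P \<in> W" "Q \<in> W" "x \<in> carrier E"
  shows "(P \<ominus>\<^bsub>hom_poly_space n E F\<lparr>carrier := W, nrm := g\<rparr>\<^esub> Q) x = P x \<ominus>\<^bsub>F\<^esub> Q x"
proof -
  have "\<ominus>\<^bsub>hom_poly_space n E F\<lparr>carrier := W, nrm := g\<rparr>\<^esub> Q = (\<lambda>x\<in>carrier E. (- 1) \<odot>\<^bsub>F\<^esub> Q x)"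
    using S.smult_l_minus[of 1 Q] S.smult_one[of Q] assms(2) by simp
  moreover have "Q x \<in> carrier F"
    by (rule hom_polys_closed[OF subsetD[OF W assms(2)] assms(3)])
  ultimately show ?thesis
    using assms(3) by (simp add: a_minus_def F.smult_minus_one)
qed

lemma poly_subspace_finsum:
  assumes "finite I" "f \<in> I \<rightarrow> W" "x \<in> carrier E"
  shows "finsum (hom_poly_space n E F\<lparr>carrier := W, nrm := g\<rparr>) f I x = finsum F (\<lambda>i. f i x) I"
  using assms(1,2)
proof (induction I)
  case empty
  then show ?case
    using assms(3) S.M.finsum_empty[of f] by simp
next
  case (insert i I)
  have cl: "f j x \<in> carrier F" if "j \<in> insert i I" for j
    using hom_polys_closed[OF subsetD[OF W funcset_mem[OF insert.prems that]] assms(3)] .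
  have "finsum (hom_poly_space n E F\<lparr>carrier := W, nrm := g\<rparr>) f (insert i I) x =
      f i x \<oplus>\<^bsub>F\<^esub> finsum (hom_poly_space n E F\<lparr>carrier := W, nrm := g\<rparr>) f I x"
    using S.M.finsum_insert[OF insert.hyps, of f] insert.prems assms(3) by simp
  also have "\<dots> = finsum F (\<lambda>i. f i x) (insert i I)"
    using insert by (subst F.M.finsum_insert) (auto intro!: cl)
  finally show ?case .
qed

end

end


section \<open>Hyper-nuclear polynomials as sums of rank-one polynomials\<close>

text \<open>A representation of \<open>P\<close> as a sum of rank-one polynomials. In contrast to \<open>hyper_nuclear_rep\<close>
  the scalar coefficients are absorbed into the polynomials and the index set is free, so that
  double series and products of series are representations as they stand.\<close>

definition nuclear_sum ::
    "nat \<Rightarrow> ('k::{real_normed_field, banach}, 'a) nvs \<Rightarrow> ('k, 'b) nvs \<Rightarrow> 'i set \<Rightarrow>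
     ('i \<Rightarrow> 'a \<Rightarrow> 'k) \<Rightarrow> ('i \<Rightarrow> 'b) \<Rightarrow> ('a \<Rightarrow> 'b) \<Rightarrow> bool" where
  "nuclear_sum n E F I p y P \<longleftrightarrow>
     (\<forall>i\<in>I. p i \<in> hom_polys n E scalar_space \<and> y i \<in> carrier F) \<and>
     (\<lambda>i. sup_norm E scalar_space (p i) * nrm F (y i)) summable_on I \<and>
     P \<in> carrier E \<rightarrow>\<^sub>E carrier F \<and>
     (\<forall>x\<in>carrier E. abs_sums F (\<lambda>i. p i x \<odot>\<^bsub>F\<^esub> y i) I (P x))"

abbreviation nuclear_cost ::
    "('k::{real_normed_field, banach}, 'a) nvs \<Rightarrow> ('k, 'b) nvs \<Rightarrow> 'i set \<Rightarrow>
     ('i \<Rightarrow> 'a \<Rightarrow> 'k) \<Rightarrow> ('i \<Rightarrow> 'b) \<Rightarrow> real" where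
  "nuclear_cost E F I p y \<equiv> \<Sum>\<^sub>\<infinity>i\<in>I. sup_norm E scalar_space (p i) * nrm F (y i)"

lemma nuclear_sumD:
  assumes "nuclear_sum n E F I p y P"
  shows "\<And>i. i \<in> I \<Longrightarrow> p i \<in> hom_polys n E scalar_space" "\<And>i. i \<in> I \<Longrightarrow> y i \<in> carrier F"
    "(\<lambda>i. sup_norm E scalar_space (p i) * nrm F (y i)) summable_on I"
    "P \<in> carrier E \<rightarrow>\<^sub>E carrier F"
    "\<And>x. x \<in> carrier E \<Longrightarrow> abs_sums F (\<lambda>i. p i x \<odot>\<^bsub>F\<^esub> y i) I (P x)"
  using assms by (auto simp: nuclear_sum_def)

context normed_banach_pair
begin

interpretation K: banach_carrier "scalar_space :: ('k, 'k) nvs"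
  by (rule banach_carrier_scalar_space)

interpretation EK: normed_banach_pair E scalar_space ..

lemma nrm_rank_one_le:
  assumes "p \<in> hom_polys n E scalar_space" "y \<in> carrier F" "x \<in> carrier E"
  shows "nrm F (p x \<odot>\<^bsub>F\<^esub> y) \<le> sup_norm E scalar_space p * nrm F y * nrm E x ^ n"
proof -
  have "norm (p x) * nrm F y \<le> (sup_norm E scalar_space p * nrm E x ^ n) * nrm F y"
    using EK.nrm_le_sup_norm[OF assms(1,3)] F.nrm_nonneg[OF assms(2)]
    by (intro mult_right_mono) simp_all
  then show ?thesis
    using assms(2) by (simp add: mult_ac)
qed

lemma nuclear_sum_exists:
  assumes p: "\<And>i. i \<in> I \<Longrightarrow> p i \<in> hom_polys n E scalar_space" and y: "\<And>i. i \<in> I \<Longrightarrow> y i \<in> carrier F"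
    and summable: "(\<lambda>i. sup_norm E scalar_space (p i) * nrm F (y i)) summable_on I"
  shows "\<exists>P. nuclear_sum n E F I p y P"
proof -
  have "\<exists>s. abs_sums F (\<lambda>i. p i x \<odot>\<^bsub>F\<^esub> y i) I s" if x: "x \<in> carrier E" for x
  proof (rule F.abs_sums_exists)
    show cl: "(\<lambda>i. p i x \<odot>\<^bsub>F\<^esub> y i) \<in> I \<rightarrow> carrier F"
      by (intro funcsetI F.smult_closed y) simp
    show "(\<lambda>i. nrm F (p i x \<odot>\<^bsub>F\<^esub> y i)) summable_on I"
      by (rule summable_on_comparison_test[OF summable_on_cmult_left[OF summable, of "nrm E x ^ n"]])
        (use nrm_rank_one_le[OF p y x] F.nrm_nonneg[OF funcset_mem[OF cl]] in auto)
  qed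
  then obtain S where S: "\<And>x. x \<in> carrier E \<Longrightarrow> abs_sums F (\<lambda>i. p i x \<odot>\<^bsub>F\<^esub> y i) I (S x)"
    by metis
  have "nuclear_sum n E F I p y (\<lambda>x\<in>carrier E. S x)"
    unfolding nuclear_sum_def using p y summable S F.abs_sumsD(2)[OF S] by auto
  then show ?thesis
    by blast
qed

lemma nuclear_sum_hom_polys:
  assumes "nuclear_sum n E F I p y P"
  shows "P \<in> hom_polys n E F" and "sup_norm E F P \<le> nuclear_cost E F I p y"
proof -
  note D = nuclear_sumD[OF assms]
  let ?q = "\<lambda>i. \<lambda>x\<in>carrier E. p i x \<odot>\<^bsub>F\<^esub> y i"
  have q: "?q i \<in> hom_polys n E F"
    "sup_norm E F (?q i) \<le> sup_norm E scalar_space (p i) * nrm F (y i)" if "i \<in> I" for i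
    by (rule hom_polys_rank_one[OF E.normed_carrier_axioms F.normed_carrier_axioms D(1,2)[OF that]])+
  have summable: "(\<lambda>i. sup_norm E F (?q i)) summable_on I"
    by (rule summable_on_comparison_test[OF D(3) q(2) sup_norm_nonneg[OF q(1)]])
  have sums: "abs_sums F (\<lambda>i. ?q i x) I (P x)" if "x \<in> carrier E" for x
    using D(5)[OF that] that by simp
  show P: "P \<in> hom_polys n E F"
    by (rule hom_polys_abs_sums[OF q(1) summable sums D(4)])
  have nonneg: "0 \<le> (\<Sum>\<^sub>\<infinity>i\<in>I. sup_norm E F (?q i))"
    by (rule infsum_nonneg) (rule sup_norm_nonneg[OF q(1)])
  have "sup_norm E F P \<le> (\<Sum>\<^sub>\<infinity>i\<in>I. sup_norm E F (?q i))"
    by (rule sup_norm_le[OF nonneg]) (rule abs_sums_hom_polys_bound[OF q(1) summable sums])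
  also have "\<dots> \<le> nuclear_cost E F I p y"
    by (rule infsum_mono[OF summable D(3) q(2)])
  finally show "sup_norm E F P \<le> nuclear_cost E F I p y" .
qed

lemma rep_value_nonneg:
  assumes "hyper_nuclear_rep n E F P lam p y"
  shows "0 \<le> (SUP j. sup_norm E scalar_space (p j))" "0 \<le> (SUP j. nrm F (y j))"
    "0 \<le> (\<Sum>j. norm (lam j))"
proof -
  note R = assms[unfolded hyper_nuclear_rep_def]
  have "sup_norm E scalar_space (p 0) \<le> (SUP j. sup_norm E scalar_space (p j))"
    using R by (intro cSUP_upper) auto
  then show "0 \<le> (SUP j. sup_norm E scalar_space (p j))"
    using EK.sup_norm_nonneg[of "p 0" n] R by simp
  have "nrm F (y 0) \<le> (SUP j. nrm F (y j))"
    using R by (intro cSUP_upper) auto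
  moreover have "y 0 \<in> carrier F"
    using R by blast
  ultimately show "0 \<le> (SUP j. nrm F (y j))"
    using F.nrm_nonneg[of "y 0"] by linarith
  show "0 \<le> (\<Sum>j. norm (lam j))"
    using R by (intro suminf_nonneg) auto
qed

lemma hyper_nuclear_norm_le:
  assumes "hyper_nuclear_rep n E F P lam p y"
  shows "hyper_nuclear_norm n E F P \<le>
    (\<Sum>j. norm (lam j)) * (SUP j. sup_norm E scalar_space (p j)) * (SUP j. nrm F (y j))"
  unfolding hyper_nuclear_norm_def
proof (rule cInf_lower)
  show "bdd_below {(\<Sum>j. norm (lam j)) * (SUP j. sup_norm E scalar_space (p j)) *
      (SUP j. nrm F (y j)) |lam p y. hyper_nuclear_rep n E F P lam p y}"
    by (rule bdd_belowI[of _ 0]) (auto intro!: mult_nonneg_nonneg rep_value_nonneg)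
qed (use assms in blast)

text \<open>After numbering the index set, \<open>p i\<close> and \<open>y i\<close> are divided by their norms, whose product
  becomes the scalar coefficient. The two suprema are then at most 1 and the coefficients sum up
  to the cost.\<close>

lemma hyper_nuclear_if_nuclear_sum:
  assumes I: "countable I" and P: "nuclear_sum n E F I p y P"
  shows "P \<in> hyper_nuclear n E F" and "hyper_nuclear_norm n E F P \<le> nuclear_cost E F I p y"
proof -
  note D = nuclear_sumD[OF P]
  define g where "g = inv_into I (to_nat_on I)"
  define J where "J = to_nat_on I ` I"
  have inj: "inj_on (to_nat_on I) I"
    using I by (rule inj_on_to_nat_on)
  have g: "g j \<in> I" if "j \<in> J" for j
    using that unfolding g_def J_def by (rule inv_into_into)
  have gh: "g (to_nat_on I i) = i" if "i \<in> I" for i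
    unfolding g_def by (rule inv_into_f_f[OF inj that])
  define a where "a i = sup_norm E scalar_space (p i)" for i
  define b where "b i = nrm F (y i)" for i
  have a: "0 \<le> a i" and b: "0 \<le> b i" if "i \<in> I" for i
    unfolding a_def b_def using EK.sup_norm_nonneg[OF D(1)[OF that]] D(2)[OF that] by simp_all
  \<comment> \<open>Numbers outside \<open>J\<close> get the coefficient 0. A factor of norm 0 is replaced by 0, since
    \<open>inverse 0 = 0\<close>; its summand vanishes anyway.\<close>
  define lam :: "nat \<Rightarrow> 'k" where "lam j = (if j \<in> J then of_real (a (g j) * b (g j)) else 0)" for j
  define q where "q j = (if j \<in> J
      then (\<lambda>x\<in>carrier E. inverse (of_real (a (g j))) \<odot>\<^bsub>scalar_space\<^esub> p (g j) x)
      else (\<lambda>x\<in>carrier E. \<zero>\<^bsub>scalar_space\<^esub>))" for j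
  define z where "z j = (if j \<in> J then inverse (of_real (b (g j)) :: 'k) \<odot>\<^bsub>F\<^esub> y (g j) else \<zero>\<^bsub>F\<^esub>)" for j
  have norm_lam: "norm (lam j) = (if j \<in> J then a (g j) * b (g j) else 0)" for j
    using a b g by (simp add: lam_def norm_mult)
  have lam_J: "((\<lambda>j. norm (lam j)) has_sum nuclear_cost E F I p y) J"
  proof -
    have "((\<lambda>i. a i * b i) has_sum nuclear_cost E F I p y) I"
      using D(3) unfolding a_def b_def by simp
    then have "((\<lambda>j. norm (lam j)) \<circ> to_nat_on I has_sum nuclear_cost E F I p y) I"
      by (subst has_sum_cong[where g = "\<lambda>i. a i * b i"]) (auto simp: norm_lam gh J_def)
    then show ?thesis
      unfolding J_def by (subst has_sum_reindex[OF inj])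
  qed
  have lam_UNIV: "((\<lambda>j. norm (lam j)) has_sum nuclear_cost E F I p y) UNIV"
    using lam_J by (subst has_sum_cong_neutral[where T = J and g = "\<lambda>j. norm (lam j)"]) (auto simp: norm_lam)
  then have lam_sums: "(\<lambda>j. norm (lam j)) sums nuclear_cost E F I p y"
    by (rule has_sum_imp_sums)
  have q: "q j \<in> hom_polys n E scalar_space" "sup_norm E scalar_space (q j) \<le> 1" for j
  proof -
    have zero: "sup_norm E scalar_space (\<lambda>x\<in>carrier E. \<zero>\<^bsub>scalar_space\<^esub>) \<le> 0"
      by (rule EK.sup_norm_le) auto
    show "q j \<in> hom_polys n E scalar_space"
      unfolding q_def using EK.hom_polys_zero EK.hom_polys_scale[OF D(1)[OF g]] by simp
    show "sup_norm E scalar_space (q j) \<le> 1"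
    proof (cases "j \<in> J")
      case True
      then have "sup_norm E scalar_space (q j) \<le> norm (inverse (of_real (a (g j))) :: 'k) * a (g j)"
        unfolding q_def a_def using EK.sup_norm_scale_le[OF D(1)[OF g]] by simp
      also have "\<dots> \<le> 1"
        using a[OF g[OF True]] by (cases "a (g j) = 0") (auto simp: norm_inverse)
      finally show ?thesis .
    qed (use zero in \<open>simp add: q_def\<close>)
  qed
  have z: "z j \<in> carrier F" "nrm F (z j) \<le> 1" for j
  proof -
    show "z j \<in> carrier F"
      unfolding z_def using F.smult_closed[OF _ D(2)[OF g]] by simp
    show "nrm F (z j) \<le> 1"
    proof (cases "j \<in> J")
      case True
      have "nrm F (z j) = norm (inverse (of_real (b (g j))) :: 'k) * b (g j)"
        unfolding z_def b_def using D(2)[OF g[OF True]] True by simp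
      also have "\<dots> \<le> 1"
        using b[OF g[OF True]] by (cases "b (g j) = 0") (auto simp: norm_inverse)
      finally show ?thesis .
    qed (simp add: z_def)
  qed
  have cl: "(lam j * q j x) \<odot>\<^bsub>F\<^esub> z j \<in> carrier F" for j x
    by (rule F.smult_closed[OF _ z(1)]) simp
  have summand: "(lam j * q j x) \<odot>\<^bsub>F\<^esub> z j = p (g j) x \<odot>\<^bsub>F\<^esub> y (g j)" if j: "j \<in> J" and x: "x \<in> carrier E" for j x
  proof -
    have yc: "y (g j) \<in> carrier F"
      by (rule D(2)[OF g[OF j]])
    show ?thesis
    proof (cases "b (g j) = 0")
      case True
      then have "y (g j) = \<zero>\<^bsub>F\<^esub>"
        using yc by (simp add: b_def)
      moreover have "z j = \<zero>\<^bsub>F\<^esub>"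
        using j \<open>y (g j) = \<zero>\<^bsub>F\<^esub>\<close> F.smult_r_null by (simp add: z_def)
      ultimately show ?thesis
        using F.smult_r_null by simp
    next
      case False
      have "(lam j * q j x) \<odot>\<^bsub>F\<^esub> z j = (lam j * q j x * inverse (of_real (b (g j)))) \<odot>\<^bsub>F\<^esub> y (g j)"
        using F.smult_assoc1[OF _ _ yc, of "lam j * q j x" "inverse (of_real (b (g j)))"] j by (simp add: z_def)
      also have "lam j * q j x * inverse (of_real (b (g j))) = p (g j) x"
      proof (cases "a (g j) = 0")
        case True
        then have "norm (p (g j) x) \<le> 0"
          using EK.nrm_le_sup_norm[OF D(1)[OF g[OF j]] x] by (simp add: a_def)
        then show ?thesis
          using True j by (simp add: lam_def)
      next
        case a: False
        then show ?thesis
          using j x \<open>b (g j) \<noteq> 0\<close> by (simp add: lam_def q_def field_simps)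
      qed
      finally show ?thesis .
    qed
  qed
  have rep: "hyper_nuclear_rep n E F P lam q z"
    unfolding hyper_nuclear_rep_def
  proof (intro conjI allI ballI q(1) z(1))
    show summable: "summable (\<lambda>j. norm (lam j))"
      using lam_sums by (rule sums_summable)
    show "bdd_above (range (\<lambda>j. sup_norm E scalar_space (q j)))" "bdd_above (range (\<lambda>j. nrm F (z j)))"
      using q(2) z(2) by (auto intro!: bdd_aboveI[of _ 1])
    fix x assume x: "x \<in> carrier E"
    have sums: "abs_sums F (\<lambda>j. (lam j * q j x) \<odot>\<^bsub>F\<^esub> z j) J (P x)"
      unfolding J_def
    proof (rule F.abs_sums_reindex[OF inj])
      have "(lam (to_nat_on I i) * q (to_nat_on I i) x) \<odot>\<^bsub>F\<^esub> z (to_nat_on I i) = p i x \<odot>\<^bsub>F\<^esub> y i" if "i \<in> I" for i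
        using summand[of "to_nat_on I i", OF _ x] that gh by (simp add: J_def)
      then show "abs_sums F (\<lambda>i. (lam (to_nat_on I i) * q (to_nat_on I i) x) \<odot>\<^bsub>F\<^esub> z (to_nat_on I i)) I (P x)"
        by (subst F.abs_sums_cong[OF _ refl refl]) (use D(5)[OF x] in auto)
    qed
    have zero: "abs_sums F (\<lambda>j. (lam j * q j x) \<odot>\<^bsub>F\<^esub> z j) (- J) \<zero>\<^bsub>F\<^esub>"
      by (rule F.abs_sums_zero) (use F.smult_l_null[OF z(1)] in \<open>simp add: lam_def\<close>)
    have "abs_sums F (\<lambda>j. (lam j * q j x) \<odot>\<^bsub>F\<^esub> z j) UNIV (P x)"
      using F.abs_sums_Un_disjoint[OF sums zero] F.abs_sumsD(2)[OF sums] by simp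
    moreover from F.abs_sumsD(3)[OF this] have "summable (\<lambda>j. nrm F ((lam j * q j x) \<odot>\<^bsub>F\<^esub> z j))"
      by (rule summable_on_imp_summable)
    ultimately show "limitin (ntop F) (\<lambda>N. finsum F (\<lambda>j. (lam j * q j x) \<odot>\<^bsub>F\<^esub> z j) {..<N}) (P x) sequentially"
      by (subst F.abs_sums_nat_iff) (use cl in auto)
  qed
  then show "P \<in> hyper_nuclear n E F"
    unfolding hyper_nuclear_def using nuclear_sum_hom_polys(1)[OF P] by blast
  have "(SUP j. sup_norm E scalar_space (q j)) \<le> 1" "(SUP j. nrm F (z j)) \<le> 1"
    using q(2) z(2) by (auto intro!: cSUP_least)
  moreover have "0 \<le> (\<Sum>j. norm (lam j))" "0 \<le> (SUP j. nrm F (z j))" "0 \<le> (SUP j. sup_norm E scalar_space (q j))"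
    using rep_value_nonneg[OF rep] by auto
  ultimately have "(\<Sum>j. norm (lam j)) * (SUP j. sup_norm E scalar_space (q j)) * (SUP j. nrm F (z j)) \<le>
      (\<Sum>j. norm (lam j)) * 1 * 1"
    by (intro mult_mono) auto
  then show "hyper_nuclear_norm n E F P \<le> nuclear_cost E F I p y"
    using hyper_nuclear_norm_le[OF rep] sums_unique[OF lam_sums] by simp
qed

text \<open>Each coefficient is absorbed into its polynomial, and the norms of the polynomials and of
  the vectors are estimated by the two suprema.\<close>

lemma nuclear_sum_if_rep:
  assumes "hyper_nuclear_rep n E F P lam p y" and ext: "P \<in> carrier E \<rightarrow>\<^sub>E carrier F"
  shows "nuclear_sum n E F UNIV (\<lambda>j. \<lambda>x\<in>carrier E. lam j \<odot>\<^bsub>scalar_space\<^esub> p j x) y P"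
    and "nuclear_cost E F UNIV (\<lambda>j. \<lambda>x\<in>carrier E. lam j \<odot>\<^bsub>scalar_space\<^esub> p j x) y \<le>
      (\<Sum>j. norm (lam j)) * (SUP j. sup_norm E scalar_space (p j)) * (SUP j. nrm F (y j))"
proof -
  note R = assms(1)[unfolded hyper_nuclear_rep_def]
  note nonneg = rep_value_nonneg[OF assms(1)]
  let ?p = "\<lambda>j. \<lambda>x\<in>carrier E. lam j \<odot>\<^bsub>scalar_space\<^esub> p j x"
  let ?M = "SUP j. sup_norm E scalar_space (p j)" and ?B = "SUP j. nrm F (y j)"
  have p: "p j \<in> hom_polys n E scalar_space" and y: "y j \<in> carrier F" for j
    using R by auto
  have p': "?p j \<in> hom_polys n E scalar_space" for j
    by (rule EK.hom_polys_scale[OF p])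
  have summand: "sup_norm E scalar_space (?p j) * nrm F (y j) \<le> norm (lam j) * ?M * ?B" for j
  proof (intro mult_mono)
    have "sup_norm E scalar_space (?p j) \<le> norm (lam j) * sup_norm E scalar_space (p j)"
      by (rule EK.sup_norm_scale_le[OF p])
    also have "\<dots> \<le> norm (lam j) * ?M"
      using R by (intro mult_left_mono cSUP_upper) auto
    finally show "sup_norm E scalar_space (?p j) \<le> norm (lam j) * ?M" .
    show "nrm F (y j) \<le> ?B"
      using R by (intro cSUP_upper) auto
  qed (use nonneg y in auto)
  have lam: "((\<lambda>j. norm (lam j)) has_sum (\<Sum>j. norm (lam j))) UNIV"
    using R by (intro sums_nonneg_imp_has_sum summable_sums) auto
  then have bound: "((\<lambda>j. norm (lam j) * ?M * ?B) has_sum ((\<Sum>j. norm (lam j)) * ?M * ?B)) UNIV"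
    by (intro has_sum_cmult_left)
  have summable: "(\<lambda>j. sup_norm E scalar_space (?p j) * nrm F (y j)) summable_on UNIV"
    by (rule summable_on_comparison_test[OF has_sum_imp_summable[OF bound] summand])
      (use EK.sup_norm_nonneg[OF p'] y in simp)
  show "nuclear_cost E F UNIV ?p y \<le> (\<Sum>j. norm (lam j)) * ?M * ?B"
    using infsum_mono[OF summable has_sum_imp_summable[OF bound] summand] infsumI[OF bound] by simp
  show "nuclear_sum n E F UNIV ?p y P"
    unfolding nuclear_sum_def
  proof (intro conjI ballI p' y summable ext)
    fix x assume x: "x \<in> carrier E"
    have cl: "?p j x \<odot>\<^bsub>F\<^esub> y j \<in> carrier F" for j
      by (rule F.smult_closed[OF _ y]) simp
    have "(\<lambda>j. nrm F (?p j x \<odot>\<^bsub>F\<^esub> y j)) summable_on UNIV"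
      by (rule summable_on_comparison_test[OF summable_on_cmult_left[OF summable, of "nrm E x ^ n"]])
        (use nrm_rank_one_le[OF p' y x] F.nrm_nonneg[OF cl] in auto)
    then have "summable (\<lambda>j. nrm F (?p j x \<odot>\<^bsub>F\<^esub> y j))"
      by (rule summable_on_imp_summable)
    moreover have "limitin (ntop F) (\<lambda>N. finsum F (\<lambda>j. ?p j x \<odot>\<^bsub>F\<^esub> y j) {..<N}) (P x) sequentially"
      using R x by simp
    ultimately show "abs_sums F (\<lambda>j. ?p j x \<odot>\<^bsub>F\<^esub> y j) UNIV (P x)"
      using cl by (subst F.abs_sums_nat_iff[symmetric]) auto
  qed
qed

lemma hyper_nuclear_nuclear_sum:
  assumes P: "P \<in> hyper_nuclear n E F" and e: "0 < e"
  obtains p :: "nat \<Rightarrow> 'a \<Rightarrow> 'k" and y where "nuclear_sum n E F UNIV p y P"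
    "nuclear_cost E F UNIV p y < hyper_nuclear_norm n E F P + e"
proof -
  let ?V = "{(\<Sum>j. norm (lam j)) * (SUP j. sup_norm E scalar_space (p j)) *
      (SUP j. nrm F (y j)) |lam p y. hyper_nuclear_rep n E F P lam p y}"
  have "?V \<noteq> {}"
    using P unfolding hyper_nuclear_def by blast
  moreover have "Inf ?V < hyper_nuclear_norm n E F P + e"
    unfolding hyper_nuclear_norm_def using e by simp
  ultimately have "\<exists>v\<in>?V. v < hyper_nuclear_norm n E F P + e"
    by (rule cInf_lessD)
  then obtain v where "v \<in> ?V" "v < hyper_nuclear_norm n E F P + e"
    by (rule bexE)
  from this(1) obtain lam p y where
    v: "v = (\<Sum>j. norm (lam j)) * (SUP j. sup_norm E scalar_space (p j)) * (SUP j. nrm F (y j))"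
    and rep: "hyper_nuclear_rep n E F P lam p y"
    unfolding mem_Collect_eq by (elim exE conjE) (rule that)
  note less = \<open>v < hyper_nuclear_norm n E F P + e\<close>[unfolded v]
  have "P \<in> hom_polys n E F"
    using P by (simp add: hyper_nuclear_def)
  then have "P \<in> carrier E \<rightarrow>\<^sub>E carrier F"
    by (rule hom_polys_extensional)
  note sum = nuclear_sum_if_rep[OF rep this]
  show thesis
    by (rule that[OF sum(1) order.strict_trans1[OF sum(2) less]])
qed

lemma hyper_nuclear_norm_nonneg:
  assumes "P \<in> hyper_nuclear n E F"
  shows "0 \<le> hyper_nuclear_norm n E F P"
  unfolding hyper_nuclear_norm_def
proof (rule cInf_greatest)
  show "{(\<Sum>j. norm (lam j)) * (SUP j. sup_norm E scalar_space (p j)) *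
      (SUP j. nrm F (y j)) |lam p y. hyper_nuclear_rep n E F P lam p y} \<noteq> {}"
    using assms unfolding hyper_nuclear_def by blast
qed (auto intro!: mult_nonneg_nonneg rep_value_nonneg)

lemma sup_norm_le_hyper_nuclear_norm:
  assumes "P \<in> hyper_nuclear n E F"
  shows "sup_norm E F P \<le> hyper_nuclear_norm n E F P"
proof (rule field_le_epsilon)
  fix e :: real assume "0 < e"
  with assms obtain p :: "nat \<Rightarrow> 'a \<Rightarrow> 'k" and y where "nuclear_sum n E F UNIV p y P"
    "nuclear_cost E F UNIV p y < hyper_nuclear_norm n E F P + e"
    by (rule hyper_nuclear_nuclear_sum)
  then show "sup_norm E F P \<le> hyper_nuclear_norm n E F P + e"
    using nuclear_sum_hom_polys(2) by fastforce
qed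

end

context normed_banach_pair
begin

interpretation K: banach_carrier "scalar_space :: ('k, 'k) nvs"
  by (rule banach_carrier_scalar_space)

interpretation EK: normed_banach_pair E scalar_space ..

lemma hyper_nuclear_hom_polys: "P \<in> hyper_nuclear n E F \<Longrightarrow> P \<in> hom_polys n E F"
  by (simp add: hyper_nuclear_def)

lemma nuclear_cost_nonneg:
  assumes "nuclear_sum n E F I p y P"
  shows "0 \<le> nuclear_cost E F I p y"
  by (rule infsum_nonneg)
    (use nuclear_sumD(1,2)[OF assms] EK.sup_norm_nonneg in \<open>auto intro!: mult_nonneg_nonneg\<close>)

text \<open>The \<open>f k\<close> have representations whose costs exceed their norms by at most \<open>e / 2^(k+1)\<close>;
  together they represent \<open>S\<close> over pairs of indices. A two-element set \<open>A\<close> gives the triangle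
  inequality, and the sets of large \<open>k\<close> bound the remainders of a series.\<close>

lemma hyper_nuclear_series:
  fixes f :: "nat \<Rightarrow> 'a \<Rightarrow> 'b"
  assumes f: "\<And>k. k \<in> A \<Longrightarrow> f k \<in> hyper_nuclear n E F"
    and summable: "(\<lambda>k. hyper_nuclear_norm n E F (f k)) summable_on A"
    and ext: "S \<in> carrier E \<rightarrow>\<^sub>E carrier F"
    and S: "\<And>x. x \<in> carrier E \<Longrightarrow> abs_sums F (\<lambda>k. f k x) A (S x)"
  shows "S \<in> hyper_nuclear n E F"
    and "hyper_nuclear_norm n E F S \<le> (\<Sum>\<^sub>\<infinity>k\<in>A. hyper_nuclear_norm n E F (f k))"
proof -
  let ?N = "\<lambda>k. hyper_nuclear_norm n E F (f k)"
  have *: "S \<in> hyper_nuclear n E F \<and> hyper_nuclear_norm n E F S \<le> infsum ?N A + e" if e: "0 < e" for e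
  proof -
    have "\<exists>p y. nuclear_sum n E F (UNIV :: nat set) p y (f k) \<and>
        nuclear_cost E F UNIV p y < ?N k + e * (1 / 2) ^ Suc k" if "k \<in> A" for k
    proof (rule hyper_nuclear_nuclear_sum[OF f[OF that]])
      show "0 < e * (1 / 2) ^ Suc k"
        using e by simp
    qed blast
    then have "\<forall>k. \<exists>p y. k \<in> A \<longrightarrow> nuclear_sum n E F (UNIV :: nat set) p y (f k) \<and>
        nuclear_cost E F UNIV p y < ?N k + e * (1 / 2) ^ Suc k"
      by blast
    then obtain p y where py: "\<forall>k. k \<in> A \<longrightarrow> nuclear_sum n E F (UNIV :: nat set) (p k) (y k) (f k) \<and>
        nuclear_cost E F UNIV (p k) (y k) < ?N k + e * (1 / 2) ^ Suc k"
      unfolding choice_iff by blast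
    then have sum: "nuclear_sum n E F UNIV (p k) (y k) (f k)"
      and cost: "nuclear_cost E F UNIV (p k) (y k) \<le> ?N k + e * (1 / 2) ^ Suc k" if "k \<in> A" for k
      using that less_imp_le by blast+
    let ?c = "\<lambda>k j. sup_norm E scalar_space (p k j) * nrm F (y k j)"
    have c_nonneg: "0 \<le> ?c k j" if "k \<in> A" for k j
      using nuclear_sumD(1,2)[OF sum[OF that]] EK.sup_norm_nonneg
      by (intro mult_nonneg_nonneg F.nrm_nonneg) auto
    \<comment> \<open>The errors of the chosen representations add up to at most \<open>e\<close>.\<close>
    have geo: "((\<lambda>k. e * (1 / 2) ^ Suc k) has_sum e) UNIV"
      using has_sum_cmult_right[OF sums_nonneg_imp_has_sum[OF power_half_series], of e] by simp
    have geoA: "(\<lambda>k. e * (1 / 2) ^ Suc k) summable_on A" "(\<Sum>\<^sub>\<infinity>k\<in>A. e * (1 / 2) ^ Suc k) \<le> e"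
    proof -
      show "(\<lambda>k. e * (1 / 2) ^ Suc k) summable_on A"
        by (rule summable_on_subset_banach[OF has_sum_imp_summable[OF geo]]) simp
      then have "(\<Sum>\<^sub>\<infinity>k\<in>A. e * (1 / 2) ^ Suc k) \<le> (\<Sum>\<^sub>\<infinity>k. e * (1 / 2) ^ Suc k)"
        by (rule infsum_mono2[OF _ has_sum_imp_summable[OF geo]]) (use e in auto)
      then show "(\<Sum>\<^sub>\<infinity>k\<in>A. e * (1 / 2) ^ Suc k) \<le> e"
        using infsumI[OF geo] by simp
    qed
    have bound: "(\<lambda>k. ?N k + e * (1 / 2) ^ Suc k) summable_on A"
      by (rule summable_on_add[OF summable geoA(1)])
    have costs: "(\<lambda>k. nuclear_cost E F UNIV (p k) (y k)) summable_on A"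
      by (rule summable_on_comparison_test[OF bound cost nuclear_cost_nonneg[OF sum]])
    have c: "(\<lambda>(k, j). ?c k j) summable_on A \<times> UNIV"
    proof (rule summable_on_SigmaI[OF _ costs])
      show "((\<lambda>j. case (k, j) of (k, j) \<Rightarrow> ?c k j) has_sum nuclear_cost E F UNIV (p k) (y k)) UNIV"
        if "k \<in> A" for k
        using nuclear_sumD(3)[OF sum[OF that]] by simp
    qed (use c_nonneg in auto)
    have "\<exists>T. nuclear_sum n E F (A \<times> UNIV) (\<lambda>(k, j). p k j) (\<lambda>(k, j). y k j) T"
      by (rule nuclear_sum_exists)
        (use nuclear_sumD(1,2)[OF sum] c in \<open>auto simp: case_prod_unfold\<close>)
    then obtain T where T: "nuclear_sum n E F (A \<times> UNIV) (\<lambda>(k, j). p k j) (\<lambda>(k, j). y k j) T" ..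
    have "T = S"
    proof (rule PiE_ext[OF nuclear_sumD(4)[OF T] ext])
      fix x assume x: "x \<in> carrier E"
      have "abs_sums F (\<lambda>(k, j). p k j x \<odot>\<^bsub>F\<^esub> y k j) (A \<times> UNIV) (T x)"
        using nuclear_sumD(5)[OF T x] by (simp add: case_prod_unfold)
      then have "abs_sums F (\<lambda>k. f k x) A (T x)"
        by (rule F.abs_sums_Sigma) (rule nuclear_sumD(5)[OF sum x])
      then show "T x = S x"
        using S[OF x] by (rule F.abs_sums_unique)
    qed
    have "nuclear_cost E F (A \<times> UNIV) (\<lambda>(k, j). p k j) (\<lambda>(k, j). y k j) =
        (\<Sum>\<^sub>\<infinity>k\<in>A. nuclear_cost E F UNIV (p k) (y k))"
      using infsum_Sigma'_banach[OF c] by (simp add: case_prod_unfold)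
    also have "\<dots> \<le> (\<Sum>\<^sub>\<infinity>k\<in>A. ?N k + e * (1 / 2) ^ Suc k)"
      by (rule infsum_mono[OF costs bound cost])
    also have "\<dots> \<le> infsum ?N A + e"
      using infsum_add[OF summable geoA(1)] geoA(2) by simp
    finally show ?thesis
      using hyper_nuclear_if_nuclear_sum[OF _ T] \<open>T = S\<close> by auto
  qed
  show "S \<in> hyper_nuclear n E F"
    using *[of 1] by simp
  show "hyper_nuclear_norm n E F S \<le> infsum ?N A"
    by (rule field_le_epsilon) (use * in blast)
qed

lemma hyper_nuclear_zero:
  "(\<lambda>x\<in>carrier E. \<zero>\<^bsub>F\<^esub>) \<in> hyper_nuclear n E F"
  "hyper_nuclear_norm n E F (\<lambda>x\<in>carrier E. \<zero>\<^bsub>F\<^esub>) = 0"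
proof -
  have "nuclear_sum n E F ({} :: nat set) p y (\<lambda>x\<in>carrier E. \<zero>\<^bsub>F\<^esub>)" for p y
    unfolding nuclear_sum_def by (auto intro!: F.abs_sums_zero)
  note * = hyper_nuclear_if_nuclear_sum[OF _ this]
  show mem: "(\<lambda>x\<in>carrier E. \<zero>\<^bsub>F\<^esub>) \<in> hyper_nuclear n E F"
    by (rule *(1)) simp
  have "hyper_nuclear_norm n E F (\<lambda>x\<in>carrier E. \<zero>\<^bsub>F\<^esub>) \<le> 0"
    using *(2) by simp
  then show "hyper_nuclear_norm n E F (\<lambda>x\<in>carrier E. \<zero>\<^bsub>F\<^esub>) = 0"
    using hyper_nuclear_norm_nonneg[OF mem] by simp
qed

lemma hyper_nuclear_add:
  assumes P: "P \<in> hyper_nuclear n E F" and Q: "Q \<in> hyper_nuclear n E F"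
  shows "(\<lambda>x\<in>carrier E. P x \<oplus>\<^bsub>F\<^esub> Q x) \<in> hyper_nuclear n E F"
    and "hyper_nuclear_norm n E F (\<lambda>x\<in>carrier E. P x \<oplus>\<^bsub>F\<^esub> Q x) \<le>
      hyper_nuclear_norm n E F P + hyper_nuclear_norm n E F Q"
proof -
  let ?f = "\<lambda>k::nat. if k = 0 then P else Q" and ?S = "\<lambda>x\<in>carrier E. P x \<oplus>\<^bsub>F\<^esub> Q x"
  have cl: "P x \<in> carrier F" "Q x \<in> carrier F" if "x \<in> carrier E" for x
    by (rule hom_polys_closed[OF hyper_nuclear_hom_polys that], fact)+
  have sums: "abs_sums F (\<lambda>k. ?f k x) {0, 1} (?S x)" if x: "x \<in> carrier E" for x
  proof -
    have "(\<lambda>k. ?f k x) \<in> {0, 1} \<rightarrow> carrier F"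
      using cl[OF x] by auto
    moreover from this have "finsum F (\<lambda>k. ?f k x) {0, 1} = ?S x"
      using x cl[OF x] by (subst F.M.finsum_insert) (auto simp: F.finsum_single)
    ultimately show ?thesis
      using F.abs_sums_finite[of "{0, 1}" "\<lambda>k. ?f k x"] by simp
  qed
  have ext: "?S \<in> carrier E \<rightarrow>\<^sub>E carrier F"
    using cl by auto
  have f: "?f k \<in> hyper_nuclear n E F" for k
    using P Q by simp
  have fin: "(\<lambda>k. hyper_nuclear_norm n E F (?f k)) summable_on {0, 1}"
    by simp
  show "?S \<in> hyper_nuclear n E F"
    by (rule hyper_nuclear_series(1)[OF f fin ext sums])
  show "hyper_nuclear_norm n E F ?S \<le> hyper_nuclear_norm n E F P + hyper_nuclear_norm n E F Q"
  proof -
    have eq: "(\<Sum>\<^sub>\<infinity>k\<in>{0, 1}. hyper_nuclear_norm n E F (?f k)) =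
        hyper_nuclear_norm n E F P + hyper_nuclear_norm n E F Q"
      by simp
    show ?thesis
      by (rule hyper_nuclear_series(2)[OF f fin ext sums, unfolded eq])
  qed
qed

lemma hyper_nuclear_scale_le:
  assumes P: "P \<in> hyper_nuclear n E F"
  shows "(\<lambda>x\<in>carrier E. a \<odot>\<^bsub>F\<^esub> P x) \<in> hyper_nuclear n E F"
    and "hyper_nuclear_norm n E F (\<lambda>x\<in>carrier E. a \<odot>\<^bsub>F\<^esub> P x) \<le> norm a * hyper_nuclear_norm n E F P"
proof -
  let ?S = "\<lambda>x\<in>carrier E. a \<odot>\<^bsub>F\<^esub> P x"
  have *: "?S \<in> hyper_nuclear n E F \<and> hyper_nuclear_norm n E F ?S \<le> norm a * hyper_nuclear_norm n E F P + e"
    if e: "0 < e" for e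
  proof -
    have "0 < e / (norm a + 1)"
      using e by (intro divide_pos_pos add_nonneg_pos) auto
    with P obtain p :: "nat \<Rightarrow> 'a \<Rightarrow> 'k" and y where py: "nuclear_sum n E F UNIV p y P"
      and cost: "nuclear_cost E F UNIV p y < hyper_nuclear_norm n E F P + e / (norm a + 1)"
      by (rule hyper_nuclear_nuclear_sum)
    note D = nuclear_sumD[OF py]
    have nrm: "nrm F (a \<odot>\<^bsub>F\<^esub> y j) = norm a * nrm F (y j)" for j
      using D(2) by simp
    have P_cl: "P x \<in> carrier F" if "x \<in> carrier E" for x
      by (rule hom_polys_closed[OF hyper_nuclear_hom_polys[OF P] that])
    have sum: "nuclear_sum n E F UNIV p (\<lambda>j. a \<odot>\<^bsub>F\<^esub> y j) ?S"
      unfolding nuclear_sum_def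
    proof (intro conjI ballI)
      show "p j \<in> hom_polys n E scalar_space" for j
        by (rule D(1)) simp
      show "a \<odot>\<^bsub>F\<^esub> y j \<in> carrier F" for j
        by (rule F.smult_closed[OF _ D(2)]) simp_all
      show "(\<lambda>j. sup_norm E scalar_space (p j) * nrm F (a \<odot>\<^bsub>F\<^esub> y j)) summable_on UNIV"
        using summable_on_cmult_right[OF D(3), of "norm a"] by (simp add: nrm mult_ac)
      show "?S \<in> carrier E \<rightarrow>\<^sub>E carrier F"
        using P_cl F.smult_closed by auto
      fix x assume x: "x \<in> carrier E"
      have "p j x \<odot>\<^bsub>F\<^esub> (a \<odot>\<^bsub>F\<^esub> y j) = a \<odot>\<^bsub>F\<^esub> (p j x \<odot>\<^bsub>F\<^esub> y j)" for j
        using F.smult_assoc1[OF _ _ D(2)[of j], of "p j x" a] F.smult_assoc1[OF _ _ D(2)[of j], of a "p j x"]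
        by (simp add: mult.commute)
      then show "abs_sums F (\<lambda>j. p j x \<odot>\<^bsub>F\<^esub> (a \<odot>\<^bsub>F\<^esub> y j)) UNIV (?S x)"
        using F.abs_sums_smult[OF D(5)[OF x], of a] x by simp
    qed
    have "nuclear_cost E F UNIV p (\<lambda>j. a \<odot>\<^bsub>F\<^esub> y j) = norm a * nuclear_cost E F UNIV p y"
      unfolding nrm by (subst infsum_cmult_right'[symmetric]) (simp add: mult_ac)
    also have "\<dots> \<le> norm a * (hyper_nuclear_norm n E F P + e / (norm a + 1))"
      using cost by (intro mult_left_mono) auto
    also have "\<dots> \<le> norm a * hyper_nuclear_norm n E F P + e"
      using e by (simp add: distrib_left) (simp add: divide_le_eq add_nonneg_pos mult.commute)
    finally show ?thesis
      using hyper_nuclear_if_nuclear_sum[OF _ sum] by auto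
  qed
  show "?S \<in> hyper_nuclear n E F"
    using *[of 1] by simp
  show "hyper_nuclear_norm n E F ?S \<le> norm a * hyper_nuclear_norm n E F P"
    by (rule field_le_epsilon) (use * in blast)
qed

text \<open>The inequality from \<open>hyper_nuclear_scale_le\<close> is also applied to the scalar \<open>inverse a\<close>.\<close>

lemma hyper_nuclear_norm_scale:
  assumes P: "P \<in> hyper_nuclear n E F"
  shows "hyper_nuclear_norm n E F (\<lambda>x\<in>carrier E. a \<odot>\<^bsub>F\<^esub> P x) = norm a * hyper_nuclear_norm n E F P"
proof (cases "a = 0")
  case True
  have "0 \<le> hyper_nuclear_norm n E F (\<lambda>x\<in>carrier E. a \<odot>\<^bsub>F\<^esub> P x)"
    by (rule hyper_nuclear_norm_nonneg[OF hyper_nuclear_scale_le(1)[OF P]])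
  then show ?thesis
    using hyper_nuclear_scale_le(2)[OF P, of a] True by simp
next
  case False
  let ?S = "\<lambda>x\<in>carrier E. a \<odot>\<^bsub>F\<^esub> P x"
  have P_cl: "P x \<in> carrier F" if "x \<in> carrier E" for x
    by (rule hom_polys_closed[OF hyper_nuclear_hom_polys[OF P] that])
  have "inverse a \<odot>\<^bsub>F\<^esub> ?S x = P x" if "x \<in> carrier E" for x
    using F.smult_assoc1[OF _ _ P_cl[OF that], of "inverse a" a] F.smult_one[OF P_cl[OF that]] False that
    by simp
  then have "(\<lambda>x\<in>carrier E. inverse a \<odot>\<^bsub>F\<^esub> ?S x) = (\<lambda>x\<in>carrier E. P x)"
    by (rule restrict_ext)
  also have "\<dots> = P"
    using hom_polys_extensional[OF hyper_nuclear_hom_polys[OF P]]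
    by (intro extensional_restrict) (simp add: PiE_def)
  finally have "hyper_nuclear_norm n E F P \<le> norm (inverse a) * hyper_nuclear_norm n E F ?S"
    using hyper_nuclear_scale_le(2)[OF hyper_nuclear_scale_le(1)[OF P], of "inverse a" a] by simp
  then have "norm a * hyper_nuclear_norm n E F P \<le>
      norm a * (norm (inverse a) * hyper_nuclear_norm n E F ?S)"
    by (rule mult_left_mono) simp
  also have "\<dots> = hyper_nuclear_norm n E F ?S"
    using False by (simp only: mult.assoc[symmetric] norm_mult[symmetric] right_inverse[OF False] norm_one mult_1)
  finally have "norm a * hyper_nuclear_norm n E F P \<le> hyper_nuclear_norm n E F ?S" .
  then show ?thesis
    using hyper_nuclear_scale_le(2)[OF P, of a] by simp
qed

lemma finite_type_hyper_nuclear: "finite_type n E F \<subseteq> hyper_nuclear n E F"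
proof
  fix P assume "P \<in> finite_type n E F"
  then obtain k :: nat and \<phi> y where ext: "P \<in> carrier E \<rightarrow>\<^sub>E carrier F"
    and \<phi>: "\<And>i. i < k \<Longrightarrow> \<phi> i \<in> hom_polys 1 E scalar_space" and y: "\<And>i. i < k \<Longrightarrow> y i \<in> carrier F"
    and P: "\<And>x. x \<in> carrier E \<Longrightarrow> P x = finsum F (\<lambda>i. (\<phi> i x ^ n) \<odot>\<^bsub>F\<^esub> y i) {..<k}"
    unfolding finite_type_def by blast
  let ?p = "\<lambda>i. compose (carrier E) (\<lambda>a. a ^ n) (\<phi> i)"
  have "nuclear_sum n E F {..<k} ?p y P"
    unfolding nuclear_sum_def
  proof (intro conjI ballI)
    show "?p i \<in> hom_polys n E scalar_space" if "i \<in> {..<k}" for i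
      using hom_polys_compose(1)[OF E.normed_carrier_axioms K.normed_carrier_axioms
          K.normed_carrier_axioms \<phi> hom_polys_power(1), of i n] that by simp
    fix x assume x: "x \<in> carrier E"
    have "abs_sums F (\<lambda>i. ?p i x \<odot>\<^bsub>F\<^esub> y i) {..<k} (finsum F (\<lambda>i. ?p i x \<odot>\<^bsub>F\<^esub> y i) {..<k})"
      by (rule F.abs_sums_finite) (use F.smult_closed[OF _ y] in auto)
    then show "abs_sums F (\<lambda>i. ?p i x \<odot>\<^bsub>F\<^esub> y i) {..<k} (P x)"
      using P[OF x] x by (simp add: compose_eq)
  qed (use y ext in auto)
  then show "P \<in> hyper_nuclear n E F"
    by (rule hyper_nuclear_if_nuclear_sum(1)[rotated]) simp
qed

end


section \<open>Composition with polynomials on both sides\<close>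

text \<open>A finite set of multi-indices is contained in a cube, over which the sum of the products is
  a power of a partial sum.\<close>

lemma prod_PiE_summable:
  fixes c :: "nat \<Rightarrow> real"
  assumes c: "c summable_on UNIV" and nonneg: "\<And>j. 0 \<le> c j"
  shows "(\<lambda>f. \<Prod>i<r. c (f i)) summable_on ({..<r} \<rightarrow>\<^sub>E UNIV)"
    and "(\<Sum>\<^sub>\<infinity>f\<in>{..<r} \<rightarrow>\<^sub>E UNIV. \<Prod>i<r. c (f i)) \<le> infsum c UNIV ^ r"
proof -
  have bound: "(\<Sum>f\<in>D. \<Prod>i<r. c (f i)) \<le> infsum c UNIV ^ r"
    if D: "finite D" "D \<subseteq> {..<r::nat} \<rightarrow>\<^sub>E (UNIV :: nat set)" for D
  proof -
    have "finite (\<Union>f\<in>D. f ` {..<r})"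
      using D(1) by auto
    then obtain N where N: "(\<Union>f\<in>D. f ` {..<r}) \<subseteq> {..<N}"
      using finite_nat_iff_bounded by blast
    have "D \<subseteq> {..<r} \<rightarrow>\<^sub>E {..<N}"
      using D(2) N by (auto simp: PiE_iff image_subset_iff UN_subset_iff)
    then have "(\<Sum>f\<in>D. \<Prod>i<r. c (f i)) \<le> (\<Sum>f\<in>{..<r} \<rightarrow>\<^sub>E {..<N}. \<Prod>i<r. c (f i))"
      by (intro sum_mono2 prod_nonneg) (auto intro: finite_PiE nonneg)
    also have "\<dots> = (\<Sum>j<N. c j) ^ r"
      using prod_sum_PiE[of "{..<r}" "\<lambda>_. {..<N}" "\<lambda>_. c"] by simp
    also have "\<dots> \<le> infsum c UNIV ^ r"
      by (intro power_mono finite_sum_le_infsum c sum_nonneg) (auto intro: nonneg)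
    finally show ?thesis .
  qed
  show summable: "(\<lambda>f. \<Prod>i<r. c (f i)) summable_on ({..<r} \<rightarrow>\<^sub>E UNIV)"
    by (rule nonneg_bdd_above_summable_on)
      (auto intro!: prod_nonneg nonneg bdd_aboveI[of _ "infsum c UNIV ^ r"] bound)
  show "(\<Sum>\<^sub>\<infinity>f\<in>{..<r} \<rightarrow>\<^sub>E UNIV. \<Prod>i<r. c (f i)) \<le> infsum c UNIV ^ r"
    by (rule infsum_le_finite_sums[OF summable bound])
qed

lemma filterlim_cubes:
  "filterlim (\<lambda>N. {..<r} \<rightarrow>\<^sub>E {..<N}) (finite_subsets_at_top ({..<r::nat} \<rightarrow>\<^sub>E (UNIV :: nat set))) sequentially"
  unfolding filterlim_finite_subsets_at_top
proof (intro allI impI)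
  fix D :: "(nat \<Rightarrow> nat) set" assume D: "finite D \<and> D \<subseteq> {..<r} \<rightarrow>\<^sub>E UNIV"
  then have "finite (\<Union>f\<in>D. f ` {..<r})"
    by auto
  then obtain N where N: "(\<Union>f\<in>D. f ` {..<r}) \<subseteq> {..<N}"
    using finite_nat_iff_bounded by blast
  show "\<forall>\<^sub>F N in sequentially. finite ({..<r} \<rightarrow>\<^sub>E {..<N}) \<and> D \<subseteq> {..<r} \<rightarrow>\<^sub>E {..<N} \<and>
      {..<r} \<rightarrow>\<^sub>E {..<N} \<subseteq> {..<r} \<rightarrow>\<^sub>E UNIV"
    using eventually_ge_at_top[of N]
  proof eventually_elim
    case (elim M)
    have "f i < M" if "f \<in> D" "i < r" for f i
      using N that elim by (fastforce simp: UN_subset_iff image_subset_iff)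
    then have "D \<subseteq> {..<r} \<rightarrow>\<^sub>E {..<M}"
      using D by (auto simp: PiE_iff)
    then show ?case
      by (auto intro: finite_PiE)
  qed
qed

text \<open>A representation of \<open>P\<close> with cost \<open>C\<close> yields one of \<open>T \<circ> P \<circ> R\<close> over the multi-indices
  \<open>f : {..<r} \<rightarrow> \<nat>\<close>, whose scalar factor is the product of the \<open>p (f i) \<circ> R\<close> and whose vector is
  the polar form of \<open>T\<close> at the \<open>y (f i)\<close>. The estimate is the limit of the estimates obtained from
  costs that approach the norm of \<open>P\<close>.\<close>

lemma hyper_nuclear_compose:
  fixes E :: "('k::{real_normed_field, banach}, 'a) nvs" and F :: "('k, 'b) nvs"
    and G :: "('k, 'c) nvs" and H :: "('k, 'd) nvs"
  assumes E: "normed_carrier E" and F: "banach_carrier F" and G: "normed_carrier G" and H: "banach_carrier H"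
    and P: "P \<in> hyper_nuclear n E F" and R: "R \<in> hom_polys m G E" and T: "T \<in> hom_polys r F H"
  defines "S \<equiv> compose (carrier G) T (compose (carrier G) P R)"
  shows "S \<in> hyper_nuclear (r * m * n) G H"
    and "hyper_nuclear_norm (r * m * n) G H S \<le> real r ^ r / fact r * sup_norm F H T *
      hyper_nuclear_norm n E F P ^ r * sup_norm G E R ^ (r * n)"
proof -
  interpret E: normed_carrier E by fact
  interpret F: banach_carrier F by fact
  interpret G: normed_carrier G by fact
  interpret H: banach_carrier H by fact
  interpret K: banach_carrier "scalar_space :: ('k, 'k) nvs"
    by (rule banach_carrier_scalar_space)
  interpret EF: normed_banach_pair E F ..
  interpret GE: normed_pair G E ..
  interpret FH: normed_banach_pair F H ..
  interpret GH: normed_banach_pair G H ..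
  interpret EK: normed_pair E scalar_space ..
  interpret GK: normed_pair G scalar_space ..
  let ?K = "real r ^ r / fact r"
  let ?B = "polar_form r F H T" and ?I = "{..<r} \<rightarrow>\<^sub>E (UNIV :: nat set)"
  obtain B0 where B0: "multilinear r F H B0" "\<And>v. v \<in> carrier F \<Longrightarrow> T v = B0 (\<lambda>i\<in>{..<r}. v)"
    using T unfolding hom_polys_def by blast
  note B = FH.multilinear_polar_form[OF B0] FH.polar_form_diag[OF B0]
  have B_le: "nrm H (?B w) \<le> ?K * sup_norm F H T * (\<Prod>i<r. nrm F (w i))"
    if "w \<in> {..<r} \<rightarrow>\<^sub>E carrier F" for w
    by (rule FH.nrm_polar_form_le[OF B0 FH.nrm_le_sup_norm[OF T] FH.sup_norm_nonneg[OF T] that])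
  have tnn: "0 \<le> sup_norm F H T" and rnn: "0 \<le> sup_norm G E R"
    by (rule FH.sup_norm_nonneg[OF T], rule GE.sup_norm_nonneg[OF R])
  have main: "S \<in> hyper_nuclear (r * m * n) G H \<and> hyper_nuclear_norm (r * m * n) G H S \<le>
      ?K * sup_norm F H T * C ^ r * sup_norm G E R ^ (r * n)"
    if py: "nuclear_sum n E F (UNIV :: nat set) p y P" and C: "nuclear_cost E F UNIV p y \<le> C" for p y C
  proof -
    note D = nuclear_sumD[OF py]
    have y: "y j \<in> carrier F" and p: "p j \<in> hom_polys n E scalar_space" for j
      using D by auto
    let ?c = "\<lambda>j. sup_norm E scalar_space (p j) * nrm F (y j)"
    have c: "0 \<le> ?c j" for j
      using EK.sup_norm_nonneg[OF p] y by simp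
    define q where "q f = (\<lambda>x\<in>carrier G. \<Prod>i<r. compose (carrier G) (p (f i)) R x)" for f :: "nat \<Rightarrow> nat"
    define z where "z f = ?B (\<lambda>i\<in>{..<r}. y (f i))" for f :: "nat \<Rightarrow> nat"
    let ?M = "?K * sup_norm F H T * sup_norm G E R ^ (r * n)"
    have M: "0 \<le> ?M"
      using tnn rnn by simp
    have arg: "(\<lambda>i\<in>{..<r}. y (f i)) \<in> {..<r} \<rightarrow>\<^sub>E carrier F" for f :: "nat \<Rightarrow> nat"
      using y by auto
    have z: "z f \<in> carrier H" for f
      unfolding z_def by (rule FH.multilinear_closed[OF B(1) arg])
    note comp = hom_polys_compose[OF G E K.normed_carrier_axioms R p]
    have q: "q f \<in> hom_polys (r * m * n) G scalar_space" for f
    proof -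
      have "q f \<in> hom_polys (r * (n * m)) G scalar_space"
        unfolding q_def by (rule hom_polys_prod(1)[OF G]) (rule comp(1))
      then show ?thesis
        by (simp only: mult.assoc mult.commute[of n m])
    qed
    have summand: "sup_norm G scalar_space (q f) * nrm H (z f) \<le> ?M * (\<Prod>i<r. ?c (f i))" for f
    proof -
      have "sup_norm G scalar_space (q f) \<le> (\<Prod>i<r. sup_norm G scalar_space (compose (carrier G) (p (f i)) R))"
        unfolding q_def by (rule hom_polys_prod(2)[OF G comp(1)])
      also have "\<dots> \<le> (\<Prod>i<r. sup_norm E scalar_space (p (f i)) * sup_norm G E R ^ n)"
        by (intro prod_mono) (use GK.sup_norm_nonneg[OF comp(1)] comp(2) in auto)
      also have "\<dots> = (\<Prod>i<r. sup_norm E scalar_space (p (f i))) * sup_norm G E R ^ (r * n)"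
        by (simp add: prod.distrib mult.commute[of r n] flip: power_mult)
      finally have 1: "sup_norm G scalar_space (q f) \<le>
          (\<Prod>i<r. sup_norm E scalar_space (p (f i))) * sup_norm G E R ^ (r * n)" .
      have 2: "nrm H (z f) \<le> ?K * sup_norm F H T * (\<Prod>i<r. nrm F (y (f i)))"
        using B_le[OF arg[of f]] unfolding z_def by simp
      have "sup_norm G scalar_space (q f) * nrm H (z f) \<le>
          ((\<Prod>i<r. sup_norm E scalar_space (p (f i))) * sup_norm G E R ^ (r * n)) *
          (?K * sup_norm F H T * (\<Prod>i<r. nrm F (y (f i))))"
        by (intro mult_mono 1 2 mult_nonneg_nonneg prod_nonneg zero_le_power rnn H.nrm_nonneg z)
          (auto intro: EK.sup_norm_nonneg[OF p])
      also have "\<dots> = ?M * (\<Prod>i<r. ?c (f i))"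
        by (simp add: prod.distrib mult_ac)
      finally show ?thesis .
    qed
    have bound: "(\<lambda>f. ?M * (\<Prod>i<r. ?c (f i))) summable_on ?I"
      by (rule summable_on_cmult_right[OF prod_PiE_summable(1)[OF D(3) c]])
    have summable: "(\<lambda>f. sup_norm G scalar_space (q f) * nrm H (z f)) summable_on ?I"
      by (rule summable_on_comparison_test[OF bound summand]) (use GK.sup_norm_nonneg[OF q] z in simp)
    obtain S' where S': "nuclear_sum (r * m * n) G H ?I q z S'"
      using GH.nuclear_sum_exists[of ?I q "r * m * n" z, OF q z summable] by blast
    have P_cl: "P v \<in> carrier F" if "v \<in> carrier E" for v
      using D(4) that by auto
    have S_ext: "S \<in> carrier G \<rightarrow>\<^sub>E carrier H"
      using GE.hom_polys_closed[OF R] P_cl FH.hom_polys_closed[OF T] unfolding S_def compose_def by auto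
    have "S' = S"
    proof (rule PiE_ext[OF nuclear_sumD(4)[OF S'] S_ext])
      fix x assume x: "x \<in> carrier G"
      define v where "v = R x"
      have v: "v \<in> carrier E"
        unfolding v_def by (rule GE.hom_polys_closed[OF R x])
      have cl: "p j v \<odot>\<^bsub>F\<^esub> y j \<in> carrier F" for j
        by (rule F.smult_closed[OF _ y]) simp
      let ?s = "\<lambda>N. finsum F (\<lambda>j. p j v \<odot>\<^bsub>F\<^esub> y j) {..<N}"
      have "limitin (ntop F) ?s (P v) sequentially"
        using F.abs_sums_nat_iff[of "\<lambda>j. p j v \<odot>\<^bsub>F\<^esub> y j" "P v"] D(5)[OF v] cl
          summable_on_imp_summable[OF F.abs_sumsD(3)[OF D(5)[OF v]]] by auto
      moreover have "continuous_map (ntop F) (ntop H) T"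
        using T by (simp add: hom_polys_def)
      ultimately have lim: "limitin (ntop H) (T \<circ> ?s) (T (P v)) sequentially"
        by (rule continuous_map_limit[rotated])
      \<comment> \<open>By multilinearity, the value of \<open>T\<close> at a partial sum is a sum over a cube of
        multi-indices. The cubes exhaust all multi-indices, so these sums tend to \<open>S' x\<close>, and by
        continuity of \<open>T\<close> also to \<open>T (P v)\<close>.\<close>
      have cubes: "(T \<circ> ?s) N = finsum H (\<lambda>f. q f x \<odot>\<^bsub>H\<^esub> z f) ({..<r} \<rightarrow>\<^sub>E {..<N})" for N
      proof -
        have "?s N \<in> carrier F"
          by (rule F.M.finsum_closed) (use cl in auto)
        then have "(T \<circ> ?s) N = ?B (\<lambda>i\<in>{..<r}. ?s N)"
          using B(2) by simp
        also have "\<dots> = finsum H (\<lambda>f. (\<Prod>i<r. p (f i) v) \<odot>\<^bsub>H\<^esub> z f) ({..<r} \<rightarrow>\<^sub>E {..<N})"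
          unfolding z_def by (rule FH.multilinear_lincomb_expand[OF B(1)]) (use y in auto)
        also have "(\<lambda>f. (\<Prod>i<r. p (f i) v) \<odot>\<^bsub>H\<^esub> z f) = (\<lambda>f. q f x \<odot>\<^bsub>H\<^esub> z f)"
          unfolding q_def v_def using x by (simp add: compose_eq)
        finally show ?thesis .
      qed
      note sums = nuclear_sumD(5)[OF S' x]
      have "limitin (ntop H) (\<lambda>N. finsum H (\<lambda>f. q f x \<odot>\<^bsub>H\<^esub> z f) ({..<r} \<rightarrow>\<^sub>E {..<N})) (S' x) sequentially"
      proof (subst H.limitin_ntop_iff)
        show "finsum H (\<lambda>f. q f x \<odot>\<^bsub>H\<^esub> z f) ({..<r} \<rightarrow>\<^sub>E {..<N}) \<in> carrier H" for N
          by (intro H.M.finsum_closed funcsetI H.smult_closed z) simp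
      qed (use H.abs_sumsD(2)[OF sums] H.abs_sums_tendsto[OF sums filterlim_cubes] in simp)
      then have "limitin (ntop H) (T \<circ> ?s) (S' x) sequentially"
        by (simp only: cubes ext[of "T \<circ> ?s", OF cubes])
      then have "S' x = T (P v)"
        using lim by (rule H.limitin_ntop_unique[OF _ _ sequentially_bot])
      then show "S' x = S x"
        using x by (simp add: S_def v_def compose_eq)
    qed
    have "countable ?I"
      by (rule countable_PiE) auto
    note hn = GH.hyper_nuclear_if_nuclear_sum[OF this S', unfolded \<open>S' = S\<close>]
    have "nuclear_cost G H ?I q z \<le> (\<Sum>\<^sub>\<infinity>f\<in>?I. ?M * (\<Prod>i<r. ?c (f i)))"
      by (rule infsum_mono[OF summable bound summand])
    also have "\<dots> = ?M * (\<Sum>\<^sub>\<infinity>f\<in>?I. \<Prod>i<r. ?c (f i))"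
      by (rule infsum_cmult_right')
    also have "\<dots> \<le> ?M * nuclear_cost E F UNIV p y ^ r"
      by (rule mult_left_mono[OF prod_PiE_summable(2)[OF D(3) c] M])
    also have "\<dots> \<le> ?M * C ^ r"
      by (intro mult_left_mono power_mono M C infsum_nonneg c)
    finally show ?thesis
      using hn by (simp add: mult_ac)
  qed
  have approx: "S \<in> hyper_nuclear (r * m * n) G H \<and> hyper_nuclear_norm (r * m * n) G H S \<le>
      ?K * sup_norm F H T * (hyper_nuclear_norm n E F P + e) ^ r * sup_norm G E R ^ (r * n)" if "0 < e" for e
  proof -
    from P that obtain p :: "nat \<Rightarrow> 'a \<Rightarrow> 'k" and y where "nuclear_sum n E F UNIV p y P"
      "nuclear_cost E F UNIV p y < hyper_nuclear_norm n E F P + e"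
      by (rule EF.hyper_nuclear_nuclear_sum)
    then show ?thesis
      by (intro main) auto
  qed
  show "S \<in> hyper_nuclear (r * m * n) G H"
    using approx[of 1] by simp
  show "hyper_nuclear_norm (r * m * n) G H S \<le> ?K * sup_norm F H T *
      hyper_nuclear_norm n E F P ^ r * sup_norm G E R ^ (r * n)"
  proof (rule tendsto_lowerbound)
    show "((\<lambda>e. ?K * sup_norm F H T * (hyper_nuclear_norm n E F P + e) ^ r * sup_norm G E R ^ (r * n)) \<longlongrightarrow>
        ?K * sup_norm F H T * hyper_nuclear_norm n E F P ^ r * sup_norm G E R ^ (r * n)) (at_right 0)"
      by (auto intro!: tendsto_eq_intros)
    show "\<forall>\<^sub>F e in at_right 0. hyper_nuclear_norm (r * m * n) G H S \<le>
        ?K * sup_norm F H T * (hyper_nuclear_norm n E F P + e) ^ r * sup_norm G E R ^ (r * n)"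
      using eventually_at_right_less[of 0] by eventually_elim (use approx in blast)
  qed simp
qed


section \<open>The ideal of hyper-nuclear polynomials\<close>

context normed_banach_pair
begin

interpretation K: banach_carrier "scalar_space :: ('k, 'k) nvs"
  by (rule banach_carrier_scalar_space)

interpretation EK: normed_banach_pair E scalar_space ..

lemma rank_one_hyper_nuclear:
  assumes p: "p \<in> hom_polys n E scalar_space" and y: "y \<in> carrier F"
  shows "(\<lambda>x\<in>carrier E. p x \<odot>\<^bsub>F\<^esub> y) \<in> hyper_nuclear n E F"
    and "hyper_nuclear_norm n E F (\<lambda>x\<in>carrier E. p x \<odot>\<^bsub>F\<^esub> y) \<le> sup_norm E scalar_space p * nrm F y"
proof -
  let ?P = "\<lambda>x\<in>carrier E. p x \<odot>\<^bsub>F\<^esub> y"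
  have cl: "p x \<odot>\<^bsub>F\<^esub> y \<in> carrier F" for x
    by (rule F.smult_closed[OF _ y]) simp
  have "abs_sums F (\<lambda>i. p x \<odot>\<^bsub>F\<^esub> y) {0::nat} (?P x)" if "x \<in> carrier E" for x
    using F.abs_sums_finite[of "{0}" "\<lambda>i::nat. p x \<odot>\<^bsub>F\<^esub> y"] cl that by (simp add: F.finsum_single)
  then have sum: "nuclear_sum n E F {0::nat} (\<lambda>_. p) (\<lambda>_. y) ?P"
    unfolding nuclear_sum_def using p y cl by auto
  show "?P \<in> hyper_nuclear n E F"
    by (rule hyper_nuclear_if_nuclear_sum(1)[OF _ sum]) simp
  show "hyper_nuclear_norm n E F ?P \<le> sup_norm E scalar_space p * nrm F y"
    using hyper_nuclear_if_nuclear_sum(2)[OF _ sum] by simp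
qed

lemma module_hyper_nuclear:
  "Module.module (ring_of_type_algebra :: 'k ring)
    (hom_poly_space n E F\<lparr>carrier := hyper_nuclear n E F, nrm := g\<rparr>)"
  by (rule module_poly_subspace)
    (use hyper_nuclear_hom_polys hyper_nuclear_zero(1) hyper_nuclear_add(1) hyper_nuclear_scale_le(1) in blast)+

lemma submodule_hyper_nuclear:
  "submodule (hyper_nuclear n E F) (ring_of_type_algebra :: 'k ring) (hom_poly_space n E F)"
  by (rule submodule_hom_poly_space)
    (use hyper_nuclear_hom_polys hyper_nuclear_zero(1) hyper_nuclear_add(1) hyper_nuclear_scale_le(1) in blast)+

text \<open>The norm dominates the sup norm, so a series with summable norms has a pointwise sum. Its
  remainders are sums of hyper-nuclear polynomials themselves, and \<open>hyper_nuclear_series\<close> bounds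
  their norms by the remainders of the series of norms.\<close>

lemma banach_carrier_hyper_nuclear:
  assumes g: "\<And>P. P \<in> hyper_nuclear n E F \<Longrightarrow> g P = hyper_nuclear_norm n E F P"
  shows "banach_carrier (hom_poly_space n E F\<lparr>carrier := hyper_nuclear n E F, nrm := g\<rparr>)"
proof -
  let ?W = "hyper_nuclear n E F"
  let ?S = "hom_poly_space n E F\<lparr>carrier := ?W, nrm := g\<rparr>"
  have W: "?W \<subseteq> hom_polys n E F"
    using hyper_nuclear_hom_polys by blast
  have nc: "normed_carrier ?S"
  proof (rule normed_carrierI[OF module_hyper_nuclear])
    fix P assume "P \<in> carrier ?S"
    then have P: "P \<in> ?W"
      by simp
    show "0 \<le> nrm ?S P"
      using g[OF P] hyper_nuclear_norm_nonneg[OF P] by simp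
    show "nrm ?S P = 0 \<longleftrightarrow> P = \<zero>\<^bsub>?S\<^esub>"
    proof
      assume "nrm ?S P = 0"
      then have "sup_norm E F P \<le> 0"
        using g[OF P] sup_norm_le_hyper_nuclear_norm[OF P] by simp
      have "P = (\<lambda>x\<in>carrier E. \<zero>\<^bsub>F\<^esub>)"
      proof (rule PiE_ext[OF hom_polys_extensional[OF hyper_nuclear_hom_polys[OF P]]
            hom_polys_extensional[OF hom_polys_zero]])
        fix x assume x: "x \<in> carrier E"
        have Px: "P x \<in> carrier F"
          by (rule hom_polys_closed[OF hyper_nuclear_hom_polys[OF P] x])
        have "nrm F (P x) \<le> sup_norm E F P * nrm E x ^ n"
          by (rule nrm_le_sup_norm[OF hyper_nuclear_hom_polys[OF P] x])
        also have "\<dots> \<le> 0"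
          using \<open>sup_norm E F P \<le> 0\<close> x by (intro mult_nonpos_nonneg) auto
        finally have "nrm F (P x) = 0"
          using F.nrm_nonneg[OF Px] by linarith
        then show "P x = (\<lambda>x\<in>carrier E. \<zero>\<^bsub>F\<^esub>) x"
          using Px x by simp
      qed
      then show "P = \<zero>\<^bsub>?S\<^esub>"
        by simp
    next
      assume "P = \<zero>\<^bsub>?S\<^esub>"
      then have "P = (\<lambda>x\<in>carrier E. \<zero>\<^bsub>F\<^esub>)"
        by simp
      then have "hyper_nuclear_norm n E F P = 0"
        by (simp only: hyper_nuclear_zero(2))
      then show "nrm ?S P = 0"
        using g[OF P] by simp
    qed
    show "nrm ?S (a \<odot>\<^bsub>?S\<^esub> P) = norm a * nrm ?S P" for a
      using g[OF P] g[OF hyper_nuclear_scale_le(1)[OF P]] hyper_nuclear_norm_scale[OF P] by simp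
    fix Q assume "Q \<in> carrier ?S"
    then have Q: "Q \<in> ?W"
      by simp
    show "nrm ?S (P \<oplus>\<^bsub>?S\<^esub> Q) \<le> nrm ?S P + nrm ?S Q"
      using g[OF P] g[OF Q] g[OF hyper_nuclear_add(1)[OF P Q]] hyper_nuclear_add(2)[OF P Q] by simp
  qed
  interpret S: normed_carrier ?S
    by (rule nc)
  have "Metric_space.mcomplete (carrier ?S) (ndist ?S)"
  proof (rule S.mcompleteI_series)
    fix f :: "nat \<Rightarrow> 'a \<Rightarrow> 'b" assume "\<And>k. f k \<in> carrier ?S" and "summable (\<lambda>k. nrm ?S (f k))"
    then have f: "f k \<in> ?W" and "summable (\<lambda>k. hyper_nuclear_norm n E F (f k))" for k
      using g by simp_all
    then have summable: "(\<lambda>k. hyper_nuclear_norm n E F (f k)) summable_on UNIV"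
      using hyper_nuclear_norm_nonneg by (subst summable_on_UNIV_nonneg_real_iff) auto
    have f_cl: "f k x \<in> carrier F" if "x \<in> carrier E" for k x
      by (rule hom_polys_closed[OF hyper_nuclear_hom_polys[OF f] that])
    have f_le: "nrm F (f k x) \<le> hyper_nuclear_norm n E F (f k) * nrm E x ^ n" if x: "x \<in> carrier E" for k x
    proof -
      have "nrm F (f k x) \<le> sup_norm E F (f k) * nrm E x ^ n"
        by (rule nrm_le_sup_norm[OF hyper_nuclear_hom_polys[OF f] x])
      also have "\<dots> \<le> hyper_nuclear_norm n E F (f k) * nrm E x ^ n"
        using sup_norm_le_hyper_nuclear_norm[OF f] x by (intro mult_right_mono) auto
      finally show ?thesis .
    qed
    have ex: "\<exists>s. abs_sums F (\<lambda>k. f k x) A s" if x: "x \<in> carrier E" for x A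
    proof (rule F.abs_sums_exists)
      have "(\<lambda>k. hyper_nuclear_norm n E F (f k) * nrm E x ^ n) summable_on A"
        by (intro summable_on_cmult_left summable_on_subset_banach[OF summable]) simp
      then show "(\<lambda>k. nrm F (f k x)) summable_on A"
        by (rule summable_on_comparison_test) (use f_le[OF x] f_cl[OF x] in auto)
    qed (use f_cl[OF x] in auto)
    define T where "T A = (\<lambda>x\<in>carrier E. SOME s. abs_sums F (\<lambda>k. f k x) A s)" for A
    have T: "abs_sums F (\<lambda>k. f k x) A (T A x)" if x: "x \<in> carrier E" for A x
      using someI_ex[OF ex[OF x, of A]] x by (simp add: T_def)
    have T_ext: "T A \<in> carrier E \<rightarrow>\<^sub>E carrier F" for A
      using F.abs_sumsD(2)[OF T] by (auto simp: T_def)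
    have T_W: "T A \<in> ?W" "hyper_nuclear_norm n E F (T A) \<le> (\<Sum>\<^sub>\<infinity>k\<in>A. hyper_nuclear_norm n E F (f k))" for A
    proof -
      have "(\<lambda>k. hyper_nuclear_norm n E F (f k)) summable_on A"
        by (rule summable_on_subset_banach[OF summable]) simp
      from hyper_nuclear_series[OF f this T_ext T] show "T A \<in> ?W"
        "hyper_nuclear_norm n E F (T A) \<le> (\<Sum>\<^sub>\<infinity>k\<in>A. hyper_nuclear_norm n E F (f k))"
        by simp_all
    qed
    have fin_W: "finsum ?S f {..<N} \<in> ?W" for N
      using S.M.finsum_closed[of f "{..<N}"] f by simp
    have diff: "T UNIV \<ominus>\<^bsub>?S\<^esub> finsum ?S f {..<N} = T (UNIV - {..<N})" for N
    proof (rule PiE_ext[OF hom_polys_extensional[OF hyper_nuclear_hom_polys] T_ext])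
      show "T UNIV \<ominus>\<^bsub>?S\<^esub> finsum ?S f {..<N} \<in> ?W"
        using S.M.minus_closed[of "T UNIV" "finsum ?S f {..<N}"] T_W(1) fin_W by simp
      fix x assume x: "x \<in> carrier E"
      let ?s = "finsum F (\<lambda>k. f k x) {..<N}" and ?t = "T (UNIV - {..<N}) x"
      have "(T UNIV \<ominus>\<^bsub>?S\<^esub> finsum ?S f {..<N}) x = T UNIV x \<ominus>\<^bsub>F\<^esub> ?s"
        using poly_subspace_minus[OF W module_hyper_nuclear T_W(1) fin_W x]
          poly_subspace_finsum[OF W module_hyper_nuclear _ _ x, of "{..<N}" f] f by simp
      also have "T UNIV x = ?s \<oplus>\<^bsub>F\<^esub> ?t"
      proof (rule F.abs_sums_unique[OF T[OF x]])
        have "abs_sums F (\<lambda>k. f k x) {..<N} ?s"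
          by (rule F.abs_sums_finite) (use f_cl[OF x] in auto)
        from F.abs_sums_Un_disjoint[OF this T[OF x, of "UNIV - {..<N}"]]
        show "abs_sums F (\<lambda>k. f k x) UNIV (?s \<oplus>\<^bsub>F\<^esub> ?t)"
          by simp
      qed
      also have "(?s \<oplus>\<^bsub>F\<^esub> ?t) \<ominus>\<^bsub>F\<^esub> ?s = ?t"
      proof -
        have "?s \<in> carrier F" "?t \<in> carrier F"
          using F.M.finsum_closed[of "\<lambda>k. f k x" "{..<N}"] f_cl[OF x] F.abs_sumsD(2)[OF T[OF x]] by auto
        then show ?thesis
          using F.add_diff_add[of ?s ?t ?s "\<zero>\<^bsub>F\<^esub>"] by simp
      qed
      finally show "(T UNIV \<ominus>\<^bsub>?S\<^esub> finsum ?S f {..<N}) x = T (UNIV - {..<N}) x" .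
    qed
    have lim: "(\<lambda>N. nrm ?S (finsum ?S f {..<N} \<ominus>\<^bsub>?S\<^esub> T UNIV)) \<longlonglongrightarrow> 0"
    proof (rule tendsto_sandwich[OF _ _ tendsto_const
          infsum_Diff_finite_tendsto_0[OF summable filterlim_lessThan_at_top]])
      have cl: "finsum ?S f {..<N} \<in> carrier ?S" "T UNIV \<in> carrier ?S" for N
        using fin_W T_W(1) by simp_all
      have "nrm ?S (finsum ?S f {..<N} \<ominus>\<^bsub>?S\<^esub> T UNIV) = hyper_nuclear_norm n E F (T (UNIV - {..<N}))" for N
        using S.nrm_diff_commute[OF cl, of N] g[OF T_W(1)] unfolding diff by simp
      then show "\<forall>\<^sub>F N in sequentially. nrm ?S (finsum ?S f {..<N} \<ominus>\<^bsub>?S\<^esub> T UNIV) \<le>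
          (\<Sum>\<^sub>\<infinity>k\<in>UNIV - {..<N}. hyper_nuclear_norm n E F (f k))"
        using T_W(2) by simp
      show "\<forall>\<^sub>F N in sequentially. 0 \<le> nrm ?S (finsum ?S f {..<N} \<ominus>\<^bsub>?S\<^esub> T UNIV)"
        by (intro always_eventually allI S.nrm_nonneg S.M.minus_closed cl)
    qed
    show "\<exists>s. limitin (ntop ?S) (\<lambda>N. finsum ?S f {..<N}) s sequentially"
    proof (intro exI[of _ "T UNIV"] S.limitin_ntop_iff[THEN iffD2] conjI lim)
      show "finsum ?S f {..<N} \<in> carrier ?S" "T UNIV \<in> carrier ?S" for N
        using fin_W T_W(1) by simp_all
    qed
  qed
  then show ?thesis
    using nc by (simp add: banach_carrier_def banach_carrier_axioms_def)
qed

end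

lemma banach_carrier_pair:
  assumes "Banach_space E" "Banach_space F"
  shows "normed_banach_pair E F"
  using assms by (simp add: Banach_space_iff normed_banach_pair_def banach_carrier_def)

lemma comp_of_HN:
  assumes "Banach_space E" "Banach_space F" "1 \<le> n"
  shows "comp_of HN n E F = hyper_nuclear n E F"
proof -
  interpret normed_banach_pair E F
    using assms by (intro banach_carrier_pair)
  have "P \<in> hyper_nuclear n E F" if "P \<in> hom_polys n E F" "P \<in> hyper_nuclear m E F" for P m
  proof (cases "m = n")
    case False
    then show ?thesis
      using hom_polys_degree_unique[OF that(1) hyper_nuclear_hom_polys[OF that(2)]] hyper_nuclear_zero(1)
      by simp
  qed (use that in simp)
  then show ?thesis
    using assms hyper_nuclear_hom_polys unfolding comp_of_def HN_def by blast
qed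

text \<open>The degree of a polynomial is ambiguous only if it is zero, and then its norm is 0 in every
  degree.\<close>

lemma HN_norm_eq:
  assumes "Banach_space E" "Banach_space F" "1 \<le> n" and P: "P \<in> hyper_nuclear n E F"
  shows "HN_norm (E, F, P) = hyper_nuclear_norm n E F P"
proof -
  interpret normed_banach_pair E F
    using assms by (intro banach_carrier_pair)
  define m where "m = (LEAST n. 1 \<le> n \<and> P \<in> hyper_nuclear n E F)"
  have "1 \<le> m \<and> P \<in> hyper_nuclear m E F"
    unfolding m_def by (rule LeastI[of _ n]) (use assms in simp)
  then have "hyper_nuclear_norm m E F P = hyper_nuclear_norm n E F P"
    using hom_polys_degree_unique[of P m n] hyper_nuclear_hom_polys P hyper_nuclear_zero(2) by metis
  then show ?thesis
    by (simp add: HN_norm_def m_def)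
qed

lemma projl_hom_polys:
  "restrict projl (range Inl) \<in> hom_polys 1 (scalar_copy :: ('k::{real_normed_field, banach}, 'u) space) scalar_space"
  "sup_norm (scalar_copy :: ('k, 'u) space) scalar_space (restrict projl (range Inl)) \<le> 1"
proof -
  note lin = hom_polys_linear[OF normed_carrier_scalar_copy normed_carrier_scalar_space,
      of "restrict projl (range Inl :: ('k + 'u) set)" 1]
  show "restrict projl (range Inl) \<in> hom_polys 1 (scalar_copy :: ('k, 'u) space) scalar_space"
    by (rule lin(1)) auto
  show "sup_norm (scalar_copy :: ('k, 'u) space) scalar_space (restrict projl (range Inl)) \<le> 1"
    by (rule lin(2)) auto
qed

lemma projl_power_hom_polys:
  fixes n :: nat
  defines "p \<equiv> \<lambda>x\<in>carrier (scalar_copy :: ('k::{real_normed_field, banach}, 'u) space). projl x ^ n"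
  shows "p \<in> hom_polys n scalar_copy scalar_space" and "sup_norm scalar_copy scalar_space p \<le> 1"
proof -
  interpret C: normed_carrier "scalar_copy :: ('k, 'u) space"
    by (rule normed_carrier_scalar_copy)
  interpret K: normed_carrier "scalar_space :: ('k, 'k) nvs"
    by (rule normed_carrier_scalar_space)
  interpret CK: normed_pair "scalar_copy :: ('k, 'u) space" scalar_space ..
  interpret KK: normed_pair "scalar_space :: ('k, 'k) nvs" scalar_space ..
  have eq: "p = compose (carrier scalar_copy) (\<lambda>a. a ^ n) (restrict projl (range Inl))"
    by (auto simp: p_def compose_def)
  note c = hom_polys_compose[OF C.normed_carrier_axioms K.normed_carrier_axioms K.normed_carrier_axioms
      projl_hom_polys(1) hom_polys_power(1)[of n]]
  show "p \<in> hom_polys n scalar_copy scalar_space"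
    using c(1) by (simp add: eq)
  have "sup_norm scalar_space scalar_space (\<lambda>a::'k. a ^ n) *
      sup_norm (scalar_copy :: ('k, 'u) space) scalar_space (restrict projl (range Inl)) ^ n \<le> 1 * 1 ^ n"
    by (intro mult_mono power_mono hom_polys_power(2) projl_hom_polys(2)
        CK.sup_norm_nonneg[OF projl_hom_polys(1)] zero_le_power) simp
  then show "sup_norm scalar_copy scalar_space p \<le> 1"
    using c(2) by (simp add: eq)
qed

lemma scalar_power_finite_type:
  "scalar_power n \<in> finite_type n (scalar_copy :: ('k::{real_normed_field, banach}, 'u) space) scalar_copy"
proof -
  interpret C: normed_carrier "scalar_copy :: ('k, 'u) space"
    by (rule normed_carrier_scalar_copy)
  have sum: "scalar_power n x = finsum scalar_copy
      (\<lambda>i. (restrict projl (range Inl) x ^ n) \<odot>\<^bsub>scalar_copy\<^esub> Inl 1) {..<1::nat}"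
    if x: "x \<in> carrier (scalar_copy :: ('k, 'u) space)" for x
  proof -
    obtain a where a: "x = Inl a"
      using x by auto
    have "finsum (scalar_copy :: ('k, 'u) space)
        (\<lambda>i. (restrict projl (range Inl) x ^ n) \<odot>\<^bsub>scalar_copy\<^esub> Inl 1) {0::nat} =
        (restrict projl (range Inl) x ^ n) \<odot>\<^bsub>scalar_copy\<^esub> Inl 1"
      by (rule C.finsum_single) (simp add: a)
    moreover have "{..<1} = {0::nat}"
      by auto
    ultimately show ?thesis
      by (simp add: a scalar_power_def)
  qed
  show ?thesis
    unfolding finite_type_def
  proof (intro CollectI conjI exI allI impI ballI)
    show "scalar_power n \<in> carrier (scalar_copy :: ('k, 'u) space) \<rightarrow>\<^sub>E carrier (scalar_copy :: ('k, 'u) space)"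
      by (auto simp: scalar_power_def)
    show "restrict projl (range Inl) \<in> hom_polys 1 (scalar_copy :: ('k, 'u) space) scalar_space"
      by (rule projl_hom_polys(1))
    show "Inl 1 \<in> carrier (scalar_copy :: ('k, 'u) space)"
      by simp
  qed (rule sum)
qed

lemma hyper_nuclear_norm_scalar_power:
  "hyper_nuclear_norm n (scalar_copy :: ('k::{real_normed_field, banach}, 'u) space) scalar_copy (scalar_power n) = 1"
proof (rule antisym)
  interpret C: banach_carrier "scalar_copy :: ('k, 'u) space"
    by (rule banach_carrier_scalar_copy)
  interpret CC: normed_banach_pair "scalar_copy :: ('k, 'u) space" "scalar_copy :: ('k, 'u) space" ..
  let ?p = "\<lambda>x\<in>carrier (scalar_copy :: ('k, 'u) space). projl x ^ n"
  have eq: "scalar_power n = (\<lambda>x\<in>carrier scalar_copy. ?p x \<odot>\<^bsub>scalar_copy :: ('k, 'u) space\<^esub> Inl 1)"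
    by (auto simp: scalar_power_def)
  have "Inl 1 \<in> carrier (scalar_copy :: ('k, 'u) space)"
    by simp
  note r = CC.rank_one_hyper_nuclear[where n = n, OF projl_power_hom_polys(1) this]
  have mem: "scalar_power n \<in> hyper_nuclear n (scalar_copy :: ('k, 'u) space) scalar_copy"
    unfolding eq by (rule r(1))
  have "hyper_nuclear_norm n (scalar_copy :: ('k, 'u) space) scalar_copy (scalar_power n) \<le>
      sup_norm scalar_copy scalar_space ?p * nrm (scalar_copy :: ('k, 'u) space) (Inl 1)"
    unfolding eq by (rule r(2))
  also have "\<dots> \<le> 1"
    using projl_power_hom_polys(2)[of n, where 'k = 'k and 'u = 'u] by simp
  finally show "hyper_nuclear_norm n (scalar_copy :: ('k, 'u) space) scalar_copy (scalar_power n) \<le> 1" .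
  have "nrm (scalar_copy :: ('k, 'u) space) (scalar_power n (Inl 1)) \<le>
      sup_norm (scalar_copy :: ('k, 'u) space) scalar_copy (scalar_power n)"
    by (rule CC.nrm_le_sup_norm_unit[OF CC.hyper_nuclear_hom_polys[OF mem]]) simp_all
  then show "1 \<le> hyper_nuclear_norm n (scalar_copy :: ('k, 'u) space) scalar_copy (scalar_power n)"
    using CC.sup_norm_le_hyper_nuclear_norm[OF mem] by (simp add: scalar_power_def)
qed

lemma Banach_space_scalar_copy: "Banach_space (scalar_copy :: ('k::{real_normed_field, banach}, 'u) space)"
  by (simp add: Banach_space_iff banach_carrier_scalar_copy)

lemma Banach_polynomial_class_HN:
  "Banach_polynomial_class (HN :: ('k::{real_normed_field, banach}, 'u) class_polynomial set) HN_norm"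
  unfolding Banach_polynomial_class_def
proof (intro conjI allI impI)
  show "polynomial_class (HN :: ('k, 'u) class_polynomial set) HN_norm"
    unfolding polynomial_class_def
  proof (intro conjI ballI subsetI)
    fix q :: "('k, 'u) class_polynomial" assume "q \<in> HN"
    then obtain E F P n where q: "q = (E, F, P)" "Banach_space E" "Banach_space F" "1 \<le> n"
      "P \<in> hyper_nuclear n E F"
      unfolding HN_def by blast
    interpret normed_banach_pair E F
      using q by (intro banach_carrier_pair)
    show "q \<in> {(E, F, P). Banach_space E \<and> Banach_space F \<and> (\<exists>n\<ge>1. P \<in> hom_polys n E F)}"
      using q hyper_nuclear_hom_polys by blast
    show "0 \<le> HN_norm q"
      unfolding q(1) HN_norm_eq[OF q(2-5)] by (rule hyper_nuclear_norm_nonneg[OF q(5)])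
  qed
next
  fix n :: nat and E F :: "('k, 'u) space"
  assume n: "1 \<le> n" and EF: "Banach_space E" "Banach_space F"
  interpret normed_banach_pair E F
    using EF by (intro banach_carrier_pair)
  show "submodule (comp_of HN n E F) ring_of_type_algebra (hom_poly_space n E F)"
    unfolding comp_of_HN[OF EF n] by (rule submodule_hyper_nuclear)
  show "finite_type n E F \<subseteq> comp_of HN n E F"
    unfolding comp_of_HN[OF EF n] by (rule finite_type_hyper_nuclear)
  show "Banach_space (hom_poly_space n E F\<lparr>carrier := comp_of HN n E F, nrm := \<lambda>P. HN_norm (E, F, P)\<rparr>)"
    unfolding comp_of_HN[OF EF n] Banach_space_iff
    by (rule banach_carrier_hyper_nuclear) (rule HN_norm_eq[OF EF n])
next
  fix n :: nat assume n: "1 \<le> n"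
  interpret normed_banach_pair "scalar_copy :: ('k, 'u) space" "scalar_copy :: ('k, 'u) space"
    by (intro banach_carrier_pair Banach_space_scalar_copy)
  have "scalar_power n \<in> hyper_nuclear n (scalar_copy :: ('k, 'u) space) scalar_copy"
    using scalar_power_finite_type finite_type_hyper_nuclear by blast
  from HN_norm_eq[OF Banach_space_scalar_copy Banach_space_scalar_copy n this]
  show "HN_norm (scalar_copy :: ('k, 'u) space, scalar_copy, scalar_power n) = 1"
    by (simp add: hyper_nuclear_norm_scalar_power)
qed

lemma two_sided_ideal_HN:
  "two_sided_ideal (\<lambda>n. 1) (\<lambda>n. real n ^ n / fact n)
    (HN :: ('k::{real_normed_field, banach}, 'u) class_polynomial set) HN_norm"
  unfolding two_sided_ideal_def Let_def
proof (intro conjI allI impI Banach_polynomial_class_HN)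
  show "ideal_constants (\<lambda>n. 1)"
    by (simp add: ideal_constants_def)
  have "fact n \<le> real n ^ n" for n
    using fact_le_power[of n, where 'a = real] by simp
  then show "ideal_constants (\<lambda>n. real n ^ n / fact n)"
    by (simp add: ideal_constants_def)
  fix n m r :: nat and E F G H :: "('k, 'u) space" and P R T
  assume nmr: "1 \<le> n" "1 \<le> m" "1 \<le> r"
    and B: "Banach_space E" "Banach_space F" "Banach_space G" "Banach_space H"
    and P: "P \<in> comp_of HN n E F" and R: "R \<in> hom_polys m G E" and T: "T \<in> hom_polys r F H"
  let ?S = "compose (carrier G) T (compose (carrier G) P R)"
  have P': "P \<in> hyper_nuclear n E F"
    using P comp_of_HN[OF B(1,2) nmr(1)] by simp
  have rmn: "1 \<le> r * m * n"
    using nmr by simp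
  note B' = B[unfolded Banach_space_iff]
  note c = hyper_nuclear_compose[OF banach_carrier.axioms(1)[OF B'(1)] B'(2)
      banach_carrier.axioms(1)[OF B'(3)] B'(4) P' R T]
  show "?S \<in> comp_of HN (r * m * n) G H"
    unfolding comp_of_HN[OF B(3,4) rmn] by (rule c(1))
  show "HN_norm (G, H, ?S) \<le> real r ^ r / fact r * 1 ^ (r * n) * sup_norm F H T *
      HN_norm (E, F, P) ^ r * sup_norm G E R ^ (r * n)"
    unfolding HN_norm_eq[OF B(3,4) rmn c(1)] HN_norm_eq[OF B(1,2) nmr(1) P'] using c(2) by simp
qed


section \<open>Minimality\<close>

text \<open>A linear map is a polynomial of degree 1, and the constant \<open>K 1\<close> is 1.\<close>

lemma hyper_ideal_if_two_sided_ideal: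
  fixes Q :: "('k::{real_normed_field, banach}, 'u) class_polynomial set"
  assumes Q: "two_sided_ideal C K Q N"
  shows "hyper_ideal C Q N"
  unfolding hyper_ideal_def
proof (intro conjI allI impI)
  have K: "K 1 = 1"
    using Q by (simp add: two_sided_ideal_def ideal_constants_def)
  show "ideal_constants C" "Banach_polynomial_class Q N"
    using Q by (simp_all add: two_sided_ideal_def)
  fix n m :: nat and E F G H :: "('k, 'u) space" and P R t
  assume *: "1 \<le> n" "1 \<le> m" "Banach_space E" "Banach_space F" "Banach_space G" "Banach_space H"
    "P \<in> comp_of Q n E F" "R \<in> hom_polys m G E" "t \<in> hom_polys 1 F H"
  have "let S = compose (carrier G) t (compose (carrier G) P R) in
      S \<in> comp_of Q (1 * m * n) G H \<and>
      N (G, H, S) \<le> K 1 * C m ^ (1 * n) * sup_norm F H t * N (E, F, P) ^ 1 * sup_norm G E R ^ (1 * n)"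
    using Q[unfolded two_sided_ideal_def, THEN conjunct2, THEN conjunct2, THEN conjunct2,
        rule_format, of n m 1 E F G H P R t] * by simp
  then show "let S = compose (carrier G) t (compose (carrier G) P R) in
      S \<in> comp_of Q (m * n) G H \<and>
      N (G, H, S) \<le> C m ^ n * sup_norm F H t * N (E, F, P) * sup_norm G E R ^ n"
    by (simp only: K power_one_right mult_1)
qed

context
  fixes C :: "nat \<Rightarrow> real" and Q :: "('k::{real_normed_field, banach}, 'u) class_polynomial set"
    and N :: "('k, 'u) class_polynomial \<Rightarrow> real"
  assumes Q: "hyper_ideal C Q N"
begin

lemma hyper_idealD:
  assumes "1 \<le> n" "1 \<le> m" "Banach_space E" "Banach_space F" "Banach_space G" "Banach_space H"
    "P \<in> comp_of Q n E F" "R \<in> hom_polys m G E" "t \<in> hom_polys 1 F H"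
  shows "compose (carrier G) t (compose (carrier G) P R) \<in> comp_of Q (m * n) G H"
    and "N (G, H, compose (carrier G) t (compose (carrier G) P R)) \<le>
      C m ^ n * sup_norm F H t * N (E, F, P) * sup_norm G E R ^ n"
  using Q assms unfolding hyper_ideal_def Let_def by blast+

lemma hyper_ideal_constant: "1 \<le> n \<Longrightarrow> 1 \<le> C n" "C 1 = 1"
  using Q by (auto simp: hyper_ideal_def ideal_constants_def)

lemma hyper_ideal_class:
  assumes "1 \<le> n" "Banach_space E" "Banach_space F"
  shows "finite_type n E F \<subseteq> comp_of Q n E F"
    and "banach_carrier (hom_poly_space n E F\<lparr>carrier := comp_of Q n E F, nrm := \<lambda>P. N (E, F, P)\<rparr>)"
  using Q assms unfolding hyper_ideal_def Banach_polynomial_class_def Banach_space_iff by blast+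

lemma scalar_power_in_hyper_ideal:
  assumes "1 \<le> n"
  shows "scalar_power n \<in> comp_of Q n scalar_copy scalar_copy"
    and "N (scalar_copy, scalar_copy, scalar_power n) = 1"
proof -
  show "scalar_power n \<in> comp_of Q n scalar_copy scalar_copy"
    using hyper_ideal_class(1)[OF assms Banach_space_scalar_copy Banach_space_scalar_copy]
      scalar_power_finite_type by blast
  show "N (scalar_copy, scalar_copy, scalar_power n) = 1"
    using Q assms unfolding hyper_ideal_def Banach_polynomial_class_def by blast
qed

lemma line_hom_polys:
  fixes F :: "('k, 'u) space"
  assumes F: "Banach_space F" and y: "y \<in> carrier F"
  defines "t \<equiv> \<lambda>z\<in>carrier (scalar_copy :: ('k, 'u) space). projl z \<odot>\<^bsub>F\<^esub> y"
  shows "t \<in> hom_polys 1 scalar_copy F" and "sup_norm scalar_copy F t \<le> nrm F y"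
proof -
  interpret F: banach_carrier F
    using F by (simp add: Banach_space_iff)
  note r = hom_polys_rank_one[OF normed_carrier_scalar_copy F.normed_carrier_axioms projl_hom_polys(1) y]
  have eq: "t = (\<lambda>z\<in>carrier (scalar_copy :: ('k, 'u) space). restrict projl (range Inl) z \<odot>\<^bsub>F\<^esub> y)"
    unfolding t_def by (rule restrict_ext) simp
  show "t \<in> hom_polys 1 scalar_copy F"
    unfolding eq by (rule r(1))
  have "sup_norm scalar_copy F t \<le>
      sup_norm (scalar_copy :: ('k, 'u) space) scalar_space (restrict projl (range Inl)) * nrm F y"
    unfolding eq by (rule r(2))
  also have "\<dots> \<le> 1 * nrm F y"
    by (intro mult_right_mono projl_hom_polys(2) F.nrm_nonneg y)
  finally show "sup_norm scalar_copy F t \<le> nrm F y"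
    by simp
qed

text \<open>The polynomial factors as \<open>p\<close>, followed by the identity of the scalars, followed by
  \<open>\<lambda> \<mapsto> \<lambda> y\<close>. The identity belongs to \<open>Q\<close> with norm 1, and its degree 1 is the exponent of \<open>C n\<close>.\<close>

lemma rank_one_in_hyper_ideal:
  fixes E F :: "('k, 'u) space"
  assumes n: "1 \<le> n" and E: "Banach_space E" and F: "Banach_space F"
    and p: "p \<in> hom_polys n E scalar_space" and y: "y \<in> carrier F"
  shows "(\<lambda>x\<in>carrier E. p x \<odot>\<^bsub>F\<^esub> y) \<in> comp_of Q n E F"
    and "N (E, F, \<lambda>x\<in>carrier E. p x \<odot>\<^bsub>F\<^esub> y) \<le> C n * (sup_norm E scalar_space p * nrm F y)"
proof -
  interpret E: banach_carrier E
    using E by (simp add: Banach_space_iff)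
  interpret F: banach_carrier F
    using F by (simp add: Banach_space_iff)
  interpret C: normed_carrier "scalar_copy :: ('k, 'u) space"
    by (rule normed_carrier_scalar_copy)
  interpret K: normed_carrier "scalar_space :: ('k, 'k) nvs"
    by (rule normed_carrier_scalar_space)
  interpret EC: normed_pair E "scalar_copy :: ('k, 'u) space" ..
  interpret EK: normed_pair E "scalar_space :: ('k, 'k) nvs" ..
  interpret CF: normed_pair "scalar_copy :: ('k, 'u) space" F ..
  have Inl_eq: "Inl = (\<lambda>a. a \<odot>\<^bsub>scalar_copy :: ('k, 'u) space\<^esub> Inl 1)"
    by (simp add: fun_eq_iff)
  have one: "Inl 1 \<in> carrier (scalar_copy :: ('k, 'u) space)"
    by simp
  let ?R = "\<lambda>x\<in>carrier E. p x \<odot>\<^bsub>scalar_copy :: ('k, 'u) space\<^esub> Inl 1"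
  let ?t = "\<lambda>z\<in>carrier (scalar_copy :: ('k, 'u) space). projl z \<odot>\<^bsub>F\<^esub> y"
  note R = hom_polys_rank_one[OF E.normed_carrier_axioms C.normed_carrier_axioms p one]
  note t = line_hom_polys[OF F y]
  let ?S = "compose (carrier E) ?t (compose (carrier E) (scalar_power 1) ?R)"
  have S: "?S = (\<lambda>x\<in>carrier E. p x \<odot>\<^bsub>F\<^esub> y)"
    unfolding compose_def by (rule restrict_ext) (simp add: scalar_power_def)
  note h = hyper_idealD[where n = 1 and m = n, OF order_refl n Banach_space_scalar_copy
      Banach_space_scalar_copy E F scalar_power_in_hyper_ideal(1)[OF order_refl] R(1) t(1), unfolded S]
  show "(\<lambda>x\<in>carrier E. p x \<odot>\<^bsub>F\<^esub> y) \<in> comp_of Q n E F"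
    using h(1) by simp
  have "N (E, F, \<lambda>x\<in>carrier E. p x \<odot>\<^bsub>F\<^esub> y) \<le> C n * (sup_norm scalar_copy F ?t * sup_norm E scalar_copy ?R)"
    using h(2) scalar_power_in_hyper_ideal(2)[of 1] by (simp add: mult.assoc)
  also have "\<dots> \<le> C n * (nrm F y * sup_norm E scalar_space p)"
  proof (intro mult_left_mono mult_mono t(2) F.nrm_nonneg y)
    show "sup_norm E scalar_copy ?R \<le> sup_norm E scalar_space p"
      using R(2) by simp
    show "0 \<le> sup_norm E scalar_copy ?R"
      by (rule EC.sup_norm_nonneg[OF R(1)])
    show "0 \<le> C n"
      using hyper_ideal_constant(1)[OF n] by simp
  qed
  finally show "N (E, F, \<lambda>x\<in>carrier E. p x \<odot>\<^bsub>F\<^esub> y) \<le> C n * (sup_norm E scalar_space p * nrm F y)"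
    by (simp add: mult.commute)
qed

text \<open>Composing \<open>D\<close> with the line \<open>\<lambda> \<mapsto> \<lambda> x\<close> gives \<open>\<lambda> \<mapsto> \<lambda>^n D(x)\<close>. The line has degree 1, so that
  the constant is \<open>C 1 = 1\<close>.\<close>

lemma hyper_ideal_eval_bound:
  fixes E F :: "('k, 'u) space"
  assumes n: "1 \<le> n" and E: "Banach_space E" and F: "Banach_space F"
    and D: "D \<in> comp_of Q n E F" and x: "x \<in> carrier E"
  shows "N (scalar_copy, F, \<lambda>z\<in>carrier scalar_copy. projl z ^ n \<odot>\<^bsub>F\<^esub> D x) \<le> N (E, F, D) * nrm E x ^ n"
proof -
  interpret E: banach_carrier E
    using E by (simp add: Banach_space_iff)
  interpret F: banach_carrier F
    using F by (simp add: Banach_space_iff)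
  interpret C: normed_carrier "scalar_copy :: ('k, 'u) space"
    by (rule normed_carrier_scalar_copy)
  interpret EF: normed_pair E F ..
  interpret CE: normed_pair "scalar_copy :: ('k, 'u) space" E ..
  interpret FF: normed_pair F F ..
  interpret S: banach_carrier "hom_poly_space n E F\<lparr>carrier := comp_of Q n E F, nrm := \<lambda>P. N (E, F, P)\<rparr>"
    by (rule hyper_ideal_class(2)[OF n E F])
  have ND: "0 \<le> N (E, F, D)"
    using S.nrm_nonneg[of D] D by simp
  have DP: "D \<in> hom_polys n E F"
    using D by (simp add: comp_of_def)
  let ?R = "\<lambda>z\<in>carrier (scalar_copy :: ('k, 'u) space). projl z \<odot>\<^bsub>E\<^esub> x"
  let ?t = "\<lambda>u\<in>carrier F. u"
  note R = line_hom_polys[OF E x]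
  have t: "?t \<in> hom_polys 1 F F" "sup_norm F F ?t \<le> 1"
    by (rule hom_polys_linear[OF F.normed_carrier_axioms F.normed_carrier_axioms, where M = 1];
        auto intro!: F.smult_closed)+
  let ?S = "compose (carrier scalar_copy) ?t (compose (carrier (scalar_copy :: ('k, 'u) space)) D ?R)"
  have S: "?S = (\<lambda>z\<in>carrier scalar_copy. projl z ^ n \<odot>\<^bsub>F\<^esub> D x)"
    unfolding compose_def
  proof (rule restrict_ext)
    fix z :: "'k + 'u" assume z: "z \<in> carrier scalar_copy"
    have "projl z ^ n \<odot>\<^bsub>F\<^esub> D x \<in> carrier F"
      by (rule F.smult_closed[OF _ EF.hom_polys_closed[OF DP x]]) simp
    then show "?t ((\<lambda>z\<in>carrier scalar_copy. D (?R z)) z) = projl z ^ n \<odot>\<^bsub>F\<^esub> D x"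
      using z EF.hom_polys_smult_arg[OF DP x, of "projl z"] by simp
  qed
  have "N (scalar_copy, F, ?S) \<le> C 1 ^ n * sup_norm F F ?t * N (E, F, D) * sup_norm scalar_copy E ?R ^ n"
    by (rule hyper_idealD(2)[OF n order_refl E F Banach_space_scalar_copy F D R(1) t(1)])
  also have "\<dots> = sup_norm F F ?t * (N (E, F, D) * sup_norm scalar_copy E ?R ^ n)"
    by (simp add: hyper_ideal_constant(2)[simplified] mult.assoc)
  also have "\<dots> \<le> 1 * (N (E, F, D) * nrm E x ^ n)"
    by (intro mult_mono t(2) mult_left_mono power_mono R(2) ND CE.sup_norm_nonneg[OF R(1)]
        mult_nonneg_nonneg zero_le_power) simp_all
  finally show ?thesis
    unfolding S by simp
qed

text \<open>The rank-one summands of a representation of \<open>P\<close> have summable norms in \<open>Q\<close>, so they have a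
  sum \<open>s\<close> there. To identify \<open>s x\<close> with \<open>P x\<close>, the vectors \<open>u\<close> of \<open>F\<close> are measured by the norm in
  \<open>Q\<close> of \<open>w u = (\<lambda> \<mapsto> \<lambda>^n u)\<close>. This is coarse enough to be controlled both by convergence in \<open>Q\<close>
  and by convergence in \<open>F\<close>, and still detects whether \<open>u\<close> vanishes, since \<open>w u\<close> takes the value
  \<open>u\<close> at 1.\<close>

lemma hyper_nuclear_in_hyper_ideal:
  fixes E F :: "('k, 'u) space"
  assumes n: "1 \<le> n" and E: "Banach_space E" and F: "Banach_space F"
    and P: "P \<in> hyper_nuclear n E F"
  shows "P \<in> comp_of Q n E F" and "N (E, F, P) \<le> C n * hyper_nuclear_norm n E F P"
proof -
  interpret normed_banach_pair E F
    using E F by (rule banach_carrier_pair)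
  interpret C: banach_carrier "scalar_copy :: ('k, 'u) space"
    by (rule banach_carrier_scalar_copy)
  interpret CF: normed_banach_pair "scalar_copy :: ('k, 'u) space" F ..
  let ?W = "comp_of Q n E F"
  let ?X = "hom_poly_space n E F\<lparr>carrier := ?W, nrm := \<lambda>P. N (E, F, P)\<rparr>"
  let ?V = "comp_of Q n scalar_copy F"
  let ?Y = "hom_poly_space n scalar_copy F\<lparr>carrier := ?V, nrm := \<lambda>P. N (scalar_copy, F, P)\<rparr>"
  interpret S: banach_carrier ?X
    by (rule hyper_ideal_class(2)[OF n E F])
  interpret Y: banach_carrier ?Y
    by (rule hyper_ideal_class(2)[OF n Banach_space_scalar_copy F])
  have W: "?W \<subseteq> hom_polys n E F" and V: "?V \<subseteq> hom_polys n scalar_copy F"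
    by (auto simp: comp_of_def)
  have Cn: "0 \<le> C n"
    using hyper_ideal_constant(1)[OF n] by simp
  define w where "w u = (\<lambda>z\<in>carrier (scalar_copy :: ('k, 'u) space). projl z ^ n \<odot>\<^bsub>F\<^esub> u)" for u
  have w: "w u \<in> ?V" "N (scalar_copy, F, w u) \<le> C n * nrm F u" if u: "u \<in> carrier F" for u
  proof -
    let ?p = "\<lambda>z\<in>carrier (scalar_copy :: ('k, 'u) space). projl z ^ n"
    have eq: "w u = (\<lambda>z\<in>carrier (scalar_copy :: ('k, 'u) space). ?p z \<odot>\<^bsub>F\<^esub> u)"
      unfolding w_def by (rule restrict_ext) simp
    note r = rank_one_in_hyper_ideal[OF n Banach_space_scalar_copy F projl_power_hom_polys(1) u]
    show "w u \<in> ?V"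
      unfolding eq by (rule r(1))
    have "N (scalar_copy, F, w u) \<le> C n * (sup_norm scalar_copy scalar_space ?p * nrm F u)"
      unfolding eq by (rule r(2))
    also have "\<dots> \<le> C n * (1 * nrm F u)"
      by (intro mult_left_mono mult_right_mono projl_power_hom_polys(2) F.nrm_nonneg u Cn)
    finally show "N (scalar_copy, F, w u) \<le> C n * nrm F u"
      by simp
  qed
  have w_add: "w (u \<oplus>\<^bsub>F\<^esub> v) = w u \<oplus>\<^bsub>?Y\<^esub> w v" if "u \<in> carrier F" "v \<in> carrier F" for u v
  proof -
    have "w u \<oplus>\<^bsub>?Y\<^esub> w v = (\<lambda>z\<in>carrier scalar_copy. w u z \<oplus>\<^bsub>F\<^esub> w v z)"
      by simp
    also have "\<dots> = w (u \<oplus>\<^bsub>F\<^esub> v)"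
      unfolding w_def by (rule restrict_ext) (simp add: F.smult_r_distr that)
    finally show ?thesis ..
  qed
  have *: "P \<in> ?W \<and> N (E, F, P) \<le> C n * (hyper_nuclear_norm n E F P + e)" if e: "0 < e" for e
  proof -
    from P e obtain p :: "nat \<Rightarrow> 'k + 'u \<Rightarrow> 'k" and y where sum: "nuclear_sum n E F UNIV p y P"
      and cost: "nuclear_cost E F UNIV p y < hyper_nuclear_norm n E F P + e"
      by (rule hyper_nuclear_nuclear_sum)
    note D = nuclear_sumD[OF sum]
    define f where "f j = (\<lambda>x\<in>carrier E. p j x \<odot>\<^bsub>F\<^esub> y j)" for j
    have f: "f j \<in> ?W" "N (E, F, f j) \<le> C n * (sup_norm E scalar_space (p j) * nrm F (y j))" for j
      unfolding f_def by (rule rank_one_in_hyper_ideal[OF n E F D(1,2)]; simp)+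
    have f_nonneg: "0 \<le> N (E, F, f j)" for j
      using S.nrm_nonneg[of "f j"] f(1) by simp
    have bound: "(\<lambda>j. C n * (sup_norm E scalar_space (p j) * nrm F (y j))) summable_on UNIV"
      by (rule summable_on_cmult_right[OF D(3)])
    have summable: "(\<lambda>j. N (E, F, f j)) summable_on UNIV"
      by (rule summable_on_comparison_test[OF bound f(2) f_nonneg])
    have "\<exists>s. abs_sums ?X f UNIV s"
      by (rule S.abs_sums_exists) (use f(1) summable in auto)
    then obtain s where s: "abs_sums ?X f UNIV s" ..
    have sW: "s \<in> ?W"
      using S.abs_sumsD(2)[OF s] by simp
    have "N (E, F, s) \<le> (\<Sum>\<^sub>\<infinity>j. N (E, F, f j))"
      using S.abs_sums_nrm_le[OF s] by simp
    also have "\<dots> \<le> (\<Sum>\<^sub>\<infinity>j. C n * (sup_norm E scalar_space (p j) * nrm F (y j)))"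
      by (rule infsum_mono[OF summable bound f(2)])
    also have "\<dots> = C n * nuclear_cost E F UNIV p y"
      by (rule infsum_cmult_right')
    also have "\<dots> \<le> C n * (hyper_nuclear_norm n E F P + e)"
      using cost Cn by (intro mult_left_mono) auto
    finally have N_s: "N (E, F, s) \<le> C n * (hyper_nuclear_norm n E F P + e)" .
    have "s = P"
    proof (rule PiE_ext[OF hom_polys_extensional[OF subsetD[OF W sW]] D(4)])
      fix x assume x: "x \<in> carrier E"
      let ?f = "\<lambda>M. finsum ?X f {..<M}" and ?g = "\<lambda>M. finsum F (\<lambda>j. f j x) {..<M}"
      have fin: "?f M \<in> ?W" for M
        using S.M.finsum_closed[of f "{..<M}"] f(1) by simp
      have fg: "?f M x = ?g M" for M
        by (rule poly_subspace_finsum[OF W S.module_axioms _ _ x]) (use f(1) in auto)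
      have sx: "s x \<in> carrier F" and Px: "P x \<in> carrier F" and gx: "?g M \<in> carrier F" for M
        using hom_polys_closed[OF subsetD[OF W sW] x] D(4) x
          hom_polys_closed[OF subsetD[OF W fin] x, of M] by (auto simp: fg)
      have lim1: "(\<lambda>M. N (E, F, ?f M \<ominus>\<^bsub>?X\<^esub> s)) \<longlonglongrightarrow> 0"
        using S.abs_sums_tendsto[OF s filterlim_lessThan_at_top] by simp
      have "abs_sums F (\<lambda>j. f j x) UNIV (P x)"
        using D(5)[OF x] x by (simp add: f_def)
      then have lim2: "(\<lambda>M. nrm F (?g M \<ominus>\<^bsub>F\<^esub> P x)) \<longlonglongrightarrow> 0"
        by (rule F.abs_sums_tendsto[OF _ filterlim_lessThan_at_top])
      \<comment> \<open>The difference is split at the value of a partial sum: convergence in \<open>Q\<close> controls the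
        first part, convergence in \<open>F\<close> the second.\<close>
      have le: "N (scalar_copy, F, w (s x \<ominus>\<^bsub>F\<^esub> P x)) \<le>
          N (E, F, ?f M \<ominus>\<^bsub>?X\<^esub> s) * nrm E x ^ n + C n * nrm F (?g M \<ominus>\<^bsub>F\<^esub> P x)" for M
      proof -
        have cl: "s x \<ominus>\<^bsub>F\<^esub> ?g M \<in> carrier F" "?g M \<ominus>\<^bsub>F\<^esub> P x \<in> carrier F"
          by (intro F.M.minus_closed sx gx Px)+
        have diff: "s \<ominus>\<^bsub>?X\<^esub> ?f M \<in> ?W"
          using S.M.minus_closed[of s "?f M"] sW fin by simp
        have "N (scalar_copy, F, w (s x \<ominus>\<^bsub>F\<^esub> P x)) =
            N (scalar_copy, F, w (s x \<ominus>\<^bsub>F\<^esub> ?g M) \<oplus>\<^bsub>?Y\<^esub> w (?g M \<ominus>\<^bsub>F\<^esub> P x))"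
          unfolding w_add[OF cl, symmetric] F.diff_add_diff[OF sx gx Px] ..
        also have "\<dots> \<le> N (scalar_copy, F, w (s x \<ominus>\<^bsub>F\<^esub> ?g M)) + N (scalar_copy, F, w (?g M \<ominus>\<^bsub>F\<^esub> P x))"
          using Y.nrm_triangle[of "w (s x \<ominus>\<^bsub>F\<^esub> ?g M)" "w (?g M \<ominus>\<^bsub>F\<^esub> P x)"] w(1)[OF cl(1)] w(1)[OF cl(2)]
          by simp
        also have "\<dots> \<le> N (E, F, s \<ominus>\<^bsub>?X\<^esub> ?f M) * nrm E x ^ n + C n * nrm F (?g M \<ominus>\<^bsub>F\<^esub> P x)"
        proof (rule add_mono[OF _ w(2)[OF cl(2)]])
          have "(s \<ominus>\<^bsub>?X\<^esub> ?f M) x = s x \<ominus>\<^bsub>F\<^esub> ?g M"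
            using poly_subspace_minus[OF W S.module_axioms sW fin x, of M] by (simp only: fg)
          then show "N (scalar_copy, F, w (s x \<ominus>\<^bsub>F\<^esub> ?g M)) \<le> N (E, F, s \<ominus>\<^bsub>?X\<^esub> ?f M) * nrm E x ^ n"
            using hyper_ideal_eval_bound[OF n E F diff x] by (simp only: w_def)
        qed
        also have "N (E, F, s \<ominus>\<^bsub>?X\<^esub> ?f M) = N (E, F, ?f M \<ominus>\<^bsub>?X\<^esub> s)"
          using S.nrm_diff_commute[of s "?f M"] sW fin by simp
        finally show ?thesis .
      qed
      have "N (scalar_copy, F, w (s x \<ominus>\<^bsub>F\<^esub> P x)) \<le> 0"
      proof (rule tendsto_le[OF sequentially_bot _ tendsto_const])
        show "(\<lambda>M. N (E, F, ?f M \<ominus>\<^bsub>?X\<^esub> s) * nrm E x ^ n + C n * nrm F (?g M \<ominus>\<^bsub>F\<^esub> P x)) \<longlonglongrightarrow> 0"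
          using tendsto_add[OF tendsto_mult_left_zero[OF lim1] tendsto_mult_right_zero[OF lim2]] by simp
      qed (use le in simp)
      have d: "s x \<ominus>\<^bsub>F\<^esub> P x \<in> carrier F"
        by (rule F.M.minus_closed[OF sx Px])
      have "nrm ?Y (w (s x \<ominus>\<^bsub>F\<^esub> P x)) = 0"
        using \<open>N (scalar_copy, F, w (s x \<ominus>\<^bsub>F\<^esub> P x)) \<le> 0\<close> Y.nrm_nonneg[of "w (s x \<ominus>\<^bsub>F\<^esub> P x)"] w(1)[OF d] by simp
      then have "w (s x \<ominus>\<^bsub>F\<^esub> P x) = \<zero>\<^bsub>?Y\<^esub>"
        using Y.nrm_eq_0_iff[of "w (s x \<ominus>\<^bsub>F\<^esub> P x)"] w(1)[OF d] by simp
      then have "w (s x \<ominus>\<^bsub>F\<^esub> P x) (Inl 1) = \<zero>\<^bsub>F\<^esub>"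
        by simp
      moreover have "w (s x \<ominus>\<^bsub>F\<^esub> P x) (Inl 1) = s x \<ominus>\<^bsub>F\<^esub> P x"
        unfolding w_def using F.smult_one[OF d] by simp
      ultimately show "s x = P x"
        using F.diff_eq_zero_iff[OF sx Px] by simp
    qed
    then show ?thesis
      using sW N_s by simp
  qed
  show "P \<in> ?W"
    using *[of 1] by simp
  show "N (E, F, P) \<le> C n * hyper_nuclear_norm n E F P"
  proof (rule tendsto_lowerbound)
    show "((\<lambda>e. C n * (hyper_nuclear_norm n E F P + e)) \<longlongrightarrow> C n * hyper_nuclear_norm n E F P) (at_right 0)"
      by (auto intro!: tendsto_eq_intros)
    show "\<forall>\<^sub>F e in at_right 0. N (E, F, P) \<le> C n * (hyper_nuclear_norm n E F P + e)"
      using eventually_at_right_less[of 0] by eventually_elim (use * in blast)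
  qed simp
qed

end

lemma HN_smallest_hyper_ideal:
  fixes Q :: "('k::{real_normed_field, banach}, 'u) class_polynomial set"
  assumes Q: "hyper_ideal C Q N"
  shows "HN \<subseteq> Q \<and> (\<forall>n\<ge>1. \<forall>E F. \<forall>P. Banach_space E \<longrightarrow> Banach_space F \<longrightarrow> P \<in> hyper_nuclear n E F \<longrightarrow>
    N (E, F, P) \<le> C n * hyper_nuclear_norm n E F P)"
proof (intro conjI allI impI subsetI)
  fix q :: "('k, 'u) class_polynomial" assume "q \<in> HN"
  then obtain E F P n where q: "q = (E, F, P)" "Banach_space E" "Banach_space F" "1 \<le> n"
      "P \<in> hyper_nuclear n E F"
    unfolding HN_def by blast
  show "q \<in> Q"
    using hyper_nuclear_in_hyper_ideal(1)[OF Q q(4,2,3,5)] by (simp add: comp_of_def q(1))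
qed (rule hyper_nuclear_in_hyper_ideal(2)[OF Q])

theorem theorem3p10:
  shows
   "two_sided_ideal (\<lambda>n. 1) (\<lambda>n. real n ^ n / fact n)
      (HN :: ('k::{real_normed_field, banach}, 'u) class_polynomial set) HN_norm \<and>
    (\<forall>C K (Q :: ('k, 'u) class_polynomial set) N. two_sided_ideal C K Q N \<longrightarrow>
       HN \<subseteq> Q \<and>
       (\<forall>n\<ge>1. \<forall>E F. \<forall>P. Banach_space E \<longrightarrow> Banach_space F \<longrightarrow> P \<in> hyper_nuclear n E F \<longrightarrow>
          N (E, F, P) \<le> C n * hyper_nuclear_norm n E F P)) \<and>
    hyper_ideal (\<lambda>n. 1) (HN :: ('k, 'u) class_polynomial set) HN_norm \<and>
    (\<forall>C (Q :: ('k, 'u) class_polynomial set) N. hyper_ideal C Q N \<longrightarrow>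
       HN \<subseteq> Q \<and>
       (\<forall>n\<ge>1. \<forall>E F. \<forall>P. Banach_space E \<longrightarrow> Banach_space F \<longrightarrow> P \<in> hyper_nuclear n E F \<longrightarrow>
          N (E, F, P) \<le> C n * hyper_nuclear_norm n E F P))"
proof (intro conjI[OF two_sided_ideal_HN] conjI[OF _ conjI] allI impI)
  show "hyper_ideal (\<lambda>n. 1) (HN :: ('k, 'u) class_polynomial set) HN_norm"
    by (rule hyper_ideal_if_two_sided_ideal[OF two_sided_ideal_HN])
next
  fix C K and Q :: "('k, 'u) class_polynomial set" and N assume "two_sided_ideal C K Q N"
  then show "HN \<subseteq> Q \<and> (\<forall>n\<ge>1. \<forall>E F. \<forall>P. Banach_space E \<longrightarrow> Banach_space F \<longrightarrow> P \<in> hyper_nuclear n E F \<longrightarrow>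
      N (E, F, P) \<le> C n * hyper_nuclear_norm n E F P)"
    by (intro HN_smallest_hyper_ideal hyper_ideal_if_two_sided_ideal)
next
  fix C and Q :: "('k, 'u) class_polynomial set" and N assume "hyper_ideal C Q N"
  then show "HN \<subseteq> Q \<and> (\<forall>n\<ge>1. \<forall>E F. \<forall>P. Banach_space E \<longrightarrow> Banach_space F \<longrightarrow> P \<in> hyper_nuclear n E F \<longrightarrow>
      N (E, F, P) \<le> C n * hyper_nuclear_norm n E F P)"
    by (rule HN_smallest_hyper_ideal)
qed

end
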